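(* Let $\Gamma$ be a finite thin-chordal graph. Then a group $H$ is (isomorphic to) a subgroup of $\mathbb{G}(\Gamma)$ if and only if $H\cong\mathbb{G}(\Gamma')$ for some induced subgraph $\Gamma'$ of the extension graph $\Gamma^e$.
   Context: Graphs are simple and undirected. $C_4$ is the cycle graph on $4$ vertices and $P_3$ is the path graph with $3$ edges (and $4$ vertices). A graph is thin-chordal if it is both $C_4$-free and $P_3$-free, i.e. it has no full (induced) subgraph isomorphic to $C_4$ or to $P_3$. For elements $g,h$ of a group, $[g,h]=g^{-1}h^{-1}gh$. For a graph $\Gamma$ (finite or infinite) with vertex set $V(\Gamma)$ and edge set $E$, the partially commutative group with commutation graph $\Gamma$ is $\mathbb{G}(\Gamma)=\langle V(\Gamma)\mid [x,y],\ \{x,y\}\in E\rangle$; for the empty graph this is the trivial group. The extension graph $\Gamma^e$ of $\Gamma$ is the (simple) graph with vertex set $\{g^{-1}xg\in\mathbb{G}(\Gamma)\mid x\in V(\Gamma),\ g\in\mathbb{G}(\Gamma)\}$ (a set of elements of $\mathbb{G}(\Gamma)$), with an edge joining distinct vertices $u$ and $v$ if and only if $[u,v]=1$ in $\mathbb{G}(\Gamma)$. An induced subgraph of $\Gamma^e$ is a graph isomorphic to a full subgraph of $\Gamma^e$ (possibly infinite, possibly empty). *)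

theory Defs
  imports "HOL-Algebra.Group"
begin

section \<open>Simple graphs\<close>

record 'a sgraph =
  verts :: "'a set"
  edges :: "'a set set"

definition simple_graph :: "'a sgraph \<Rightarrow> bool" where
  "simple_graph \<Gamma> \<longleftrightarrow> (\<forall>e\<in>edges \<Gamma>. e \<subseteq> verts \<Gamma> \<and> card e = 2)"

definition finite_graph :: "'a sgraph \<Rightarrow> bool" where
  "finite_graph \<Gamma> \<longleftrightarrow> simple_graph \<Gamma> \<and> finite (verts \<Gamma>)"

definition graph_isomorphic :: "'a sgraph \<Rightarrow> 'b sgraph \<Rightarrow> bool" where
  "graph_isomorphic \<Gamma> \<Delta> \<longleftrightarrow>
    (\<exists>f. bij_betw f (verts \<Gamma>) (verts \<Delta>) \<and>
         (\<forall>x\<in>verts \<Gamma>. \<forall>y\<in>verts \<Gamma>. {x, y} \<in> edges \<Gamma> \<longleftrightarrow> {f x, f y} \<in> edges \<Delta>))"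

definition full_subgraph :: "'a sgraph \<Rightarrow> 'a set \<Rightarrow> 'a sgraph" where
  "full_subgraph \<Gamma> W = \<lparr>verts = W, edges = {e \<in> edges \<Gamma>. e \<subseteq> W}\<rparr>"

definition induced_subgraph :: "'b sgraph \<Rightarrow> 'a sgraph \<Rightarrow> bool" where
  "induced_subgraph \<Delta> \<Gamma> \<longleftrightarrow>
    simple_graph \<Delta> \<and> (\<exists>W. W \<subseteq> verts \<Gamma> \<and> graph_isomorphic \<Delta> (full_subgraph \<Gamma> W))"

definition cycle_graph :: "nat \<Rightarrow> nat sgraph" where
  "cycle_graph n = \<lparr>verts = {..<n}, edges = {{i, (i + 1) mod n} | i. i < n}\<rparr>"

text \<open>The index of a path is its number of edges, so \<open>path_graph 3\<close> has four vertices.\<close>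

definition path_graph :: "nat \<Rightarrow> nat sgraph" where
  "path_graph n = \<lparr>verts = {..n}, edges = {{i, i + 1} | i. i < n}\<rparr>"

definition thin_chordal :: "'a sgraph \<Rightarrow> bool" where
  "thin_chordal \<Gamma> \<longleftrightarrow>
    \<not> induced_subgraph (cycle_graph 4) \<Gamma> \<and> \<not> induced_subgraph (path_graph 3) \<Gamma>"


section \<open>Groups given by presentations\<close>

text \<open>A letter \<open>(x, True)\<close> stands for the generator \<open>x\<close> and \<open>(x, False)\<close> for its formal inverse.\<close>

type_synonym 'a word = "('a \<times> bool) list"

definition words :: "'a set \<Rightarrow> 'a word set" where
  "words X = lists (X \<times> UNIV)"

text \<open>
  Equality of words in \<open>\<langle>X | R\<rangle>\<close>: the congruence on the free monoid \<open>words X\<close> generated by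
  free cancellation and by \<open>r = 1\<close> for every relator \<open>r \<in> R\<close>.
\<close>

inductive word_eq :: "'a set \<Rightarrow> 'a word set \<Rightarrow> 'a word \<Rightarrow> 'a word \<Rightarrow> bool"
  for X :: "'a set" and R :: "'a word set" where
  refl: "u \<in> words X \<Longrightarrow> word_eq X R u u"
| sym: "word_eq X R u v \<Longrightarrow> word_eq X R v u"
| trans: "word_eq X R u v \<Longrightarrow> word_eq X R v w \<Longrightarrow> word_eq X R u w"
| cancel: "u \<in> words X \<Longrightarrow> v \<in> words X \<Longrightarrow> x \<in> X \<Longrightarrow>
    word_eq X R (u @ [(x, b), (x, \<not> b)] @ v) (u @ v)"
| relator: "u \<in> words X \<Longrightarrow> v \<in> words X \<Longrightarrow> r \<in> R \<Longrightarrow> r \<in> words X \<Longrightarrow>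
    word_eq X R (u @ r @ v) (u @ v)"

definition word_class :: "'a set \<Rightarrow> 'a word set \<Rightarrow> 'a word \<Rightarrow> 'a word set" where
  "word_class X R w = {u. word_eq X R w u}"

definition presented_group :: "'a set \<Rightarrow> 'a word set \<Rightarrow> 'a word set monoid" where
  "presented_group X R =
    \<lparr>carrier = word_class X R ` words X,
     mult = (\<lambda>A B. \<Union>a\<in>A. \<Union>b\<in>B. word_class X R (a @ b)),
     one = word_class X R []\<rparr>"


section \<open>Partially commutative groups and extension graphs\<close>

definition commutator_word :: "'a \<Rightarrow> 'a \<Rightarrow> 'a word" where
  "commutator_word x y = [(x, False), (y, False), (x, True), (y, True)]"

definition pc_relators :: "'a sgraph \<Rightarrow> 'a word set" where
  "pc_relators \<Gamma> = {commutator_word x y | x y. {x, y} \<in> edges \<Gamma>}"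

definition pc_group :: "'a sgraph \<Rightarrow> 'a word set monoid" where
  "pc_group \<Gamma> = presented_group (verts \<Gamma>) (pc_relators \<Gamma>)"

definition pc_gen :: "'a sgraph \<Rightarrow> 'a \<Rightarrow> 'a word set" where
  "pc_gen \<Gamma> x = word_class (verts \<Gamma>) (pc_relators \<Gamma>) [(x, True)]"

definition commutator :: "('g, 'm) monoid_scheme \<Rightarrow> 'g \<Rightarrow> 'g \<Rightarrow> 'g" where
  "commutator G g h = inv\<^bsub>G\<^esub> g \<otimes>\<^bsub>G\<^esub> inv\<^bsub>G\<^esub> h \<otimes>\<^bsub>G\<^esub> g \<otimes>\<^bsub>G\<^esub> h"

definition extension_verts :: "'a sgraph \<Rightarrow> 'a word set set" where
  "extension_verts \<Gamma> =
    {inv\<^bsub>pc_group \<Gamma>\<^esub> g \<otimes>\<^bsub>pc_group \<Gamma>\<^esub> pc_gen \<Gamma> x \<otimes>\<^bsub>pc_group \<Gamma>\<^esub> g | x g.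
       x \<in> verts \<Gamma> \<and> g \<in> carrier (pc_group \<Gamma>)}"

definition extension_graph :: "'a sgraph \<Rightarrow> 'a word set sgraph" where
  "extension_graph \<Gamma> =
    \<lparr>verts = extension_verts \<Gamma>,
     edges = {{u, v} | u v. u \<in> extension_verts \<Gamma> \<and> v \<in> extension_verts \<Gamma> \<and> u \<noteq> v \<and>
                commutator (pc_group \<Gamma>) u v = \<one>\<^bsub>pc_group \<Gamma>\<^esub>}\<rparr>"


section \<open>Basic well-definedness facts\<close>

lemma simple_graph_full_subgraph:
  "simple_graph \<Gamma> \<Longrightarrow> simple_graph (full_subgraph \<Gamma> W)"
  by (auto simp: simple_graph_def full_subgraph_def)

lemma simple_graph_extension_graph: "simple_graph (extension_graph \<Gamma>)"
proof -
  have "e \<subseteq> extension_verts \<Gamma> \<and> card e = 2"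
    if "e = {u, v}" "u \<in> extension_verts \<Gamma>" "v \<in> extension_verts \<Gamma>" "u \<noteq> v" for e u v
    using that(2-4) unfolding that(1) card_2_iff by blast
  then show ?thesis
    unfolding simple_graph_def extension_graph_def sgraph.select_convs by blast
qed

lemma simple_graph_cycle_graph_4: "simple_graph (cycle_graph 4)"
  unfolding simple_graph_def
proof
  fix e assume "e \<in> edges (cycle_graph 4)"
  then obtain i :: nat where i: "i < 4" "e = {i, (i + 1) mod 4}"
    by (auto simp only: cycle_graph_def sgraph.select_convs mem_Collect_eq)
  have "i \<noteq> (i + 1) mod 4" using i(1) by presburger
  then have "card e = 2" unfolding i(2) card_2_iff by blast
  moreover have "e \<subseteq> verts (cycle_graph 4)"
    using i by (simp add: cycle_graph_def)
  ultimately show "e \<subseteq> verts (cycle_graph 4) \<and> card e = 2" by simp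
qed

lemma simple_graph_path_graph: "simple_graph (path_graph n)"
  by (auto simp: simple_graph_def path_graph_def)

lemma words_append [simp]: "u @ v \<in> words X \<longleftrightarrow> u \<in> words X \<and> v \<in> words X"
  by (auto simp: words_def)

lemma words_Cons [simp]: "a # v \<in> words X \<longleftrightarrow> fst a \<in> X \<and> v \<in> words X"
  by (cases a) (auto simp: words_def)

lemma words_Nil [simp]: "[] \<in> words X"
  by (auto simp: words_def)

lemma word_eq_words: "word_eq X R u v \<Longrightarrow> u \<in> words X \<and> v \<in> words X"
  by (induction rule: word_eq.induct) auto

lemma word_eq_append_left: "word_eq X R u v \<Longrightarrow> w \<in> words X \<Longrightarrow> word_eq X R (w @ u) (w @ v)"
proof (induction rule: word_eq.induct)
  case (refl u)
  then show ?case by (simp add: word_eq.refl)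
next
  case (sym u v)
  show ?case by (rule word_eq.sym[OF sym.IH[OF sym.prems]])
next
  case (trans u v w)
  show ?case by (rule word_eq.trans[OF trans.IH(1)[OF trans.prems] trans.IH(2)[OF trans.prems]])
next
  case (cancel u v x b)
  then show ?case using word_eq.cancel[of "w @ u" X v x R b] by simp
next
  case (relator u v r)
  then show ?case using word_eq.relator[of "w @ u" X v r R] by simp
qed

lemma word_eq_append_right: "word_eq X R u v \<Longrightarrow> w \<in> words X \<Longrightarrow> word_eq X R (u @ w) (v @ w)"
proof (induction rule: word_eq.induct)
  case (refl u)
  then show ?case by (simp add: word_eq.refl)
next
  case (sym u v)
  show ?case by (rule word_eq.sym[OF sym.IH[OF sym.prems]])
next
  case (trans u v w)
  show ?case by (rule word_eq.trans[OF trans.IH(1)[OF trans.prems] trans.IH(2)[OF trans.prems]])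
next
  case (cancel u v x b)
  then show ?case using word_eq.cancel[of u X "v @ w" x R b] by simp
next
  case (relator u v r)
  then show ?case using word_eq.relator[of u X "v @ w" r R] by simp
qed

lemma word_eq_append:
  "word_eq X R u u' \<Longrightarrow> word_eq X R v v' \<Longrightarrow> word_eq X R (u @ v) (u' @ v')"
  by (rule word_eq.trans[OF word_eq_append_right word_eq_append_left])
    (auto dest: word_eq_words)

lemma word_class_eq_iff:
  assumes "u \<in> words X"
  shows "word_class X R u = word_class X R v \<longleftrightarrow> word_eq X R u v"
proof
  assume "word_class X R u = word_class X R v"
  moreover have "u \<in> word_class X R u"
    using assms by (simp add: word_class_def word_eq.refl)
  ultimately show "word_eq X R u v"
    by (simp add: word_class_def word_eq.sym)
next
  assume "word_eq X R u v"
  then show "word_class X R u = word_class X R v"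
    unfolding word_class_def
    by (intro Collect_cong iffI) (erule word_eq.trans[OF word_eq.sym], assumption, rule word_eq.trans)
qed

lemma presented_group_mult:
  assumes "u \<in> words X" "v \<in> words X"
  shows "word_class X R u \<otimes>\<^bsub>presented_group X R\<^esub> word_class X R v = word_class X R (u @ v)"
proof -
  have "word_class X R (a @ b) = word_class X R (u @ v)"
    if "a \<in> word_class X R u" "b \<in> word_class X R v" for a b
    using that assms word_class_eq_iff[of "u @ v" X R "a @ b"]
    by (simp add: word_class_def word_eq_append)
  moreover have "u \<in> word_class X R u" "v \<in> word_class X R v"
    using assms by (auto simp: word_class_def word_eq.refl)
  ultimately have
    "(\<Union>a\<in>word_class X R u. \<Union>b\<in>word_class X R v. word_class X R (a @ b)) = word_class X R (u @ v)"
    by blast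
  then show ?thesis by (simp add: presented_group_def)
qed

lemma word_eq_inverse:
  "w \<in> words X \<Longrightarrow> word_eq X R (rev (map (apsnd Not) w) @ w) []"
proof (induction w)
  case Nil
  then show ?case by (simp add: word_eq.refl)
next
  case (Cons a w)
  obtain x b where a: "a = (x, b)" by (cases a)
  let ?w' = "rev (map (apsnd Not) w)"
  have w: "w \<in> words X" "x \<in> X" using Cons.prems a by auto
  have w': "?w' \<in> words X"
    using word_eq_words[OF Cons.IH[OF w(1)]] by simp
  have "word_eq X R (?w' @ [(x, \<not> b), (x, \<not> \<not> b)] @ w) (?w' @ w)"
    by (rule word_eq.cancel[OF w' w])
  then show ?case
    using word_eq.trans[OF _ Cons.IH[OF w(1)]] a by simp
qed

lemma group_presented_group: "group (presented_group X R)"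
proof (rule groupI)
  let ?G = "presented_group X R"
  have carr: "carrier ?G = word_class X R ` words X"
    and one: "\<one>\<^bsub>?G\<^esub> = word_class X R []"
    by (simp_all add: presented_group_def)
  show "\<one>\<^bsub>?G\<^esub> \<in> carrier ?G" by (auto simp: carr one)
  fix A assume "A \<in> carrier ?G"
  then obtain a where a: "a \<in> words X" "A = word_class X R a" by (auto simp: carr)
  show "\<one>\<^bsub>?G\<^esub> \<otimes>\<^bsub>?G\<^esub> A = A" using a by (simp add: one presented_group_mult)
  have "word_eq X R (rev (map (apsnd Not) a) @ a) []" by (rule word_eq_inverse[OF a(1)])
  moreover from word_eq_words[OF this] have "rev (map (apsnd Not) a) \<in> words X" by simp
  ultimately show "\<exists>B\<in>carrier ?G. B \<otimes>\<^bsub>?G\<^esub> A = \<one>\<^bsub>?G\<^esub>"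
    using a by (intro bexI[of _ "word_class X R (rev (map (apsnd Not) a))"])
      (auto simp: carr one presented_group_mult word_class_eq_iff)
  fix B assume "B \<in> carrier ?G"
  then obtain b where b: "b \<in> words X" "B = word_class X R b" by (auto simp: carr)
  show "A \<otimes>\<^bsub>?G\<^esub> B \<in> carrier ?G" using a b by (auto simp: carr presented_group_mult)
  fix C assume "C \<in> carrier ?G"
  then obtain c where c: "c \<in> words X" "C = word_class X R c" by (auto simp: carr)
  show "A \<otimes>\<^bsub>?G\<^esub> B \<otimes>\<^bsub>?G\<^esub> C = A \<otimes>\<^bsub>?G\<^esub> (B \<otimes>\<^bsub>?G\<^esub> C)"
    using a b c by (simp add: presented_group_mult)
qed

lemma group_pc_group: "group (pc_group \<Gamma>)"
  by (simp add: pc_group_def group_presented_group)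

end

(*
  A nonempty finite thin-chordal graph has a vertex joined to all others or is a disjoint union of
  two smaller thin-chordal graphs, so the group is built up from the trivial group by direct products
  with Z and by free products, and one inducts on the number of generators. For Z x G0 a subgroup
  is, up to isomorphism, a subgroup of G0 or its product with Z. For a free product A * B the
  Kurosh subgroup theorem splits a subgroup into conjugates of subgroups of A and B and a free
  group; conversely A * B contains countably many conjugates of A and of B that generate their
  free product, which is enough room both for these pieces inside the extension graph and for the
  components of the extension graph inside the group.

  Everything takes place inside one group. A set X of elements is encoded by "pc_basis": words over X
  with trivial value are trivial in the partially commutative group of the commutation graph of X.
  Free products occur only as families of subgroups in which no alternating product is trivial.
  Kurosh's theorem is proved by letting the group act on (reduced words) x (cosets).
*)

theory Submission
  imports Defs "HOL-Algebra.Elementary_Groups" "HOL-Algebra.Bij" "HOL-Library.Countable_Set"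
begin

section \<open>Evaluating words\<close>

text \<open>The induction runs over generating subsets of one fixed group and carries two
  statements, \<open>subgroups_embed\<close> and \<open>extension_embeds\<close>, one for each
  direction. In both, the vertex map \<open>e\<close> need not extend to a homomorphism: it
  preserves and reflects commutation only, because groups are compared up to isomorphism. This
  freedom is what allows infinitely many pieces to be moved apart independently of each other. The
  obstacle is the free product, where a subgroup may have infinitely many Kurosh factors and the
  extension graph infinitely many components, against two given factors. The extra room comes from
  Kurosh's theorem itself: an explicit action on integers has infinitely many points fixed by either
  factor, and each of them contributes a whole conjugate as a free factor of a point stabiliser. For
  the stabiliser of a coset of \<open>A j\<close> the same theorem yields malnormality, which
  separates the components of the extension graph. Hence it is stated for stabilisers in an
  arbitrary transitive action.\<close>

fun word_val :: "('g, 'm) monoid_scheme \<Rightarrow> ('a \<Rightarrow> 'g) \<Rightarrow> 'a word \<Rightarrow> 'g" where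
  "word_val G f [] = \<one>\<^bsub>G\<^esub>"
| "word_val G f ((x, b) # w) = (if b then f x else inv\<^bsub>G\<^esub> f x) \<otimes>\<^bsub>G\<^esub> word_val G f w"

definition comm :: "('g, 'm) monoid_scheme \<Rightarrow> 'g \<Rightarrow> 'g \<Rightarrow> bool" where
  "comm G x y \<longleftrightarrow> x \<otimes>\<^bsub>G\<^esub> y = y \<otimes>\<^bsub>G\<^esub> x"

lemma comm_refl [simp]: "comm G x x"
  by (simp add: comm_def)

lemma comm_sym: "comm G x y \<longleftrightarrow> comm G y x"
  by (auto simp: comm_def)

lemma word_val_cong:
  "w \<in> words X \<Longrightarrow> (\<And>x. x \<in> X \<Longrightarrow> f x = g x) \<Longrightarrow> word_val G f w = word_val G g w"
  by (induction G f w rule: word_val.induct) auto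

lemma word_val_map: "word_val G f (map (apfst h) w) = word_val G (f \<circ> h) w"
  by (induction G "f \<circ> h" w rule: word_val.induct) auto

lemma words_map: "w \<in> words X \<Longrightarrow> h ` X \<subseteq> Y \<Longrightarrow> map (apfst h) w \<in> words Y"
  by (induction w) auto

lemma words_mono: "w \<in> words X \<Longrightarrow> X \<subseteq> Y \<Longrightarrow> w \<in> words Y"
  by (induction w) auto

lemma words_rev_inverse: "w \<in> words X \<Longrightarrow> rev (map (apsnd Not) w) \<in> words X"
  by (induction w) auto

lemma word_eq_map:
  assumes "word_eq X (pc_relators \<Gamma>) u v" and "h ` X \<subseteq> Y"
    and "\<And>x y. x \<in> X \<Longrightarrow> y \<in> X \<Longrightarrow> {x, y} \<in> edges \<Gamma> \<Longrightarrow> {h x, h y} \<in> edges \<Delta>"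
  shows "word_eq Y (pc_relators \<Delta>) (map (apfst h) u) (map (apfst h) v)"
  using assms(1)
proof (induction rule: word_eq.induct)
  case (refl u)
  then show ?case using assms(2) by (intro word_eq.refl words_map)
next
  case (sym u v)
  then show ?case by (rule_tac word_eq.sym)
next
  case (trans u v w)
  from trans.IH show ?case by (rule word_eq.trans)
next
  case (cancel u v x b)
  have "h x \<in> Y" using cancel assms(2) by auto
  from word_eq.cancel[OF words_map[OF cancel(1) assms(2)] words_map[OF cancel(2) assms(2)] this]
  show ?case by simp
next
  case (relator u v r)
  then obtain x y where r: "r = commutator_word x y" "{x, y} \<in> edges \<Gamma>"
    by (auto simp: pc_relators_def)
  then have xy: "x \<in> X" "y \<in> X" using relator(4) by (auto simp: commutator_word_def)
  have "map (apfst h) r = commutator_word (h x) (h y)" by (simp add: r commutator_word_def)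
  then have "map (apfst h) r \<in> pc_relators \<Delta>"
    using assms(3)[OF xy r(2)] by (auto simp: pc_relators_def)
  from word_eq.relator[OF words_map[OF relator(1) assms(2)] words_map[OF relator(2) assms(2)] this
      words_map[OF relator(4) assms(2)]]
  show ?case by simp
qed

context group
begin

lemma mult_inv_cancel [simp]:
  assumes "x \<in> carrier G" "y \<in> carrier G"
  shows "x \<otimes> (inv x \<otimes> y) = y" "inv x \<otimes> (x \<otimes> y) = y"
  using assms by (simp_all add: m_assoc[symmetric])

lemma comm_inv: "comm G x y \<Longrightarrow> x \<in> carrier G \<Longrightarrow> y \<in> carrier G \<Longrightarrow> comm G (inv x) y"
  unfolding comm_def by (metis inv_closed inv_solve_left inv_solve_right m_assoc m_closed)

lemma comm_mult:
  "comm G x z \<Longrightarrow> comm G y z \<Longrightarrow> x \<in> carrier G \<Longrightarrow> y \<in> carrier G \<Longrightarrow> z \<in> carrier G \<Longrightarrow>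
    comm G (x \<otimes> y) z"
  unfolding comm_def by (metis m_assoc)

lemma comm_generate:
  assumes "g \<in> generate G S" "S \<subseteq> carrier G" "z \<in> carrier G" "\<And>s. s \<in> S \<Longrightarrow> comm G s z"
  shows "comm G g z"
  using assms(1)
proof (induction rule: generate.induct)
  case one
  then show ?case using assms by (simp add: comm_def)
next
  case (incl h)
  then show ?case using assms by auto
next
  case (inv h)
  then show ?case using assms by (auto intro: comm_inv)
next
  case (eng h1 h2)
  then show ?case using assms by (auto intro: comm_mult generate_in_carrier)
qed

abbreviation conj_by :: "'a \<Rightarrow> 'a \<Rightarrow> 'a" where
  "conj_by g x \<equiv> inv g \<otimes> x \<otimes> g"

lemma conj_eq_iff:
  assumes "g \<in> carrier G" "x \<in> carrier G" "y \<in> carrier G"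
  shows "conj_by g x = conj_by g y \<longleftrightarrow> x = y"
  using assms by auto

lemma conj_mult:
  assumes "g \<in> carrier G" "x \<in> carrier G" "y \<in> carrier G"
  shows "conj_by g (x \<otimes> y) = (conj_by g x) \<otimes> (conj_by g y)"
  using assms by (simp add: m_assoc)

lemma conj_inv:
  assumes "g \<in> carrier G" "x \<in> carrier G"
  shows "inv (conj_by g x) = inv g \<otimes> inv x \<otimes> g"
  using assms by (simp add: inv_mult_group m_assoc)

lemma comm_conj_iff:
  assumes "g \<in> carrier G" "x \<in> carrier G" "y \<in> carrier G"
  shows "comm G (conj_by g x) (conj_by g y) \<longleftrightarrow> comm G x y"
  unfolding comm_def using assms by (simp only: conj_mult[symmetric] conj_eq_iff m_closed)

lemma conj_conj:
  assumes "g \<in> carrier G" "h \<in> carrier G" "x \<in> carrier G"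
  shows "conj_by h (conj_by g x) = inv (g \<otimes> h) \<otimes> x \<otimes> (g \<otimes> h)"
  using assms by (simp add: inv_mult_group m_assoc)

lemma conj_cancel:
  assumes "g \<in> carrier G" "x \<in> carrier G"
  shows "g \<otimes> (conj_by g x) \<otimes> inv g = x" "conj_by g (g \<otimes> x \<otimes> inv g) = x"
  using assms by (simp_all add: m_assoc)

lemma word_val_closed:
  "w \<in> words X \<Longrightarrow> f \<in> X \<rightarrow> carrier G \<Longrightarrow> word_val G f w \<in> carrier G"
  by (induction w) (auto simp: Pi_iff)

lemma word_val_append:
  "u \<in> words X \<Longrightarrow> v \<in> words X \<Longrightarrow> f \<in> X \<rightarrow> carrier G \<Longrightarrow>
    word_val G f (u @ v) = word_val G f u \<otimes> word_val G f v"
  by (induction u) (auto simp: m_assoc word_val_closed Pi_iff)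

lemma word_val_rev_inverse:
  "w \<in> words X \<Longrightarrow> f \<in> X \<rightarrow> carrier G \<Longrightarrow>
    word_val G f (rev (map (apsnd Not) w)) = inv (word_val G f w)"
proof (induction w)
  case (Cons a w)
  then obtain x b where a: "a = (x, b)" "x \<in> X" "w \<in> words X" "f x \<in> carrier G"
    by (cases a) auto
  then show ?case
    using Cons by (simp add: word_val_append[of _ X] words_rev_inverse inv_mult_group word_val_closed)
qed simp

text \<open>Von Dyck's theorem at the level of words: free cancellations and commutators of adjacent
  vertices evaluate to \<open>\<one>\<close>, so evaluation is constant on classes.\<close>

lemma word_val_eq:
  assumes "word_eq X (pc_relators \<Gamma>) u v" and f: "f \<in> X \<rightarrow> carrier G"
    and "\<And>x y. x \<in> X \<Longrightarrow> y \<in> X \<Longrightarrow> {x, y} \<in> edges \<Gamma> \<Longrightarrow> comm G (f x) (f y)"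
  shows "word_val G f u = word_val G f v"
  using assms(1)
proof (induction rule: word_eq.induct)
  case (cancel u v x b)
  then have "f x \<in> carrier G" using f by auto
  then have "word_val G f ([(x, b), (x, \<not> b)] @ v) = word_val G f v"
    using cancel f by (auto simp: m_assoc[symmetric] word_val_closed)
  then show ?case using cancel f by (simp add: word_val_append[of _ X])
next
  case (relator u v r)
  then obtain x y where r: "r = commutator_word x y" "{x, y} \<in> edges \<Gamma>"
    by (auto simp: pc_relators_def)
  then have xy: "x \<in> X" "y \<in> X" using relator(4) by (auto simp: commutator_word_def)
  then have c: "f x \<in> carrier G" "f y \<in> carrier G" "f x \<otimes> f y = f y \<otimes> f x"
    using f assms(3)[OF xy r(2)] by (auto simp: comm_def)
  have "word_val G f r = inv (f x) \<otimes> (inv (f y) \<otimes> (f x \<otimes> f y))"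
    using c by (simp add: r commutator_word_def)
  also have "\<dots> = \<one>" using c by (metis inv_closed inv_mult_group l_inv m_assoc m_closed)
  finally show ?case using relator f by (simp add: word_val_append[of _ X] word_val_closed)
qed auto

lemma generate_word_val:
  assumes f: "f \<in> X \<rightarrow> carrier G"
  shows "generate G (f ` X) = word_val G f ` words X"
proof
  show "generate G (f ` X) \<subseteq> word_val G f ` words X"
  proof
    fix g assume "g \<in> generate G (f ` X)"
    then show "g \<in> word_val G f ` words X"
    proof (induction rule: generate.induct)
      case one
      show ?case by (rule image_eqI[of _ _ "[]"]) auto
    next
      case (incl h)
      then obtain x where "x \<in> X" "h = f x" by auto
      then show ?case using f by (intro image_eqI[of _ _ "[(x, True)]"]) (auto simp: Pi_iff)
    next
      case (inv h)
      then obtain x where "x \<in> X" "h = f x" by auto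
      then show ?case using f by (intro image_eqI[of _ _ "[(x, False)]"]) (auto simp: Pi_iff)
    next
      case (eng h1 h2)
      then obtain u v where "u \<in> words X" "v \<in> words X" "h1 = word_val G f u" "h2 = word_val G f v"
        by auto
      then show ?case using f by (intro image_eqI[of _ _ "u @ v"]) (auto simp: word_val_append)
    qed
  qed
  have "word_val G f w \<in> generate G (f ` X)" if "w \<in> words X" for w
    using that
  proof (induction w)
    case Nil
    then show ?case by (simp add: generate.one)
  next
    case (Cons a w)
    then obtain x b where a: "a = (x, b)" "x \<in> X" "w \<in> words X" by (cases a) auto
    then have "f x \<in> f ` X" by simp
    then show ?case using Cons.IH[OF a(3)]
      by (auto simp: a(1) intro: generate.eng generate.incl generate.inv)
  qed
  then show "word_val G f ` words X \<subseteq> generate G (f ` X)" by auto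
qed

lemma generate_word_val_id:
  "X \<subseteq> carrier G \<Longrightarrow> generate G X = word_val G id ` words X"
  using generate_word_val[of id X] by (auto simp: Pi_iff subset_iff)

lemma subgroup_generate: "X \<subseteq> carrier G \<Longrightarrow> subgroup (generate G X) G"
  by (rule generate_is_subgroup)

end

text \<open>Multiplicativity is asked on \<open>S\<close> alone because maps such as the retraction
  that kills a central generator are controlled only on a generated subgroup.\<close>

lemma word_val_hom:
  assumes "group G" "group P" "f \<in> X \<rightarrow> carrier G" "subgroup S G" "f ` X \<subseteq> S"
    and "\<phi> \<in> S \<rightarrow> carrier P"
    and "\<And>g h. g \<in> S \<Longrightarrow> h \<in> S \<Longrightarrow> \<phi> (g \<otimes>\<^bsub>G\<^esub> h) = \<phi> g \<otimes>\<^bsub>P\<^esub> \<phi> h"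
    and "w \<in> words X"
  shows "\<phi> (word_val G f w) = word_val P (\<phi> \<circ> f) w"
proof -
  interpret G: group G by fact
  interpret P: group P by fact
  have H: "group (G\<lparr>carrier := S\<rparr>)" using subgroup.subgroup_is_group[OF assms(4,1)] .
  interpret h: group_hom "G\<lparr>carrier := S\<rparr>" P \<phi>
    by (rule group_hom.intro[OF H assms(2)]) (unfold_locales, use assms(6,7) in \<open>auto simp: hom_def\<close>)
  have 1: "\<phi> \<one>\<^bsub>G\<^esub> = \<one>\<^bsub>P\<^esub>" using h.hom_one by simp
  have 2: "\<phi> (inv\<^bsub>G\<^esub> x) = inv\<^bsub>P\<^esub> \<phi> x" if "x \<in> S" for x
    using h.hom_inv[of x] G.m_inv_consistent[OF assms(4) that] that by simp
  show ?thesis using assms(8)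
  proof (induction w)
    case (Cons a w)
    then obtain x b where a: "a = (x, b)" "x \<in> X" "w \<in> words X" by (cases a) auto
    have fx: "f x \<in> S" using a assms(5) by auto
    have wS: "word_val G f w \<in> S"
      using G.generate_word_val[OF assms(3)] G.generate_subgroup_incl[OF assms(5,4)] a(3) by auto
    show ?case using Cons.IH[OF a(3)] fx wS a 2 assms(7) subgroup.m_inv_closed[OF assms(4)]
      by auto
  qed (simp add: 1)
qed

section \<open>Faithfully embedded generating sets\<close>

definition comm_graph :: "('g, 'm) monoid_scheme \<Rightarrow> 'g set \<Rightarrow> 'g sgraph" where
  "comm_graph G X = \<lparr>verts = X, edges = {{x, y} | x y. x \<in> X \<and> y \<in> X \<and> x \<noteq> y \<and> comm G x y}\<rparr>"

lemma verts_comm_graph [simp]: "verts (comm_graph G X) = X"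
  by (simp add: comm_graph_def)

lemma edges_comm_graph: "{x, y} \<in> edges (comm_graph G X) \<longleftrightarrow> x \<in> X \<and> y \<in> X \<and> x \<noteq> y \<and> comm G x y"
  by (auto simp: comm_graph_def doubleton_eq_iff comm_sym)

lemma simple_graph_comm_graph: "simple_graph (comm_graph G X)"
  by (auto simp: simple_graph_def comm_graph_def card_2_iff)

text \<open>Injectivity of the canonical map from \<open>pc_group (comm_graph G X)\<close> to
  \<open>G\<close>, phrased without that second group. The vertices being group elements, the graph
  is determined by \<open>X\<close>.\<close>

definition pc_basis :: "('g, 'm) monoid_scheme \<Rightarrow> 'g set \<Rightarrow> bool" where
  "pc_basis G X \<longleftrightarrow> X \<subseteq> carrier G \<and>
    (\<forall>w\<in>words X. word_val G id w = \<one>\<^bsub>G\<^esub> \<longrightarrow> word_eq X (pc_relators (comm_graph G X)) w [])"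

lemma pc_basis_carrier: "pc_basis G X \<Longrightarrow> X \<subseteq> carrier G"
  by (simp add: pc_basis_def)

lemma carrier_pc_group: "carrier (pc_group \<Gamma>) = word_class (verts \<Gamma>) (pc_relators \<Gamma>) ` words (verts \<Gamma>)"
  by (simp add: pc_group_def presented_group_def)

lemma one_pc_group: "\<one>\<^bsub>pc_group \<Gamma>\<^esub> = word_class (verts \<Gamma>) (pc_relators \<Gamma>) []"
  by (simp add: pc_group_def presented_group_def)

lemma pc_gen_closed: "pc_gen \<Gamma> \<in> verts \<Gamma> \<rightarrow> carrier (pc_group \<Gamma>)"
  by (auto simp: carrier_pc_group pc_gen_def)

lemma mult_pc_group:
  assumes "u \<in> words (verts \<Gamma>)" "v \<in> words (verts \<Gamma>)"
  shows "word_class (verts \<Gamma>) (pc_relators \<Gamma>) u \<otimes>\<^bsub>pc_group \<Gamma>\<^esub> word_class (verts \<Gamma>) (pc_relators \<Gamma>) v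
    = word_class (verts \<Gamma>) (pc_relators \<Gamma>) (u @ v)"
  using presented_group_mult[OF assms] by (simp add: pc_group_def)

lemma inv_pc_gen:
  assumes "x \<in> verts \<Gamma>"
  shows "inv\<^bsub>pc_group \<Gamma>\<^esub> pc_gen \<Gamma> x = word_class (verts \<Gamma>) (pc_relators \<Gamma>) [(x, False)]"
proof -
  interpret group "pc_group \<Gamma>" by (rule group_pc_group)
  have "word_eq (verts \<Gamma>) (pc_relators \<Gamma>) ([] @ [(x, False), (x, \<not> False)] @ []) ([] @ [])"
    by (rule word_eq.cancel) (use assms in auto)
  then have "word_class (verts \<Gamma>) (pc_relators \<Gamma>) [(x, False)] \<otimes>\<^bsub>pc_group \<Gamma>\<^esub> pc_gen \<Gamma> x = \<one>\<^bsub>pc_group \<Gamma>\<^esub>"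
    using assms by (simp add: pc_gen_def mult_pc_group one_pc_group word_class_eq_iff)
  then show ?thesis
    using assms pc_gen_closed[of \<Gamma>] by (intro inv_equality) (auto simp: carrier_pc_group)
qed

lemma word_val_pc_gen:
  "w \<in> words (verts \<Gamma>) \<Longrightarrow>
    word_val (pc_group \<Gamma>) (pc_gen \<Gamma>) w = word_class (verts \<Gamma>) (pc_relators \<Gamma>) w"
proof (induction w)
  case (Cons a w)
  then obtain x b where a: "a = (x, b)" "x \<in> verts \<Gamma>" "w \<in> words (verts \<Gamma>)" by (cases a) auto
  then show ?case using Cons.IH mult_pc_group[of "[(x, b)]" \<Gamma> w]
    by (cases b) (simp_all add: inv_pc_gen, simp add: pc_gen_def)
qed (simp add: one_pc_group)

lemma pc_gen_comm:
  assumes "{x, y} \<in> edges \<Gamma>" "x \<in> verts \<Gamma>" "y \<in> verts \<Gamma>"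
  shows "comm (pc_group \<Gamma>) (pc_gen \<Gamma> x) (pc_gen \<Gamma> y)"
proof -
  interpret group "pc_group \<Gamma>" by (rule group_pc_group)
  let ?x = "pc_gen \<Gamma> x" and ?y = "pc_gen \<Gamma> y"
  have c: "?x \<in> carrier (pc_group \<Gamma>)" "?y \<in> carrier (pc_group \<Gamma>)"
    using assms pc_gen_closed[of \<Gamma>] by auto
  have r: "commutator_word x y \<in> words (verts \<Gamma>)" using assms by (simp add: commutator_word_def)
  moreover have "commutator_word x y \<in> pc_relators \<Gamma>" using assms by (auto simp: pc_relators_def)
  ultimately have "word_eq (verts \<Gamma>) (pc_relators \<Gamma>) ([] @ commutator_word x y @ []) ([] @ [])"
    by (intro word_eq.relator) auto
  then have "word_val (pc_group \<Gamma>) (pc_gen \<Gamma>) (commutator_word x y) = \<one>\<^bsub>pc_group \<Gamma>\<^esub>"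
    using r by (simp add: word_val_pc_gen one_pc_group word_class_eq_iff)
  then have "inv\<^bsub>pc_group \<Gamma>\<^esub> (?y \<otimes>\<^bsub>pc_group \<Gamma>\<^esub> ?x) \<otimes>\<^bsub>pc_group \<Gamma>\<^esub> (?x \<otimes>\<^bsub>pc_group \<Gamma>\<^esub> ?y) = \<one>\<^bsub>pc_group \<Gamma>\<^esub>"
    using c by (simp add: commutator_word_def inv_mult_group m_assoc)
  then have "?x \<otimes>\<^bsub>pc_group \<Gamma>\<^esub> ?y = ?y \<otimes>\<^bsub>pc_group \<Gamma>\<^esub> ?x \<otimes>\<^bsub>pc_group \<Gamma>\<^esub> \<one>\<^bsub>pc_group \<Gamma>\<^esub>"
    using c by (subst (asm) inv_solve_left') auto
  then show ?thesis using c by (simp add: comm_def)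
qed

section \<open>The universal property of a faithful generating set\<close>

context group
begin

text \<open>If \<open>u\<close> and \<open>v\<close> have equal value in \<open>G\<close>, then
  \<open>u\<close> followed by the inverse of \<open>v\<close> is trivial in the presented group,
  hence also in \<open>P\<close>; so evaluation in \<open>P\<close> descends to elements of
  \<open>generate G X\<close>.\<close>

lemma pc_basis_extend:
  assumes X: "pc_basis G X" and P: "group P" and f: "f \<in> X \<rightarrow> carrier P"
    and c: "\<And>x y. x \<in> X \<Longrightarrow> y \<in> X \<Longrightarrow> comm G x y \<Longrightarrow> comm P (f x) (f y)"
  obtains \<phi> where "\<And>w. w \<in> words X \<Longrightarrow> \<phi> (word_val G id w) = word_val P f w"
    and "\<phi> \<in> generate G X \<rightarrow> carrier P"
    and "\<And>g h. g \<in> generate G X \<Longrightarrow> h \<in> generate G X \<Longrightarrow> \<phi> (g \<otimes> h) = \<phi> g \<otimes>\<^bsub>P\<^esub> \<phi> h"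
    and "\<And>x. x \<in> X \<Longrightarrow> \<phi> x = f x"
proof -
  interpret P: group P by fact
  have Xc: "id \<in> X \<rightarrow> carrier G" "X \<subseteq> carrier G" using pc_basis_carrier[OF X] by auto
  have eq: "word_val P f u = word_val P f v"
    if uv: "u \<in> words X" "v \<in> words X" "word_val G id u = word_val G id v" for u v
  proof -
    let ?v = "rev (map (apsnd Not) v)"
    have "word_val G id (u @ ?v) = \<one>"
      using uv Xc by (simp add: word_val_append[of _ X] word_val_rev_inverse words_rev_inverse word_val_closed)
    then have "word_eq X (pc_relators (comm_graph G X)) (u @ ?v) []"
      using X uv by (auto simp: pc_basis_def words_rev_inverse)
    then have "word_val P f (u @ ?v) = word_val P f []"
      by (rule P.word_val_eq[OF _ f]) (auto simp: edges_comm_graph c)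
    then have "word_val P f u \<otimes>\<^bsub>P\<^esub> inv\<^bsub>P\<^esub> word_val P f v = \<one>\<^bsub>P\<^esub>"
      using uv f by (simp add: P.word_val_append[of _ X] P.word_val_rev_inverse words_rev_inverse)
    then show ?thesis
      using P.word_val_closed[OF uv(1) f] P.word_val_closed[OF uv(2) f]
      by (simp add: P.inv_solve_right')
  qed
  define \<phi> where "\<phi> g = word_val P f (SOME w. w \<in> words X \<and> word_val G id w = g)" for g
  have \<phi>: "\<phi> (word_val G id w) = word_val P f w" if "w \<in> words X" for w
  proof -
    have "\<exists>v. v \<in> words X \<and> word_val G id v = word_val G id w" using that by auto
    then show ?thesis unfolding \<phi>_def by (rule someI2_ex) (use that in \<open>blast intro: eq\<close>)
  qed
  have gen: "generate G X = word_val G id ` words X" using generate_word_val_id Xc by blast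
  show ?thesis
  proof (rule that[of \<phi>])
    show "\<phi> \<in> generate G X \<rightarrow> carrier P" using f by (auto simp: gen \<phi> P.word_val_closed)
    show "\<phi> (g \<otimes> h) = \<phi> g \<otimes>\<^bsub>P\<^esub> \<phi> h" if gh: "g \<in> generate G X" "h \<in> generate G X" for g h
    proof -
      obtain u v where uv: "u \<in> words X" "v \<in> words X" "g = word_val G id u" "h = word_val G id v"
        using gh by (auto simp: gen)
      then have "g \<otimes> h = word_val G id (u @ v)" using Xc by (simp add: word_val_append[of _ X])
      then show ?thesis using uv f by (simp add: \<phi> P.word_val_append[of _ X])
    qed
    show "\<phi> x = f x" if "x \<in> X" for x
    proof -
      have "word_val G id [(x, True)] = x" using Xc that by auto
      moreover have "word_val P f [(x, True)] = f x" using f that by (auto simp: Pi_iff)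
      ultimately show ?thesis using \<phi>[of "[(x, True)]"] that by auto
    qed
  qed (use \<phi> in auto)
qed

text \<open>Retraction onto a full subgraph: sending the generators outside \<open>Y\<close> to the
  identity of \<open>pc_group (comm_graph G Y)\<close> respects commutation and maps a word over
  \<open>Y\<close> to its own class.\<close>

lemma pc_basis_mono:
  assumes X: "pc_basis G X" and "Y \<subseteq> X"
  shows "pc_basis G Y"
proof -
  let ?P = "pc_group (comm_graph G Y)"
  let ?f = "\<lambda>x. if x \<in> Y then pc_gen (comm_graph G Y) x else \<one>\<^bsub>?P\<^esub>"
  interpret P: group ?P by (rule group_pc_group)
  have f: "?f \<in> X \<rightarrow> carrier ?P" using pc_gen_closed[of "comm_graph G Y"] by auto
  have c: "comm ?P (?f x) (?f y)" if "comm G x y" for x y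
  proof (cases "x \<in> Y \<and> y \<in> Y \<and> x \<noteq> y")
    case True
    then have "{x, y} \<in> edges (comm_graph G Y)" using that by (simp add: edges_comm_graph)
    then show ?thesis using True by (auto intro: pc_gen_comm)
  next
    case False
    moreover have "pc_gen (comm_graph G Y) z \<in> carrier ?P" if "z \<in> Y" for z
      using pc_gen_closed[of "comm_graph G Y"] that by (auto simp: Pi_iff)
    ultimately show ?thesis by (cases "x \<in> Y"; cases "y \<in> Y") (simp_all add: comm_def)
  qed
  obtain \<phi> where \<phi>: "\<And>w. w \<in> words X \<Longrightarrow> \<phi> (word_val G id w) = word_val ?P ?f w"
    by (rule pc_basis_extend[OF X P.is_group f c]) blast+
  have "word_eq Y (pc_relators (comm_graph G Y)) w []" if w: "w \<in> words Y" "word_val G id w = \<one>" for w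
  proof -
    have "word_val ?P ?f w = word_val ?P ?f []"
      using \<phi>[of w] \<phi>[of "[]"] w words_mono[OF w(1) assms(2)] by auto
    moreover have "word_val ?P ?f w = word_val ?P (pc_gen (comm_graph G Y)) w"
      by (rule word_val_cong[OF w(1)]) auto
    ultimately have "word_class Y (pc_relators (comm_graph G Y)) w = word_class Y (pc_relators (comm_graph G Y)) []"
      using word_val_pc_gen[of w "comm_graph G Y"] w by (simp add: one_pc_group)
    then show ?thesis using w by (simp add: word_class_eq_iff)
  qed
  then show ?thesis using assms by (auto simp: pc_basis_def)
qed

text \<open>Only the pull-back of triviality is assumed: \<open>s\<close> need not extend to a homomorphism.\<close>

lemma pc_basis_image:
  assumes X: "pc_basis G X" and s: "s \<in> X \<rightarrow> carrier H" "inj_on s X"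
    and c: "\<And>x y. x \<in> X \<Longrightarrow> y \<in> X \<Longrightarrow> comm G x y \<Longrightarrow> comm H (s x) (s y)"
    and triv: "\<And>w. w \<in> words X \<Longrightarrow> word_val H s w = \<one>\<^bsub>H\<^esub> \<Longrightarrow> word_val G id w = \<one>"
  shows "pc_basis H (s ` X)"
  unfolding pc_basis_def
proof (intro conjI ballI impI)
  show "s ` X \<subseteq> carrier H" using s by auto
  fix w assume w: "w \<in> words (s ` X)" "word_val H id w = \<one>\<^bsub>H\<^esub>"
  define t where "t = the_inv_into X s"
  have t: "t (s x) = x" if "x \<in> X" for x
    using that s by (simp add: t_def the_inv_into_f_f)
  have ws: "map (apfst s) (map (apfst t) w) = w"
    using w(1) by (induction w) (auto simp: t)
  have tw: "map (apfst t) w \<in> words X" by (rule words_map[OF w(1)]) (auto simp: t)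
  have "word_val H s (map (apfst t) w) = \<one>\<^bsub>H\<^esub>"
    using w(2) ws word_val_map[of H id s "map (apfst t) w"] by simp
  then have "word_eq X (pc_relators (comm_graph G X)) (map (apfst t) w) []"
    using X tw triv by (auto simp: pc_basis_def)
  then have "word_eq (s ` X) (pc_relators (comm_graph H (s ` X))) (map (apfst s) (map (apfst t) w)) (map (apfst s) [])"
    by (rule word_eq_map) (use s c in \<open>auto simp: edges_comm_graph inj_on_def\<close>)
  then show "word_eq (s ` X) (pc_relators (comm_graph H (s ` X))) w []" by (simp only: ws list.map)
qed

lemma pc_basis_conj:
  assumes X: "pc_basis G X" and g: "g \<in> carrier G"
  shows "pc_basis G (conj_by g ` X)"
proof (rule pc_basis_image[OF X])
  have Xc: "X \<subseteq> carrier G" by (rule pc_basis_carrier[OF X])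
  show "(conj_by g) \<in> X \<rightarrow> carrier G" using Xc g by auto
  show "inj_on (conj_by g) X"
  proof (rule inj_onI)
    fix x y assume "x \<in> X" "y \<in> X" "conj_by g x = conj_by g y"
    then show "x = y" using conj_eq_iff[of g x y] g Xc by blast
  qed
  show "comm G (conj_by g x) (conj_by g y)" if "x \<in> X" "y \<in> X" "comm G x y" for x y
    using comm_conj_iff[of g x y] that g Xc by blast
  fix w assume w: "w \<in> words X" "word_val G (conj_by g) w = \<one>"
  have "inv g \<otimes> word_val G id w \<otimes> g = word_val G ((conj_by g) \<circ> id) w"
    by (rule word_val_hom[OF is_group is_group _ subgroup_self, of _ X])
      (use Xc g w in \<open>auto simp: conj_mult\<close>)
  moreover have "word_val G id w \<in> carrier G" using word_val_closed[OF w(1), of id] Xc by (auto simp: Pi_iff subset_iff)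
  ultimately have "inv g \<otimes> word_val G id w \<otimes> g = inv g \<otimes> \<one> \<otimes> g" "word_val G id w \<in> carrier G"
    using w(2) g by auto
  then show "word_val G id w = \<one>" using conj_eq_iff[of g _ \<one>] g by blast
qed

text \<open>The way back from faithful sets to presented groups, for any relabelling of the
  commutation graph. The clause \<open>s x \<noteq> s y\<close> is there because \<open>comm\<close>
  is reflexive while a graph has no loops.\<close>

lemma pc_basis_iso:
  assumes X: "pc_basis G X" and s: "bij_betw s (verts \<Gamma>) X"
    and e: "\<And>x y. x \<in> verts \<Gamma> \<Longrightarrow> y \<in> verts \<Gamma> \<Longrightarrow>
      {x, y} \<in> edges \<Gamma> \<longleftrightarrow> s x \<noteq> s y \<and> comm G (s x) (s y)"
  shows "pc_group \<Gamma> \<cong> G\<lparr>carrier := generate G X\<rparr>"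
proof -
  let ?P = "pc_group \<Gamma>" and ?V = "verts \<Gamma>" and ?R = "pc_relators \<Gamma>"
  interpret P: group ?P by (rule group_pc_group)
  have Xc: "X \<subseteq> carrier G" by (rule pc_basis_carrier[OF X])
  have sX: "s ` ?V = X" "inj_on s ?V" using s by (auto simp: bij_betw_def)
  have sc: "s \<in> ?V \<rightarrow> carrier G" using sX Xc by auto
  have wd: "word_val G s u = word_val G s v" if "word_eq ?V ?R u v" for u v
    by (rule word_val_eq[OF that sc]) (use e in auto)
  define t where "t = the_inv_into ?V s"
  have t: "t (s x) = x" if "x \<in> ?V" for x
    using that sX by (simp add: t_def the_inv_into_f_f)
  have faithful: "word_eq ?V ?R w []" if w: "w \<in> words ?V" "word_val G s w = \<one>" for w
  proof -
    have "map (apfst s) w \<in> words X" by (rule words_map[OF w(1)]) (use sX in auto)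
    moreover have "word_val G id (map (apfst s) w) = \<one>" using w by (simp add: word_val_map)
    ultimately have "word_eq X (pc_relators (comm_graph G X)) (map (apfst s) w) []"
      using X by (auto simp: pc_basis_def)
    then have "word_eq ?V ?R (map (apfst t) (map (apfst s) w)) (map (apfst t) [])"
    proof (rule word_eq_map)
      show "t ` X \<subseteq> ?V" using sX t by auto
      fix x y assume "x \<in> X" "y \<in> X" "{x, y} \<in> edges (comm_graph G X)"
      then show "{t x, t y} \<in> edges \<Gamma>" using sX(1) t e by (auto simp: edges_comm_graph)
    qed
    moreover have "map (apfst t) (map (apfst s) w) = w"
      using w(1) by (induction w) (auto simp: t)
    ultimately show ?thesis by simp
  qed
  \<comment> \<open>An element of the presented group is a class of words; by \<open>wd\<close> the
    representative picked by \<open>SOME\<close> does not affect the value.\<close>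
  define \<Phi> where "\<Phi> A = word_val G s (SOME w. w \<in> A)" for A
  have \<Phi>: "\<Phi> (word_class ?V ?R w) = word_val G s w" if "w \<in> words ?V" for w
  proof -
    have "\<exists>v. v \<in> word_class ?V ?R w" using that by (auto simp: word_class_def intro: word_eq.refl)
    then show ?thesis unfolding \<Phi>_def
      by (rule someI2_ex) (use wd in \<open>auto simp: word_class_def\<close>)
  qed
  have img: "generate G X = word_val G s ` words ?V" using generate_word_val[OF sc] sX by simp
  have "\<Phi> \<in> hom ?P (G\<lparr>carrier := generate G X\<rparr>)"
    by (rule homI) (auto simp: carrier_pc_group \<Phi> img mult_pc_group word_val_append[OF _ _ sc])
  moreover have "inj_on \<Phi> (carrier ?P)"
  proof (rule inj_onI)
    fix A B assume "A \<in> carrier ?P" "B \<in> carrier ?P" "\<Phi> A = \<Phi> B"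
    then obtain u v where uv: "u \<in> words ?V" "v \<in> words ?V" "A = word_class ?V ?R u"
      "B = word_class ?V ?R v" "word_val G s u = word_val G s v"
      by (auto simp: carrier_pc_group \<Phi>)
    let ?v = "rev (map (apsnd Not) v)"
    have "word_val G s (u @ ?v) = \<one>"
      using uv sc by (simp add: word_val_append[of _ ?V] word_val_rev_inverse words_rev_inverse word_val_closed)
    then have "word_eq ?V ?R (u @ ?v) []" using uv by (intro faithful) (auto simp: words_rev_inverse)
    then have "word_eq ?V ?R ((u @ ?v) @ v) ([] @ v)"
      by (rule word_eq_append_right) (use uv in auto)
    moreover have "word_eq ?V ?R (u @ (?v @ v)) (u @ [])"
      by (rule word_eq_append_left[OF word_eq_inverse]) (use uv in auto)
    ultimately have "word_eq ?V ?R u v" by (auto intro: word_eq.trans word_eq.sym)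
    then show "A = B" using uv by (simp add: word_class_eq_iff)
  qed
  moreover have "\<Phi> ` carrier ?P = generate G X"
    unfolding img carrier_pc_group image_image using \<Phi> by (intro image_cong) auto
  ultimately have "\<Phi> \<in> iso ?P (G\<lparr>carrier := generate G X\<rparr>)"
    by (auto simp: iso_def bij_betw_def)
  then show ?thesis by (auto simp: is_iso_def)
qed

end

section \<open>Free families of subgroups\<close>

text \<open>Values outside \<open>S\<close> and \<open>Y\<close> are unconstrained, so that actions
  of the subgroups \<open>A i\<close> and of \<open>M\<close> on one set can be compared as plain
  functions.\<close>

definition gact :: "('g, 'm) monoid_scheme \<Rightarrow> 'g set \<Rightarrow> 'y set \<Rightarrow> ('g \<Rightarrow> 'y \<Rightarrow> 'y) \<Rightarrow> bool" where
  "gact G S Y \<rho> \<longleftrightarrow> (\<forall>g\<in>S. \<forall>y\<in>Y. \<rho> g y \<in> Y) \<and> (\<forall>y\<in>Y. \<rho> \<one>\<^bsub>G\<^esub> y = y) \<and>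
    (\<forall>g\<in>S. \<forall>h\<in>S. \<forall>y\<in>Y. \<rho> (g \<otimes>\<^bsub>G\<^esub> h) y = \<rho> g (\<rho> h y))"

fun alternating :: "('g, 'm) monoid_scheme \<Rightarrow> ('j \<Rightarrow> 'g set) \<Rightarrow> ('j \<times> 'g) list \<Rightarrow> bool" where
  "alternating G S [] \<longleftrightarrow> True"
| "alternating G S ((j, b) # l) \<longleftrightarrow>
    b \<in> S j \<and> b \<noteq> \<one>\<^bsub>G\<^esub> \<and> (l = [] \<or> fst (hd l) \<noteq> j) \<and> alternating G S l"

definition syll_prod :: "('g, 'm) monoid_scheme \<Rightarrow> ('j \<times> 'g) list \<Rightarrow> 'g" where
  "syll_prod G l = foldr (\<lambda>p g. snd p \<otimes>\<^bsub>G\<^esub> g) l \<one>\<^bsub>G\<^esub>"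

lemma syll_prod_simps [simp]:
  "syll_prod G [] = \<one>\<^bsub>G\<^esub>" "syll_prod G (p # l) = snd p \<otimes>\<^bsub>G\<^esub> syll_prod G l"
  by (simp_all add: syll_prod_def)

definition free_family :: "('g, 'm) monoid_scheme \<Rightarrow> 'j set \<Rightarrow> ('j \<Rightarrow> 'g set) \<Rightarrow> bool" where
  "free_family G J B \<longleftrightarrow>
    (\<forall>l. alternating G B l \<and> fst ` set l \<subseteq> J \<and> l \<noteq> [] \<longrightarrow> syll_prod G l \<noteq> \<one>\<^bsub>G\<^esub>)"

text \<open>A reduced word splits uniquely into an element of the factor \<open>j\<close>, possibly
  \<open>\<one>\<close>, and a reduced word that does not begin in \<open>j\<close>.
  \<open>head_in\<close> and \<open>tail_in\<close> are the two parts and \<open>cons_in\<close>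
  rejoins them; \<open>\<one>\<close> leaves no syllable behind.\<close>

definition head_in :: "('g, 'm) monoid_scheme \<Rightarrow> 'j \<Rightarrow> ('j \<times> 'g) list \<Rightarrow> 'g" where
  "head_in G j l = (if l \<noteq> [] \<and> fst (hd l) = j then snd (hd l) else \<one>\<^bsub>G\<^esub>)"

definition tail_in :: "'j \<Rightarrow> ('j \<times> 'g) list \<Rightarrow> ('j \<times> 'g) list" where
  "tail_in j l = (if l \<noteq> [] \<and> fst (hd l) = j then tl l else l)"

definition cons_in :: "('g, 'm) monoid_scheme \<Rightarrow> 'j \<Rightarrow> 'g \<Rightarrow> ('j \<times> 'g) list \<Rightarrow> ('j \<times> 'g) list" where
  "cons_in G j a l = (if a = \<one>\<^bsub>G\<^esub> then l else (j, a) # l)"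

text \<open>Van der Waerden's trick: left multiplication on reduced words, without a normal form theorem.\<close>

definition syll_act :: "('g, 'm) monoid_scheme \<Rightarrow> 'j \<Rightarrow> 'g \<Rightarrow> ('j \<times> 'g) list \<Rightarrow> ('j \<times> 'g) list" where
  "syll_act G j a l = cons_in G j (a \<otimes>\<^bsub>G\<^esub> head_in G j l) (tail_in j l)"

lemma (in group) gact_syll_act:
  assumes "subgroup (S j) G"
  shows "gact G (S j) {l. alternating G S l} (syll_act G j)"
proof -
  interpret S: subgroup "S j" G by fact
  have hd: "head_in G j l \<in> S j" if "alternating G S l" for l
    using that by (cases l) (auto simp: head_in_def)
  have tl: "alternating G S (tail_in j l) \<and> (tail_in j l = [] \<or> fst (hd (tail_in j l)) \<noteq> j)"
    if "alternating G S l" for l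
    using that by (cases l) (auto simp: tail_in_def)
  have cons: "alternating G S (cons_in G j a l) \<and> head_in G j (cons_in G j a l) = a \<and>
      tail_in j (cons_in G j a l) = l"
    if "a \<in> S j" "alternating G S l" "l = [] \<or> fst (hd l) \<noteq> j" for a l
    using that by (auto simp: cons_in_def head_in_def tail_in_def)
  have sub: "x \<in> carrier G" if "x \<in> S j" for x using that by simp
  show ?thesis unfolding gact_def
  proof (intro conjI allI ballI)
    fix g l assume "g \<in> S j" "l \<in> {l. alternating G S l}"
    then show "syll_act G j g l \<in> {l. alternating G S l}"
      using hd tl cons by (simp add: syll_act_def)
  next
    fix l assume l: "l \<in> {l. alternating G S l}"
    then have "head_in G j l \<in> carrier G" using hd by auto
    moreover have "cons_in G j (head_in G j l) (tail_in j l) = l"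
      using l by (cases l) (auto simp: cons_in_def head_in_def tail_in_def)
    ultimately show "syll_act G j \<one> l = l" by (simp add: syll_act_def)
  next
    fix g h l assume gh: "g \<in> S j" "h \<in> S j" and l: "l \<in> {l. alternating G S l}"
    then have "g \<otimes> h \<otimes> head_in G j l = g \<otimes> (h \<otimes> head_in G j l)"
      using hd by (intro m_assoc) auto
    then show "syll_act G j (g \<otimes> h) l = syll_act G j g (syll_act G j h l)"
      using gh l cons[of "h \<otimes> head_in G j l" "tail_in j l"] hd[of l] tl[of l]
      by (simp add: syll_act_def)
  qed
qed

lemma (in group) syll_act_Cons:
  assumes "alternating G S ((j, b) # l)" "b \<in> carrier G"
  shows "syll_act G j b l = (j, b) # l"
  using assms by (auto simp: syll_act_def head_in_def tail_in_def cons_in_def)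

lemma (in group) gact_inv:
  assumes "gact G S Y \<rho>" "subgroup S G" "g \<in> S" "y \<in> Y"
  shows "\<rho> (inv g) (\<rho> g y) = y" "\<rho> g (\<rho> (inv g) y) = y"
proof -
  interpret S: subgroup S G by fact
  have "\<rho> (inv g \<otimes> g) y = \<rho> (inv g) (\<rho> g y)" "\<rho> (g \<otimes> inv g) y = \<rho> g (\<rho> (inv g) y)"
    using assms S.m_inv_closed unfolding gact_def by blast+
  moreover have "\<rho> \<one> y = y" using assms by (simp add: gact_def)
  moreover have "inv g \<otimes> g = \<one>" "g \<otimes> inv g = \<one>" using assms by simp_all
  ultimately show "\<rho> (inv g) (\<rho> g y) = y" "\<rho> g (\<rho> (inv g) y) = y"
    by simp_all
qed

text \<open>Injectivity of \<open>\<nu>\<close> keeps neighbouring syllables in different factors,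
  and the product of a word does not see the indices.\<close>

lemma (in group) free_family_mono:
  assumes "free_family G J B" "inj_on \<nu> K" "\<nu> ` K \<subseteq> J" "\<And>k. k \<in> K \<Longrightarrow> D k \<subseteq> B (\<nu> k)"
  shows "free_family G K D"
  unfolding free_family_def
proof (intro allI impI)
  fix l assume l: "alternating G D l \<and> fst ` set l \<subseteq> K \<and> l \<noteq> []"
  then have "alternating G B (map (apfst \<nu>) l)"
  proof (induction l)
    case (Cons p l)
    obtain k b where p: "p = (k, b)" by (cases p)
    show ?case
    proof (cases l)
      case Nil
      then show ?thesis using Cons.prems assms(4) p by auto
    next
      case (Cons q l')
      then have "fst q \<in> K" "k \<in> K" "fst q \<noteq> k" using Cons.prems p by auto
      then have "\<nu> (fst q) \<noteq> \<nu> k" using assms(2) by (auto simp: inj_on_def)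
      then show ?thesis using Cons.prems Cons.IH Cons assms(4) p by (cases q) auto
    qed
  qed simp
  moreover have "fst ` set (map (apfst \<nu>) l) \<subseteq> J" using l assms(3) by (auto simp: image_subset_iff)
  moreover have "map (apfst \<nu>) l \<noteq> []" using l by simp
  ultimately have "syll_prod G (map (apfst \<nu>) l) \<noteq> \<one>"
    using assms(1) unfolding free_family_def by blast
  moreover have "syll_prod G (map (apfst \<nu>) l) = syll_prod G l" by (induction l) auto
  ultimately show "syll_prod G l \<noteq> \<one>" by simp
qed

text \<open>Otherwise \<open>x\<close> followed by its inverse, read in two different factors, is an
  alternating word of length two with trivial product.\<close>

lemma (in group) free_family_disjoint:
  assumes "free_family G J B" "j \<in> J" "k \<in> J" "j \<noteq> k" "subgroup (B k) G" "x \<in> B j" "x \<in> B k"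
  shows "x = \<one>"
proof (rule ccontr)
  assume x: "x \<noteq> \<one>"
  have xc: "x \<in> carrier G" "inv x \<in> B k"
    using assms subgroup.mem_carrier subgroup.m_inv_closed by fastforce+
  have "alternating G B [(j, x), (k, inv x)]" using assms x xc by auto
  then have "syll_prod G [(j, x), (k, inv x)] \<noteq> \<one>"
    using assms(1-3) unfolding free_family_def by (auto simp del: syll_prod_simps)
  then show False using xc by simp
qed

text \<open>The commutator is an alternating word of length four.\<close>

lemma (in group) free_family_not_comm:
  assumes "free_family G J B" "j \<in> J" "k \<in> J" "j \<noteq> k" "subgroup (B j) G" "subgroup (B k) G"
    and "x \<in> B j" "y \<in> B k" "x \<noteq> \<one>" "y \<noteq> \<one>"
  shows "\<not> comm G x y"
proof
  assume c: "comm G x y"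
  have xc: "x \<in> carrier G" "inv x \<in> B j" "inv x \<noteq> \<one>" and yc: "y \<in> carrier G" "inv y \<in> B k" "inv y \<noteq> \<one>"
    using assms subgroup.mem_carrier[OF assms(5)] subgroup.mem_carrier[OF assms(6)]
    by (auto simp: subgroup.m_inv_closed)
  have "alternating G B [(j, inv x), (k, inv y), (j, x), (k, y)]" using assms xc yc by auto
  then have "syll_prod G [(j, inv x), (k, inv y), (j, x), (k, y)] \<noteq> \<one>"
    using assms(1-3) unfolding free_family_def by (auto simp del: syll_prod_simps)
  moreover have "inv x \<otimes> (inv y \<otimes> (x \<otimes> y)) = \<one>"
    using c xc yc by (simp add: comm_def)
  ultimately show False using xc yc by simp
qed

text \<open>
  In a word over the union of the \<open>X j\<close> some syllable has trivial value, since the family is free;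
  deleting it shortens the word.
\<close>

lemma (in group) pc_basis_Union:
  assumes free: "free_family G J B" and sub: "\<And>j. j \<in> J \<Longrightarrow> subgroup (B j) G"
    and X: "\<And>j. j \<in> J \<Longrightarrow> pc_basis G (X j)" "\<And>j. j \<in> J \<Longrightarrow> X j \<subseteq> B j"
  shows "pc_basis G (\<Union>j\<in>J. X j)"
proof -
  let ?U = "\<Union>j\<in>J. X j"
  have Uc: "?U \<subseteq> carrier G" using X(1) pc_basis_carrier by blast
  have id: "id \<in> ?U \<rightarrow> carrier G" using Uc by auto
  have syll: "\<exists>ws. w = concat (map snd ws) \<and> (\<forall>(j, u)\<in>set ws. j \<in> J \<and> u \<in> words (X j) \<and> u \<noteq> []) \<and>
      distinct_adj (map fst ws)" if "w \<in> words ?U" for w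
    using that
  proof (induction w)
    case Nil
    show ?case by (rule exI[of _ "[]"]) auto
  next
    case (Cons a w)
    then obtain ws j where ws: "w = concat (map snd ws)"
      "\<forall>(j, u)\<in>set ws. j \<in> J \<and> u \<in> words (X j) \<and> u \<noteq> []"
      "distinct_adj (map fst ws)" and j: "j \<in> J" "fst a \<in> X j"
      by auto
    show ?case
    proof (cases "ws \<noteq> [] \<and> fst (hd ws) = j")
      case True
      then obtain u ws' where u: "ws = (j, u) # ws'" by (cases ws) auto
      show ?thesis
        by (rule exI[of _ "(j, a # u) # ws'"]) (use ws u j in \<open>auto simp: distinct_adj_Cons\<close>)
    next
      case False
      then show ?thesis
        by (intro exI[of _ "(j, [a]) # ws"])
          (use ws j in \<open>auto simp: distinct_adj_Cons hd_map\<close>)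
    qed
  qed
  have "word_eq ?U (pc_relators (comm_graph G ?U)) w []" if "w \<in> words ?U" "word_val G id w = \<one>" for w
    using that
  proof (induction w rule: length_induct)
    case (1 w)
    have w1: "word_val G id w = \<one>" using 1(3) by (simp add: id_def)
    show ?case
    proof (cases "w = []")
      case True
      then show ?thesis by (simp add: word_eq.refl)
    next
      case False
      obtain ws where ws: "w = concat (map snd ws)"
        "\<forall>(j, u)\<in>set ws. j \<in> J \<and> u \<in> words (X j) \<and> u \<noteq> []"
        "distinct_adj (map fst ws)" using syll[OF 1(2)] by blast
      have val: "word_val G id u \<in> B j" if "(j, u) \<in> set ws" for j u
      proof -
        have "u \<in> words (X j)" "j \<in> J" using ws(2) that by auto
        then have "word_val G id u \<in> generate G (X j)"
          using generate_word_val_id[of "X j"] X pc_basis_carrier by blast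
        then show ?thesis using generate_subgroup_incl[OF X(2) sub] \<open>j \<in> J\<close> by blast
      qed
      have "\<exists>(j, u)\<in>set ws. word_val G id u = \<one>"
      proof (rule ccontr)
        assume non: "\<not> ?thesis"
        have "alternating G B (map (\<lambda>(j, u). (j, word_val G id u)) ws)"
          using ws(3) val non
        proof (induction ws)
          case (Cons p ws)
          then show ?case
            by (cases ws) (auto simp: distinct_adj_Cons split: prod.splits)
        qed simp
        moreover have "ws \<noteq> []" using False ws(1) by auto
        moreover have "fst ` set (map (\<lambda>(j, u). (j, word_val G id u)) ws) \<subseteq> J" using ws(2) by auto
        ultimately have "syll_prod G (map (\<lambda>(j, u). (j, word_val G id u)) ws) \<noteq> \<one>"
          using free unfolding free_family_def by blast
        moreover have "syll_prod G (map (\<lambda>(j, u). (j, word_val G id u)) ws) = word_val G id (concat (map snd ws))"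
          using ws(2)
        proof (induction ws)
          case (Cons p ws)
          obtain j u where p: "p = (j, u)" by (cases p)
          have "u \<in> words ?U" using Cons.prems p by (auto intro: words_mono)
          moreover have "concat (map snd ws) \<in> words ?U" using Cons.prems
            by (induction ws) (auto intro: words_mono)
          ultimately have "word_val G id (u @ concat (map snd ws)) =
              word_val G id u \<otimes> word_val G id (concat (map snd ws))"
            by (rule word_val_append[OF _ _ id])
          then show ?case using Cons.IH Cons.prems by (simp add: p id_def)
        qed simp
        ultimately show False using w1 ws(1) by simp
      qed
      then obtain j u where ju: "(j, u) \<in> set ws" "word_val G id u = \<one>" by auto
      then obtain ws1 ws2 where ws12: "ws = ws1 @ (j, u) # ws2" by (meson split_list)
      define a where "a = concat (map snd ws1)"
      define b where "b = concat (map snd ws2)"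
      have w: "w = a @ u @ b" by (simp add: ws(1) ws12 a_def b_def)
      have in_words: "a \<in> words ?U" "b \<in> words ?U" "u \<in> words ?U" using 1(2) w by auto
      have u: "u \<in> words (X j)" "j \<in> J" "u \<noteq> []" using ws(2) ju by auto
      then have "word_eq (X j) (pc_relators (comm_graph G (X j))) u []"
        using X(1) ju by (auto simp: pc_basis_def)
      then have "word_eq ?U (pc_relators (comm_graph G ?U)) (map (apfst id) u) (map (apfst id) [])"
        by (rule word_eq_map) (use u in \<open>auto simp: edges_comm_graph\<close>)
      then have "word_eq ?U (pc_relators (comm_graph G ?U)) u []" by (simp add: apfst_id)
      from word_eq_append_left[OF word_eq_append_right[OF this in_words(2)] in_words(1)]
      have "word_eq ?U (pc_relators (comm_graph G ?U)) w (a @ b)" by (simp add: w)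
      moreover have "word_eq ?U (pc_relators (comm_graph G ?U)) (a @ b) []"
      proof (rule 1(1)[rule_format])
        show "length (a @ b) < length w" using u by (simp add: w)
        show "word_val G id (a @ b) = \<one>"
          using w1 ju(2) in_words id by (simp add: w word_val_append[of _ ?U] word_val_closed)
      qed (use in_words in auto)
      ultimately show ?thesis by (rule word_eq.trans)
    qed
  qed
  then show ?thesis using Uc by (auto simp: pc_basis_def)
qed

lemma gact_closed: "gact G S Y \<rho> \<Longrightarrow> g \<in> S \<Longrightarrow> y \<in> Y \<Longrightarrow> \<rho> g y \<in> Y"
  and gact_one: "gact G S Y \<rho> \<Longrightarrow> y \<in> Y \<Longrightarrow> \<rho> \<one>\<^bsub>G\<^esub> y = y"
  and gact_mult: "gact G S Y \<rho> \<Longrightarrow> g \<in> S \<Longrightarrow> h \<in> S \<Longrightarrow> y \<in> Y \<Longrightarrow> \<rho> (g \<otimes>\<^bsub>G\<^esub> h) y = \<rho> g (\<rho> h y)"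
  by (simp_all add: gact_def)

section \<open>Subgroups of free products\<close>

type_synonym ('i, 'c) tag = "('i \<times> 'c) + ('i \<times> 'c)"

text \<open>
  \<open>C\<close> is a transitive \<open>M\<close>-set in which the subgroup under study is the stabiliser of \<open>c0\<close>; that \<open>M\<close>
  is the free product of the \<open>A i\<close> is only used in the form \<open>glue\<close>. The element \<open>v\<close> merely
  supplies an infinite cyclic group of the right type. The tag \<open>Inl (i, y)\<close> stands for the
  \<open>A i\<close>-orbit of \<open>y\<close>, the tag \<open>Inr (i, x)\<close> for a free generator.
\<close>

locale free_product_action = group G for G :: "('g, 'm) monoid_scheme" (structure) +
  fixes A :: "'i \<Rightarrow> 'g set" and M :: "'g set" and C :: "'c set" and act :: "'g \<Rightarrow> 'c \<Rightarrow> 'c"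
    and c0 :: 'c and v :: 'g
  assumes subA: "subgroup (A i) G"
    and M_eq: "M = generate G (\<Union>i. A i)"
    and act: "gact G M C act"
    and c0: "c0 \<in> C"
    and transitive: "x \<in> C \<Longrightarrow> \<exists>g\<in>M. act g c0 = x"
    and v: "v \<in> carrier G" "\<And>n :: int. v [^] n = \<one> \<Longrightarrow> n = 0"
    and glue: "\<And>(Y :: ((('i, 'c) tag \<times> 'g) list \<times> 'c) set) \<rho>.
      (\<And>i. gact G (A i) Y (\<rho> i)) \<Longrightarrow>
      \<exists>\<phi>. gact G M Y \<phi> \<and> (\<forall>i. \<forall>a\<in>A i. \<forall>y\<in>Y. \<phi> a y = \<rho> i a y)"
begin

lemma subM: "subgroup M G"
  unfolding M_eq by (rule subgroup_generate) (use subA subgroup.subset in blast)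

lemma A_M: "a \<in> A i \<Longrightarrow> a \<in> M"
  unfolding M_eq by (rule generate.incl) auto

lemma A_carrier: "a \<in> A i \<Longrightarrow> a \<in> carrier G"
  using subA subgroup.mem_carrier by metis

lemma A_closed [simp]: "\<one> \<in> A i" "a \<in> A i \<Longrightarrow> b \<in> A i \<Longrightarrow> a \<otimes> b \<in> A i" "a \<in> A i \<Longrightarrow> inv a \<in> A i"
  using subgroup.one_closed[OF subA] subgroup.m_closed[OF subA] subgroup.m_inv_closed[OF subA] by blast+

lemma M_closed [simp]: "\<one> \<in> M" "g \<in> M \<Longrightarrow> h \<in> M \<Longrightarrow> g \<otimes> h \<in> M" "g \<in> M \<Longrightarrow> inv g \<in> M"
  using subgroup.one_closed[OF subM] subgroup.m_closed[OF subM] subgroup.m_inv_closed[OF subM] by blast+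

lemma M_carrier: "g \<in> M \<Longrightarrow> g \<in> carrier G"
  using subM subgroup.mem_carrier by metis

lemma act_closed [simp]: "g \<in> M \<Longrightarrow> x \<in> C \<Longrightarrow> act g x \<in> C"
  using act by (simp add: gact_def)

lemma act_one [simp]: "x \<in> C \<Longrightarrow> act \<one> x = x"
  using act by (simp add: gact_def)

lemma act_mult: "g \<in> M \<Longrightarrow> h \<in> M \<Longrightarrow> x \<in> C \<Longrightarrow> act (g \<otimes> h) x = act g (act h x)"
  using act by (simp add: gact_def)

lemma act_inv [simp]: "g \<in> M \<Longrightarrow> x \<in> C \<Longrightarrow> act (inv g) (act g x) = x"
    "g \<in> M \<Longrightarrow> x \<in> C \<Longrightarrow> act g (act (inv g) x) = x"
  using gact_inv[OF act subM] by auto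

definition H :: "'g set" where "H = {g \<in> M. act g c0 = c0}"

lemma subH: "subgroup H G"
proof (rule subgroupI)
  show "H \<subseteq> carrier G" by (auto simp: H_def M_carrier)
  show "H \<noteq> {}" using c0 by (auto simp: H_def intro!: exI[of _ \<one>])
  show "inv a \<in> H" if "a \<in> H" for a
    using that c0 act_inv(1)[of a c0] by (auto simp: H_def)
  show "a \<otimes> b \<in> H" if "a \<in> H" "b \<in> H" for a b
    using that c0 by (auto simp: H_def act_mult)
qed

lemma H_carrier: "h \<in> H \<Longrightarrow> h \<in> carrier G"
  using subH subgroup.mem_carrier by metis

subsection \<open>A spanning tree and the transversals it defines\<close>

text \<open>\<open>n\<close> counts the factor elements applied on the way from \<open>c0\<close>.
  \<open>\<one>\<close> is allowed among them, so levels increase, and \<open>depth\<close> below is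
  a distance from \<open>c0\<close> measured in syllables.\<close>

primrec level :: "nat \<Rightarrow> 'c set" where
  "level 0 = {c0}"
| "level (Suc n) = {act a y | a y. (\<exists>i. a \<in> A i) \<and> y \<in> level n}"

lemma level_C: "level n \<subseteq> C"
  using c0 A_M by (induction n) auto

lemma level_exists:
  assumes "x \<in> C" shows "\<exists>n. x \<in> level n"
proof -
  have "\<forall>n. \<forall>y\<in>level n. \<exists>m. act g y \<in> level m" if "g \<in> generate G (\<Union>i. A i)" for g
    using that
  proof (induction rule: generate.induct)
    case one
    then show ?case using level_C by (metis act_one subsetD)
  next
    case (incl h)
    then have "act h y \<in> level (Suc n)" if "y \<in> level n" for n y using that by auto
    then show ?case by blast
  next
    case (inv h)
    then obtain i where "h \<in> A i" by auto
    then have "inv h \<in> A i" by simp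
    then have "act (inv h) y \<in> level (Suc n)" if "y \<in> level n" for n y using that by auto
    then show ?case by blast
  next
    case (eng h1 h2)
    show ?case
    proof (intro allI ballI)
      fix n y assume y: "y \<in> level n"
      then obtain m where "act h2 y \<in> level m" using eng by blast
      then obtain k where "act h1 (act h2 y) \<in> level k" using eng by blast
      moreover have "act (h1 \<otimes> h2) y = act h1 (act h2 y)"
        using eng(1,2) y level_C by (intro act_mult) (auto simp: M_eq)
      ultimately show "\<exists>m. act (h1 \<otimes> h2) y \<in> level m" by auto
    qed
  qed
  moreover obtain g where "g \<in> M" "act g c0 = x" using transitive assms by blast
  moreover have "c0 \<in> level 0" by simp
  ultimately show ?thesis unfolding M_eq by blast
qed

definition depth :: "'c \<Rightarrow> nat" where "depth x = (LEAST n. x \<in> level n)"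

lemma depth_c0 [simp]: "depth c0 = 0"
  by (simp add: depth_def)

definition orb :: "'i \<Rightarrow> 'c \<Rightarrow> 'c set" where "orb i x = (\<lambda>a. act a x) ` A i"

lemma orb_act:
  assumes "a \<in> A i" "x \<in> C" shows "orb i (act a x) = orb i x"
proof -
  have "act b (act a x) = act (b \<otimes> a) x" if "b \<in> A i" for b
    using that assms by (simp add: act_mult A_M)
  moreover have "act b x = act (b \<otimes> inv a) (act a x)" if "b \<in> A i" for b
  proof -
    have "act (b \<otimes> inv a) (act a x) = act (b \<otimes> inv a \<otimes> a) x"
      using that assms by (simp add: act_mult A_M)
    then show ?thesis using that assms by (simp add: m_assoc A_carrier)
  qed
  moreover have "b \<otimes> a \<in> A i" "b \<otimes> inv a \<in> A i" if "b \<in> A i" for b using that assms by simp_all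
  ultimately show ?thesis unfolding orb_def by blast
qed

text \<open>The shallowest point is chosen from the orbit as a set, so all points of an
  \<open>A i\<close>-orbit share it. Base points index the vertex factors and anchor the
  transversals.\<close>

definition base :: "'i \<Rightarrow> 'c \<Rightarrow> 'c" where
  "base i x = (SOME y. y \<in> orb i x \<and> (\<forall>z\<in>orb i x. depth y \<le> depth z))"

lemma base: "base i x \<in> orb i x \<and> (\<forall>z\<in>orb i x. depth (base i x) \<le> depth z)"
proof -
  have "act \<one> x \<in> orb i x" unfolding orb_def by (rule imageI) simp
  then have "\<exists>y. y \<in> orb i x \<and> (\<forall>z. z \<in> orb i x \<longrightarrow> depth y \<le> depth z)"
    by (rule ex_has_least_nat)
  then have "\<exists>y. y \<in> orb i x \<and> (\<forall>z\<in>orb i x. depth y \<le> depth z)" by blast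
  then show ?thesis unfolding base_def by (rule someI_ex)
qed

lemma base_act [simp]: "a \<in> A i \<Longrightarrow> x \<in> C \<Longrightarrow> base i (act a x) = base i x"
  by (simp add: base_def orb_act)

lemma base_orb:
  assumes "x \<in> C"
  obtains a where "a \<in> A i" "act a (base i x) = x" "base i x \<in> C" "base i (base i x) = base i x"
proof -
  obtain a where a: "a \<in> A i" "base i x = act a x" using base[of i x] by (auto simp: orb_def)
  show ?thesis
    by (rule that[of "inv a"]) (use a assms in \<open>simp_all add: A_M\<close>)
qed

lemma base_C [simp]: "x \<in> C \<Longrightarrow> base i x \<in> C"
  and base_base [simp]: "x \<in> C \<Longrightarrow> base i (base i x) = base i x"
  by (metis base_orb)+

text \<open>The last step of a shortest route to \<open>x\<close> stays inside one orbit, and the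
  point before it is shallower; the base of that orbit is at least as shallow. This is the parent
  relation of the spanning tree.\<close>

lemma depth_base:
  assumes "x \<in> C" "x \<noteq> c0" shows "\<exists>i. depth (base i x) < depth x"
proof -
  have x: "x \<in> level (depth x)" unfolding depth_def by (rule LeastI_ex[OF level_exists[OF assms(1)]])
  then obtain n where n: "depth x = Suc n" using assms(2) by (cases "depth x") auto
  then obtain a i y where y: "x = act a y" "a \<in> A i" "y \<in> level n" using x by auto
  have yC: "y \<in> C" using y level_C by auto
  have "depth y \<le> n" unfolding depth_def using y(3) by (rule Least_le)
  moreover have "act \<one> y \<in> orb i y" unfolding orb_def by (rule imageI) simp
  then have "depth (base i y) \<le> depth y" using base[of i y] yC by auto
  ultimately show ?thesis using n y yC by (intro exI[of _ i]) simp
qed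

definition dirn :: "'c \<Rightarrow> 'i" where "dirn x = (SOME i. depth (base i x) < depth x)"

lemma dirn: "x \<in> C \<Longrightarrow> x \<noteq> c0 \<Longrightarrow> depth (base (dirn x) x) < depth x"
  unfolding dirn_def by (rule someI_ex[OF depth_base])

text \<open>The prescribed value \<open>\<one>\<close> at a base point makes \<open>tau i\<close>
  and \<open>tau0\<close> agree there; an unrestricted choice could return any element of the
  stabiliser in \<open>A i\<close>.\<close>

definition from_base :: "'i \<Rightarrow> 'c \<Rightarrow> 'g" where
  "from_base i x = (if x = base i x then \<one> else SOME a. a \<in> A i \<and> act a (base i x) = x)"

lemma from_base:
  assumes "x \<in> C" shows "from_base i x \<in> A i" "act (from_base i x) (base i x) = x"
proof -
  have "from_base i x \<in> A i \<and> act (from_base i x) (base i x) = x"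
  proof (cases "x = base i x")
    case True
    then have "from_base i x = \<one>" by (simp add: from_base_def)
    then show ?thesis using assms True[symmetric] by simp
  next
    case False
    then have "from_base i x = (SOME a. a \<in> A i \<and> act a (base i x) = x)" by (simp add: from_base_def)
    moreover have "\<exists>a. a \<in> A i \<and> act a (base i x) = x" using base_orb[OF assms] by blast
    ultimately show ?thesis by (metis (mono_tags, lifting) someI_ex)
  qed
  then show "from_base i x \<in> A i" "act (from_base i x) (base i x) = x" by auto
qed

text \<open>Products of the chosen elements along tree paths. The guard ensures termination for all
  arguments; on \<open>C\<close> it fails exactly at the root \<open>c0\<close>.\<close>

function tau0 :: "'c \<Rightarrow> 'g" where
  "tau0 x = (if depth (base (dirn x) x) < depth x
    then from_base (dirn x) x \<otimes> tau0 (base (dirn x) x) else \<one>)"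
  by auto
termination by (relation "measure depth") auto

declare tau0.simps [simp del]

text \<open>With \<open>tau0\<close> this forms a Kurosh system of transversals: along an
  \<open>A i\<close>-orbit the values of \<open>tau i\<close> differ by left factors from
  \<open>A i\<close>. The price is that \<open>tau i\<close> may differ from \<open>tau0\<close>
  away from base points and from points whose tree direction is \<open>i\<close>.\<close>

definition tau :: "'i \<Rightarrow> 'c \<Rightarrow> 'g" where "tau i x = from_base i x \<otimes> tau0 (base i x)"

lemma tau0_c0 [simp]: "tau0 c0 = \<one>"
  by (simp add: tau0.simps)

lemma tau0_dirn: "x \<in> C \<Longrightarrow> x \<noteq> c0 \<Longrightarrow> tau0 x = tau (dirn x) x"
  using dirn by (subst tau0.simps) (simp add: tau_def)

lemma tau0: "x \<in> C \<Longrightarrow> tau0 x \<in> M \<and> act (tau0 x) c0 = x"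
proof (induction x rule: measure_induct_rule[of depth])
  case (less x)
  show ?case
  proof (cases "x = c0")
    case False
    let ?y = "base (dirn x) x"
    have "tau0 ?y \<in> M \<and> act (tau0 ?y) c0 = ?y" using less False dirn by simp
    then show ?thesis using less.prems False c0 from_base[of x "dirn x"]
      by (simp add: tau0_dirn tau_def act_mult A_M)
  qed (use c0 in simp)
qed

lemma tau: "x \<in> C \<Longrightarrow> tau i x \<in> M" "x \<in> C \<Longrightarrow> act (tau i x) c0 = x"
  using tau0[of "base i x"] from_base[of x i] c0 by (simp_all add: tau_def act_mult A_M)

lemma tau_base: "x \<in> C \<Longrightarrow> tau i (base i x) = tau0 (base i x)"
  using tau0[of "base i x"] by (simp add: tau_def from_base_def M_carrier)

lemma tau_from_base: "x \<in> C \<Longrightarrow> tau i x = from_base i x \<otimes> tau i (base i x)"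
  using tau_base by (simp add: tau_def)

lemma tau_carrier [simp]: "x \<in> C \<Longrightarrow> tau i x \<in> carrier G" "x \<in> C \<Longrightarrow> tau0 x \<in> carrier G"
  using tau tau0 M_carrier by auto

text \<open>The discrepancy of two transversals at one point. In the graph whose vertices are points
  and orbits it is the loop closed by an edge outside the spanning tree, hence a candidate for a
  free generator.\<close>

definition edge :: "'i \<Rightarrow> 'c \<Rightarrow> 'g" where "edge i x = inv (tau i x) \<otimes> tau0 x"

lemma edge_H: "x \<in> C \<Longrightarrow> edge i x \<in> H"
  using tau[of x i] tau0[of x] c0 act_inv(1)[of "tau i x" c0] by (simp add: H_def edge_def act_mult)

lemma edge_one: "x \<in> C \<Longrightarrow> edge i x = \<one> \<longleftrightarrow> tau0 x = tau i x"
  by (simp add: edge_def inv_solve_left')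

fun factor :: "('i, 'c) tag \<Rightarrow> 'g set" where
  "factor (Inl (i, y)) = {h \<in> H. tau i y \<otimes> h \<otimes> inv (tau i y) \<in> A i}"
| "factor (Inr (i, x)) = range (\<lambda>n :: int. edge i x [^] n)"

definition J :: "('i, 'c) tag set" where
  "J = {Inl (i, base i x) | i x. x \<in> C} \<union> {Inr (i, x) | i x. x \<in> C \<and> edge i x \<noteq> \<one>}"

lemma subgroup_powers: "g \<in> carrier G \<Longrightarrow> subgroup (range (\<lambda>n :: int. g [^] n)) G"
  using generate_pow[of g] generate_is_subgroup[of "{g}"] by (simp add: full_SetCompr_eq)

lemma sub_factor_Inl:
  assumes "y \<in> C" shows "subgroup (factor (Inl (i, y))) G"
proof (rule subgroupI)
  let ?t = "tau i y"
  note H = subgroup.one_closed[OF subH] subgroup.m_closed[OF subH] subgroup.m_inv_closed[OF subH]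
  show "factor (Inl (i, y)) \<subseteq> carrier G" by (auto simp: H_carrier)
  show "factor (Inl (i, y)) \<noteq> {}" using assms H(1) by (auto intro!: exI[of _ \<one>])
  have t: "?t \<in> carrier G" using assms by simp
  show "inv a \<in> factor (Inl (i, y))" if "a \<in> factor (Inl (i, y))" for a
  proof -
    have a: "a \<in> H" "?t \<otimes> a \<otimes> inv ?t \<in> A i" using that by auto
    then have "inv (?t \<otimes> a \<otimes> inv ?t) = ?t \<otimes> inv a \<otimes> inv ?t"
      using conj_inv[of "inv ?t" a] t by (simp add: H_carrier)
    then show ?thesis using a H(3) A_closed(3)[OF a(2)] by simp
  qed
  show "a \<otimes> b \<in> factor (Inl (i, y))" if "a \<in> factor (Inl (i, y))" "b \<in> factor (Inl (i, y))" for a b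
  proof -
    have ab: "a \<in> H" "?t \<otimes> a \<otimes> inv ?t \<in> A i" "b \<in> H" "?t \<otimes> b \<otimes> inv ?t \<in> A i" using that by auto
    then have "?t \<otimes> (a \<otimes> b) \<otimes> inv ?t = (?t \<otimes> a \<otimes> inv ?t) \<otimes> (?t \<otimes> b \<otimes> inv ?t)"
      using conj_mult[of "inv ?t" a b] t by (simp add: H_carrier)
    then show ?thesis using ab H(2) A_closed(2)[OF ab(2,4)] by simp
  qed
qed

lemma J_cases:
  assumes "j \<in> J"
  obtains (vertex) i x where "j = Inl (i, base i x)" "x \<in> C"
    | (loop) i x where "j = Inr (i, x)" "x \<in> C" "edge i x \<noteq> \<one>"
  using assms unfolding J_def by blast

lemma sub_factor:
  assumes "j \<in> J" shows "subgroup (factor j) G"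
  using assms
proof (cases rule: J_cases)
  case (vertex i x)
  then show ?thesis using sub_factor_Inl[of "base i x" i] by (simp del: factor.simps)
next
  case (loop i x)
  then show ?thesis using subgroup_powers[OF H_carrier[OF edge_H[OF loop(2)]]] by simp
qed

lemma factor_H:
  assumes "j \<in> J" shows "factor j \<subseteq> H"
  using assms
proof (cases rule: J_cases)
  case (vertex i x)
  show ?thesis unfolding vertex(1) factor.simps by blast
next
  case (loop i x)
  show ?thesis unfolding loop(1) factor.simps
    using subgroup_int_pow_closed[OF subH edge_H[OF loop(2)]] by blast
qed

abbreviation transport :: "'i \<Rightarrow> 'g \<Rightarrow> 'c \<Rightarrow> 'g" where
  "transport i a x \<equiv> inv (tau i (act a x)) \<otimes> a \<otimes> tau i x"

text \<open>By \<open>tau_from_base\<close> both transversal values are \<open>A i\<close>-multiples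
  of the value at the common base point; conjugating by the latter leaves a product of three
  elements of \<open>A i\<close>.\<close>

lemma transport_factor:
  assumes "x \<in> C" "a \<in> A i"
  shows "transport i a x \<in> factor (Inl (i, base i x))"
proof -
  let ?y = "act a x" and ?b = "base i x" and ?t = "tau i (base i x)"
  let ?h = "inv (tau i ?y) \<otimes> a \<otimes> tau i x"
  have aM: "a \<in> M" "a \<in> carrier G" using assms A_M A_carrier by auto
  have yC: "?y \<in> C" using assms aM by simp
  have ty: "tau i ?y = from_base i ?y \<otimes> ?t" by (rule tau_from_base[OF yC, of i, unfolded base_act[OF assms(2,1)]])
  have tx: "tau i x = from_base i x \<otimes> ?t" by (rule tau_from_base[OF assms(1)])
  have fA: "from_base i ?y \<in> A i" "from_base i x \<in> A i" using from_base yC assms by auto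
  then have fc: "from_base i ?y \<in> carrier G" "from_base i x \<in> carrier G" "?t \<in> carrier G"
    using assms A_carrier by auto
  have M: "tau i ?y \<in> M" "tau i x \<in> M" using tau yC assms by auto
  have "act ?h c0 = act (inv (tau i ?y)) ?y"
    using M aM c0 assms tau(2)[of x i] by (simp add: act_mult)
  also have "\<dots> = c0" using act_inv(1)[OF M(1) c0] tau(2)[OF yC] by simp
  finally have "?h \<in> H" using M aM by (simp add: H_def)
  moreover have "?t \<otimes> ?h \<otimes> inv ?t = inv (from_base i ?y) \<otimes> a \<otimes> from_base i x"
    using fc aM by (simp add: ty tx inv_mult_group m_assoc)
  ultimately show ?thesis using fA assms by simp
qed

subsection \<open>Generation\<close>

text \<open>Reidemeister-Schreier rewriting: multiplying by one element of some \<open>A i\<close>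
  changes the cofactor of the transversal by two edges and one transport.\<close>

lemma generate_factors: "generate G (\<Union>j\<in>J. factor j) = H"
proof
  let ?F = "\<Union>j\<in>J. factor j" let ?K = "generate G ?F"
  have FH: "?F \<subseteq> H" using factor_H by blast
  then show "?K \<subseteq> H" by (rule generate_subgroup_incl[OF _ subH])
  have Fc: "?F \<subseteq> carrier G" using FH H_carrier by blast
  note K = subgroup_generate[OF Fc]
  have edge: "edge i x \<in> ?K" if "x \<in> C" for i x
  proof (cases "edge i x = \<one>")
    case False
    then have "Inr (i, x) \<in> J" using that by (simp add: J_def)
    moreover have "edge i x [^] (1 :: int) \<in> factor (Inr (i, x))" unfolding factor.simps by (rule rangeI)
    moreover have "edge i x [^] (1 :: int) = edge i x" using H_carrier[OF edge_H[OF that]] by simp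
    ultimately show ?thesis by (metis UN_I generate.incl)
  qed (simp add: generate.one)
  have fac: "h \<in> ?K" if "h \<in> factor (Inl (i, base i x))" "x \<in> C" for h i x
  proof -
    have "Inl (i, base i x) \<in> J" using that by (auto simp: J_def)
    then show ?thesis using that by (intro generate.incl) blast
  qed
  \<comment> \<open>Elements whose cofactor with respect to \<open>tau0\<close> lies in
    \<open>?K\<close>. Since \<open>tau0 c0\<close> is \<open>\<one>\<close>, an element of
    \<open>H\<close> is its own cofactor, so it suffices that \<open>Y\<close> is all of
    \<open>M\<close>.\<close>
  define Y where "Y = {g \<in> M. \<exists>h\<in>?K. g = tau0 (act g c0) \<otimes> h}"
  have step: "a \<otimes> g \<in> Y" if a: "a \<in> A i" and g: "g \<in> Y" for a g i
  proof -
    define x where "x = act g c0"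
    define y where "y = act a x"
    obtain h where h: "h \<in> ?K" "g = tau0 x \<otimes> h" and gM: "g \<in> M" using g by (auto simp: Y_def x_def)
    have aM: "a \<in> M" using a A_M by blast
    have xy: "x \<in> C" "y \<in> C" using aM gM c0 by (auto simp: x_def y_def)
    define b where "b = inv (tau i y) \<otimes> a \<otimes> tau i x"
    have b: "b \<in> ?K" using transport_factor[OF xy(1) a] fac xy by (simp add: b_def y_def)
    have e: "edge i x \<in> ?K" "edge i y \<in> ?K" using edge xy by auto
    have "inv (edge i y) \<otimes> (b \<otimes> (edge i x \<otimes> h)) \<in> ?K"
      using b e h(1) K by (simp add: subgroup.m_closed subgroup.m_inv_closed)
    moreover have c: "a \<in> carrier G" "h \<in> carrier G" using aM M_carrier h(1) K subgroup.mem_carrier by auto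
    \<comment> \<open>A telescope: the inverse edge replaces \<open>tau0 y\<close> by
      \<open>tau i y\<close>, then \<open>b\<close> leads to \<open>a \<otimes> tau i x\<close>, and
      \<open>edge i x\<close> turns this into \<open>a \<otimes> tau0 x\<close>.\<close>
    have "a \<otimes> g = tau0 y \<otimes> (inv (edge i y) \<otimes> (b \<otimes> (edge i x \<otimes> h)))"
      using xy c by (simp add: h(2) b_def edge_def inv_mult_group m_assoc)
    moreover have "act (a \<otimes> g) c0 = y" using aM gM c0 by (simp add: act_mult y_def x_def)
    moreover have "a \<otimes> g \<in> M" using aM gM by simp
    ultimately show ?thesis unfolding Y_def by blast
  qed
  have "\<forall>y\<in>Y. g \<otimes> y \<in> Y" if "g \<in> generate G (\<Union>i. A i)" for g
    using that
  proof (induction rule: generate.induct)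
    case one
    then show ?case by (auto simp: Y_def M_carrier)
  next
    case (incl h)
    then show ?case using step by blast
  next
    case (inv h)
    then obtain i where "h \<in> A i" by auto
    then have "inv h \<in> A i" by simp
    then show ?case using step by blast
  next
    case (eng h1 h2)
    have "h1 \<in> carrier G" "h2 \<in> carrier G" using eng(1,2) M_carrier by (auto simp: M_eq)
    then have "h1 \<otimes> h2 \<otimes> y = h1 \<otimes> (h2 \<otimes> y)" if "y \<in> Y" for y
      using that by (intro m_assoc) (auto simp: Y_def M_carrier)
    then show ?case using eng by metis
  qed
  moreover have "\<one> \<in> Y" using c0 by (auto simp: Y_def generate.one intro!: bexI[of _ \<one>])
  ultimately have Y: "g \<in> Y" if "g \<in> M" for g
    using that M_carrier by (metis M_eq r_one)
  show "H \<subseteq> ?K"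
  proof
    fix g assume "g \<in> H"
    then have g: "g \<in> M" "act g c0 = c0" by (auto simp: H_def)
    then obtain h where "h \<in> ?K" "g = tau0 c0 \<otimes> h" using Y[OF g(1)] by (auto simp: Y_def)
    then show "g \<in> ?K" using generate_in_carrier[OF Fc] by simp
  qed
qed

subsection \<open>Freeness\<close>

text \<open>The infinite order of the edges is yet to be shown, so in the model each loop factor is
  a copy of the powers of \<open>v\<close>, whose order is known to be infinite.\<close>

fun model :: "('i, 'c) tag \<Rightarrow> 'g set" where
  "model (Inl p) = factor (Inl p)"
| "model (Inr p) = range (\<lambda>n :: int. v [^] n)"

abbreviation reduced :: "(('i, 'c) tag \<times> 'g) list set" where
  "reduced \<equiv> {l. alternating G model l}"

text \<open>The inverse appears because \<open>tau i x\<close> is to act by the twist and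
  \<open>tau0 x\<close> without one; then \<open>edge i x\<close>, which begins with the inverse of
  \<open>tau i x\<close>, acts as \<open>v\<close>.\<close>

definition twist :: "'i \<Rightarrow> 'c \<Rightarrow> 'g" where
  "twist i x = (if edge i x = \<one> then \<one> else inv v)"

text \<open>
  Chosen so that, on \<open>(l, c0)\<close>, the elements \<open>tau0 x\<close>, \<open>edge i x\<close> and \<open>h \<in> factor (Inl p)\<close> of \<open>M\<close> come to
  act as \<open>(l, x)\<close>, \<open>(v l, c0)\<close> and \<open>(h l, c0)\<close>.
\<close>

definition rho :: "'i \<Rightarrow> 'g \<Rightarrow> (('i, 'c) tag \<times> 'g) list \<times> 'c \<Rightarrow>
    (('i, 'c) tag \<times> 'g) list \<times> 'c" where
  "rho i a = (\<lambda>(l, x).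
    (syll_act G (Inr (i, act a x)) (twist i (act a x))
      (syll_act G (Inl (i, base i x)) (transport i a x)
        (syll_act G (Inr (i, x)) (inv (twist i x)) l)), act a x))"

lemma sub_model_Inr: "subgroup (model (Inr p)) G"
  using subgroup_powers[OF v(1)] by simp

lemma twist_model: "twist i x \<in> model (Inr p)" "inv (twist i x) \<in> model (Inr p)"
proof -
  have "v [^] (1 :: int) \<in> model (Inr p)" unfolding model.simps by (rule rangeI)
  then have "v \<in> model (Inr p)" using v(1) by simp
  then show "twist i x \<in> model (Inr p)" "inv (twist i x) \<in> model (Inr p)"
    using subgroup.m_inv_closed[OF sub_model_Inr] subgroup.one_closed[OF sub_model_Inr]
    by (auto simp: twist_def)
qed

lemma gact_Inr: "gact G (model (Inr p)) reduced (syll_act G (Inr p))"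
  by (rule gact_syll_act[of model "Inr p", OF sub_model_Inr])

lemma gact_Inl: "y \<in> C \<Longrightarrow> gact G (factor (Inl (i, y))) reduced (syll_act G (Inl (i, y)))"
  using gact_syll_act[of model "Inl (i, y)"] sub_factor_Inl by simp

lemma twist_reduced:
  assumes "l \<in> reduced"
  shows "syll_act G (Inr p) (twist i x) l \<in> reduced" "syll_act G (Inr p) (inv (twist i x)) l \<in> reduced"
    "syll_act G (Inr p) (inv (twist i x)) (syll_act G (Inr p) (twist i x) l) = l"
  by (rule gact_closed[OF gact_Inr twist_model(1) assms])
    (rule gact_closed[OF gact_Inr twist_model(2) assms],
     rule gact_inv(1)[OF gact_Inr sub_model_Inr twist_model(1) assms])

text \<open>For a product the twist at the intermediate point cancels against its inverse, and the
  two transports, which lie in the same vertex factor, multiply to the transport of the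
  product.\<close>

lemma gact_rho: "gact G (A i) (reduced \<times> C) (rho i)"
  unfolding gact_def
proof (intro conjI ballI)
  fix a p assume "a \<in> A i" "p \<in> reduced \<times> C"
  then obtain l x where p: "p = (l, x)" "l \<in> reduced" "x \<in> C" and a: "a \<in> A i" by auto
  have "transport i a x \<in> factor (Inl (i, base i x))"
    by (rule transport_factor[OF p(3) a])
  then have "syll_act G (Inl (i, base i x)) (transport i a x)
      (syll_act G (Inr (i, x)) (inv (twist i x)) l) \<in> reduced"
    using p twist_reduced(2)[OF p(2)] by (intro gact_closed[OF gact_Inl]) auto
  then show "rho i a p \<in> reduced \<times> C" using twist_reduced(1) p A_M[OF a] by (simp add: rho_def)
next
  fix p assume "p \<in> reduced \<times> C"
  then obtain l x where p: "p = (l, x)" "l \<in> reduced" "x \<in> C" by auto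
  let ?l = "syll_act G (Inr (i, x)) (inv (twist i x)) l"
  have "syll_act G (Inl (i, base i x)) \<one> ?l = ?l"
    using twist_reduced(2)[OF p(2)] p by (intro gact_one[OF gact_Inl]) auto
  moreover have "syll_act G (Inr (i, x)) (twist i x) ?l = l"
    by (rule gact_inv(2)[OF gact_Inr sub_model_Inr twist_model(1) p(2)])
  ultimately show "rho i \<one> p = p" using p by (simp add: rho_def)
next
  fix a b p assume ab: "a \<in> A i" "b \<in> A i" and "p \<in> reduced \<times> C"
  then obtain l x where p: "p = (l, x)" "l \<in> reduced" "x \<in> C" by auto
  let ?l = "syll_act G (Inr (i, x)) (inv (twist i x)) l" and ?s = "syll_act G (Inl (i, base i x))"
  let ?y = "act b x" let ?z = "act a ?y"
  let ?h = "transport i a ?y" and ?k = "transport i b x"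
  have abM: "a \<in> M" "b \<in> M" using ab A_M by auto
  have yz: "?y \<in> C" "?z \<in> C" using abM p by auto
  have h: "?h \<in> factor (Inl (i, base i x))" using transport_factor[OF yz(1) ab(1)] ab p by simp
  have k: "?k \<in> factor (Inl (i, base i x))" by (rule transport_factor[OF p(3) ab(2)])
  have "?h \<otimes> ?k = inv (tau i ?z) \<otimes> (a \<otimes> b) \<otimes> tau i x"
    using yz p ab by (simp add: m_assoc A_carrier)
  moreover have l: "?l \<in> reduced" by (rule twist_reduced(2)[OF p(2)])
  have act: "?s (?h \<otimes> ?k) ?l = ?s ?h (?s ?k ?l)" "?s ?k ?l \<in> reduced"
    using gact_mult[OF gact_Inl h k l] gact_closed[OF gact_Inl k l] p by auto
  moreover have "act (a \<otimes> b) x = ?z" using abM p by (simp add: act_mult)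
  ultimately show "rho i (a \<otimes> b) p = rho i a (rho i b p)"
    using p ab twist_reduced(3)[OF act(2)] by (simp add: rho_def)
qed

text \<open>In the glued action each syllable of an alternating product puts one syllable of the
  same index in front of the current word, so a nonempty product moves \<open>([], c0)\<close>. The
  order of an edge is read off from the same action.\<close>

theorem free_factors: "free_family G J factor"
  and edge_infinite_order: "x \<in> C \<Longrightarrow> edge i x \<noteq> \<one> \<Longrightarrow> edge i x [^] (n :: int) = \<one> \<Longrightarrow> n = 0"
proof -
  obtain \<phi> where \<phi>: "gact G M (reduced \<times> C) \<phi>"
    "\<And>i a y. a \<in> A i \<Longrightarrow> y \<in> reduced \<times> C \<Longrightarrow> \<phi> a y = rho i a y"
    using glue[OF gact_rho] by blast
  have \<phi>m: "\<phi> (g \<otimes> h) y = \<phi> g (\<phi> h y)" if "g \<in> M" "h \<in> M" "y \<in> reduced \<times> C" for g h y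
    by (rule gact_mult[OF \<phi>(1) that])
  have \<phi>c: "\<phi> g y \<in> reduced \<times> C" if "g \<in> M" "y \<in> reduced \<times> C" for g y
    by (rule gact_closed[OF \<phi>(1) that])
  have \<phi>i: "\<phi> (inv g) (\<phi> g y) = y" if "g \<in> M" "y \<in> reduced \<times> C" for g y
    using gact_inv[OF \<phi>(1) subM] that by blast
  let ?t = "\<lambda>i x. syll_act G (Inr (i, x)) (twist i x)"
  have tw: "?t i x l = l" if "edge i x = \<one>" "l \<in> reduced" for i x l
    using that gact_Inr[of "(i, x)"] by (simp add: twist_def gact_def)
  have one: "syll_act G (Inl (i, base i x)) \<one> l = l" if "l \<in> reduced" "x \<in> C" for i x l
    using that gact_Inl[of "base i x" i] unfolding gact_def by simp
  \<comment> \<open>Going from the base point to \<open>x\<close>, the initial twist vanishes and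
    the transport is \<open>\<one>\<close> by \<open>tau_from_base\<close>; only the twist at
    \<open>x\<close> remains.\<close>
  have step: "\<phi> (tau i x) (l, c0) = (?t i x l, x)"
    if l: "l \<in> reduced" and x: "x \<in> C" and IH: "\<phi> (tau0 (base i x)) (l, c0) = (l, base i x)" for i x l
  proof -
    have b: "edge i (base i x) = \<one>" using tau_base[OF x] x by (simp add: edge_one)
    have f: "from_base i x \<in> A i" "act (from_base i x) (base i x) = x" using from_base x by auto
    have "\<phi> (tau i x) (l, c0) = \<phi> (from_base i x) (\<phi> (tau0 (base i x)) (l, c0))"
      unfolding tau_def using f A_M tau0 x c0 l by (intro \<phi>m) auto
    also have "\<dots> = rho i (from_base i x) (l, base i x)" using IH \<phi>(2)[OF f(1)] l x by simp
    also have "\<dots> = (?t i x l, x)"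
    proof -
      have "syll_act G (Inr (i, base i x)) (inv (twist i (base i x))) l = l"
        using tw[OF b l] b by (simp add: twist_def)
      moreover have "inv (tau i x) \<otimes> from_base i x \<otimes> tau i (base i x) = \<one>"
        unfolding tau_from_base[OF x, of i] using x A_carrier[OF f(1)] by (simp add: inv_mult_group m_assoc)
      ultimately show ?thesis using f one[OF l x, of i] x by (simp add: rho_def)
    qed
    finally show ?thesis .
  qed
  \<comment> \<open>Along a tree edge \<open>tau0 x\<close> equals \<open>tau (dirn x) x\<close>, so
    the edge element is \<open>\<one>\<close> and the twist left over by \<open>step\<close> is
    trivial.\<close>
  have t0: "\<phi> (tau0 x) (l, c0) = (l, x)" if "l \<in> reduced" "x \<in> C" for x l
    using that
  proof (induction x rule: measure_induct_rule[of depth])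
    case (less x)
    show ?case
    proof (cases "x = c0")
      case True
      then show ?thesis using \<phi>(1) less c0 by (simp add: gact_def)
    next
      case False
      then have "\<phi> (tau (dirn x) x) (l, c0) = (?t (dirn x) x l, x)"
        using less dirn by (intro step) auto
      moreover have "edge (dirn x) x = \<one>" using False less by (simp add: edge_one tau0_dirn)
      ultimately show ?thesis using tw less False by (simp add: tau0_dirn)
    qed
  qed
  have t: "\<phi> (tau i x) (l, c0) = (?t i x l, x)" if "l \<in> reduced" "x \<in> C" for i x l
    using step[OF that t0] that by simp
  \<comment> \<open>\<open>h\<close> is a conjugate by \<open>?u\<close> of some
    \<open>a \<in> A i\<close> that fixes the base point. There the twists vanish and the transport
    of \<open>a\<close> is \<open>h\<close> itself.\<close>
  have Inl: "\<phi> h (l, c0) = (syll_act G (Inl (i, base i x)) h l, c0)"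
    if h: "h \<in> factor (Inl (i, base i x))" and l: "l \<in> reduced" and x: "x \<in> C" for i x h l
  proof -
    let ?y = "base i x" let ?u = "tau i (base i x)"
    have y: "?y \<in> C" "base i ?y = ?y" "edge i ?y = \<one>"
      using x tau_base[OF x] by (simp_all add: edge_one)
    have hH: "h \<in> H" "?u \<otimes> h \<otimes> inv ?u \<in> A i" using h by auto
    define a where "a = ?u \<otimes> h \<otimes> inv ?u"
    have u: "?u \<in> M" "?u \<in> carrier G" using tau y by auto
    have hM: "h \<in> M" "h \<in> carrier G" using hH H_carrier by (auto simp: H_def)
    have inv_u: "act (inv ?u) ?y = c0" using act_inv(1)[OF u(1) c0] tau(2)[OF y(1), of i] by simp
    have ay: "act a ?y = ?y"
      using hH u hM y inv_u tau(2)[OF y(1), of i] c0 by (simp add: a_def act_mult H_def)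
    have h_eq: "conj_by ?u a = h" using u hM by (simp add: a_def m_assoc)
    have aA: "a \<in> A i" using hH by (simp add: a_def)
    have m: "syll_act G (Inl (i, ?y)) h l \<in> reduced"
      by (rule gact_closed[OF gact_Inl[OF y(1)] h l])
    have twy: "syll_act G (Inr (i, ?y)) (twist i ?y) m = m"
      "syll_act G (Inr (i, ?y)) (inv (twist i ?y)) m = m" if "m \<in> reduced" for m
      using tw[OF y(3) that] y(3) by (simp_all add: twist_def)
    have "\<phi> h (l, c0) = \<phi> (inv ?u \<otimes> (a \<otimes> ?u)) (l, c0)"
      using h_eq u aA by (simp add: m_assoc A_carrier)
    also have "\<dots> = \<phi> (inv ?u) (\<phi> a (\<phi> ?u (l, c0)))"
      using u aA A_M l c0 by (subst \<phi>m; simp add: \<phi>m)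
    also have "\<phi> ?u (l, c0) = (l, ?y)" using t[OF l y(1), of i] twy l by simp
    also have "\<phi> a (l, ?y) = (syll_act G (Inl (i, ?y)) h l, ?y)"
      using \<phi>(2)[OF aA, of "(l, ?y)"] l y(1,2) twy[OF l] twy[OF m] ay h_eq by (simp add: rho_def)
    also have "\<dots> = \<phi> ?u (syll_act G (Inl (i, ?y)) h l, c0)"
      using t[OF m y(1), of i] twy m by simp
    also have "\<phi> (inv ?u) \<dots> = (syll_act G (Inl (i, ?y)) h l, c0)"
      using \<phi>i[OF u(1)] m c0 by simp
    finally show ?thesis .
  qed
  have edge1: "\<phi> (edge i x) (l, c0) = (syll_act G (Inr (i, x)) v l, c0)"
    if e: "edge i x \<noteq> \<one>" and l: "l \<in> reduced" and x: "x \<in> C" for i x l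
  proof -
    have u: "tau i x \<in> M" "tau0 x \<in> M" using tau tau0 x by auto
    have tv: "inv (twist i x) = v" using e v by (simp add: twist_def)
    let ?m = "syll_act G (Inr (i, x)) v l"
    have m: "?m \<in> reduced" using twist_reduced(2)[OF l, of "(i, x)" i x] tv by simp
    have "\<phi> (edge i x) (l, c0) = \<phi> (inv (tau i x)) (l, x)"
      unfolding edge_def using u l c0 t0[OF l x] by (subst \<phi>m) auto
    moreover have "\<phi> (tau i x) (?m, c0) = (l, x)"
      using t[OF m x, of i] gact_inv(2)[OF gact_Inr sub_model_Inr twist_model(1) l, of "(i, x)" i x] tv
      by simp
    moreover have "\<phi> (inv (tau i x)) (\<phi> (tau i x) (?m, c0)) = (?m, c0)"
      using \<phi>i[OF u(1)] m c0 by simp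
    ultimately show ?thesis by simp
  qed
  have vm: "v [^] n \<in> model (Inr p)" for n :: int and p by simp
  have Inr: "\<phi> (edge i x [^] n) (l, c0) = (syll_act G (Inr (i, x)) (v [^] n) l, c0)"
    if e: "edge i x \<noteq> \<one>" and l: "l \<in> reduced" and x: "x \<in> C" for i x l and n :: int
  proof -
    let ?s = "syll_act G (Inr (i, x))"
    have eM: "edge i x [^] n \<in> M" for n :: int
      using edge_H[OF x, of i] subgroup_int_pow_closed[OF subM] by (auto simp: H_def)
    have ec: "edge i x \<in> carrier G" using edge_H[OF x] H_carrier by blast
    have red: "?s (v [^] n) l \<in> reduced" if "l \<in> reduced" for n :: int and l
      by (rule gact_closed[OF gact_Inr vm that])
    have vmult: "?s (v [^] m \<otimes> v [^] n) l = ?s (v [^] m) (?s (v [^] n) l)"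
      if "l \<in> reduced" for m n :: int and l
      by (rule gact_mult[OF gact_Inr vm vm that])
    have step_up: "\<phi> (edge i x) (l, c0) = (?s v l, c0)" and step_down: "\<phi> (inv (edge i x)) (l, c0) = (?s (inv v) l, c0)"
      if l: "l \<in> reduced" for l
    proof -
      show "\<phi> (edge i x) (l, c0) = (?s v l, c0)" by (rule edge1[OF e l x])
      have m: "?s (inv v) l \<in> reduced" using red[OF l, of "-1"] v(1) by (simp add: int_pow_neg)
      have "\<phi> (edge i x) (?s (inv v) l, c0) = (l, c0)"
        using edge1[OF e m x] vmult[OF l, of 1 "-1"] gact_one[OF gact_Inr, of l "(i, x)"] v(1) l
        by (simp add: int_pow_neg)
      then show "\<phi> (inv (edge i x)) (l, c0) = (?s (inv v) l, c0)"
        using \<phi>i[of "edge i x" "(?s (inv v) l, c0)"] eM[of 1] ec m c0 by simp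
    qed
    have "\<phi> (edge i x [^] n) (l, c0) = (?s (v [^] n) l, c0)" if "l \<in> reduced" for l
      using that
    proof (induction n arbitrary: l rule: int_induct[of _ 0])
      case base
      then show ?case using gact_one[OF \<phi>(1)] gact_one[OF gact_Inr] c0 by simp
    next
      case (step1 k)
      have "edge i x [^] (k + 1) = edge i x [^] k \<otimes> edge i x" "v [^] (k + 1) = v [^] k \<otimes> v [^] (1 :: int)"
        using ec v(1) int_pow_mult[OF ec, of k 1] int_pow_mult[OF v(1), of k 1] by simp_all
      then show ?case
        using step_up[OF step1.prems] step1.IH[OF red[OF step1.prems, of 1]] vmult[OF step1.prems, of k 1]
          \<phi>m[OF eM, of "edge i x" "(l, c0)" k] eM[of 1] ec v(1) c0 step1.prems by simp
    next
      case (step2 k)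
      have "edge i x [^] (k - 1) = edge i x [^] k \<otimes> inv (edge i x)" "v [^] (k - 1) = v [^] k \<otimes> v [^] (- 1 :: int)"
        using ec v(1) int_pow_diff[OF ec, of k 1] int_pow_mult[OF v(1), of k "-1"] by simp_all
      then show ?case
        using step_down[OF step2.prems] step2.IH[OF red[OF step2.prems, of "-1"]] vmult[OF step2.prems, of k "-1"]
          \<phi>m[OF eM, of "inv (edge i x)" "(l, c0)" k] eM[of "-1"] ec v(1) c0 step2.prems
        by (simp add: int_pow_neg)
    qed
    then show ?thesis using l by blast
  qed
  \<comment> \<open>Only the index of the new syllable is recorded: for an \<open>Inr\<close> tag
    its entry is a power of \<open>v\<close> and not \<open>b\<close>.\<close>
  have syl: "\<exists>s. \<phi> b (l, c0) = (s, c0) \<and> (\<exists>c. s = (j, c) # l)"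
    if j: "j \<in> J" and b: "b \<in> factor j" "b \<noteq> \<one>" and l: "l \<in> reduced" "l = [] \<or> fst (hd l) \<noteq> j" for j b l
  proof (cases j)
    case Inl': (Inl p)
    with j obtain i x where x: "x \<in> C" "p = (i, base i x)" by (cases rule: J_cases) auto
    have "b \<in> carrier G" using sub_factor[OF j] b(1) subgroup.mem_carrier by metis
    moreover have "alternating G model ((j, b) # l)" using b l Inl' by simp
    ultimately have "syll_act G j b l = (j, b) # l" by (intro syll_act_Cons)
    then show ?thesis using Inl[of b i x l] Inl' b(1) l(1) x by simp
  next
    case Inr': (Inr p)
    with j obtain i x where x: "x \<in> C" "p = (i, x)" "edge i x \<noteq> \<one>" by (cases rule: J_cases) auto
    obtain n :: int where n: "b = edge i x [^] n" using b Inr' x by auto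
    then have "n \<noteq> 0" using b by auto
    then have "alternating G model ((j, v [^] n) # l)" using v(2) l Inr' by auto
    then have "syll_act G j (v [^] n) l = (j, v [^] n) # l" using v(1) by (intro syll_act_Cons) auto
    then show ?thesis using Inr[OF x(3) l(1) x(1), of n] Inr' x n by simp
  qed
  have main: "\<exists>m. \<phi> (syll_prod G l) ([], c0) = (m, c0) \<and> m \<in> reduced \<and> map fst m = map fst l \<and>
      syll_prod G l \<in> M"
    if "alternating G factor l" "fst ` set l \<subseteq> J" for l
    using that
  proof (induction l)
    case Nil
    then show ?case using \<phi>(1) c0 by (auto simp: gact_def)
  next
    case (Cons p l)
    obtain j b where p: "p = (j, b)" by (cases p)
    obtain m where m: "\<phi> (syll_prod G l) ([], c0) = (m, c0)" "m \<in> reduced" "map fst m = map fst l"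
      "syll_prod G l \<in> M" using Cons p by auto
    have j: "j \<in> J" "b \<in> factor j" "b \<noteq> \<one>" using Cons.prems p by auto
    have bM: "b \<in> M" using factor_H[OF j(1)] j by (auto simp: H_def)
    have "m = [] \<or> fst (hd m) \<noteq> j"
      using Cons.prems(1) p m(3) by (cases l; cases m) auto
    then obtain s c where s: "\<phi> b (m, c0) = (s, c0)" "s = (j, c) # m"
      using syl[OF j m(2)] by blast
    have "\<phi> (syll_prod G (p # l)) ([], c0) = (s, c0)"
      using s m bM c0 p by (simp add: \<phi>m)
    moreover have "s \<in> reduced" using \<phi>c[OF bM, of "(m, c0)"] s(1) m(2) c0 by simp
    ultimately show ?case using s m p bM by auto
  qed
  show "n = 0" if x: "x \<in> C" and e: "edge i x \<noteq> \<one>" and n: "edge i x [^] n = \<one>" for x i and n :: int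
  proof (rule ccontr)
    assume "n \<noteq> 0"
    then have "alternating G model [(Inr (i, x), v [^] n)]" using v(2) by auto
    then have "syll_act G (Inr (i, x)) (v [^] n) [] = [(Inr (i, x), v [^] n)]"
      using v(1) by (intro syll_act_Cons) auto
    then have "\<phi> \<one> ([], c0) = ([(Inr (i, x), v [^] n)], c0)"
      using Inr[OF e _ x, of "[]" n] n by simp
    moreover have "\<phi> \<one> ([], c0) = ([], c0)" using \<phi>(1) c0 by (simp add: gact_def)
    ultimately show False by simp
  qed
  show "free_family G J factor" unfolding free_family_def
  proof (intro allI impI notI)
    fix l assume l: "alternating G factor l \<and> fst ` set l \<subseteq> J \<and> l \<noteq> []" and one: "syll_prod G l = \<one>"
    obtain m where "\<phi> (syll_prod G l) ([], c0) = (m, c0)" "map fst m = map fst l"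
      using main l by blast
    moreover have "\<phi> \<one> ([], c0) = ([], c0)" using \<phi>(1) c0 by (simp add: gact_def)
    ultimately show False using one l by simp
  qed
qed

section \<open>Conjugates of the factors inside the stabiliser, and malnormality\<close>

lemma conj_in_factor:
  assumes t: "t \<in> M" and h: "h \<in> H" "t \<otimes> h \<otimes> inv t \<in> A i"
  shows "\<exists>k\<in>H. k \<otimes> h \<otimes> inv k \<in> factor (Inl (i, base i (act t c0)))"
proof -
  define x where "x = act t c0"
  define f where "f = from_base i x"
  define b where "b = tau i (base i x)"
  have x: "x \<in> C" using t c0 by (simp add: x_def)
  have f: "f \<in> A i" "f \<in> carrier G" using from_base(1)[OF x, of i] A_carrier by (auto simp: f_def)
  have b: "b \<in> carrier G" using x by (simp add: b_def)
  have tx: "tau i x = f \<otimes> b" unfolding f_def b_def by (rule tau_from_base[OF x])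
  have txM: "tau i x \<in> M" "act (tau i x) c0 = x" using tau[OF x] by auto
  have tc: "t \<in> carrier G" "h \<in> carrier G" using t h M_carrier H_carrier by auto
  \<comment> \<open>\<open>t\<close> and \<open>tau i x\<close> both carry \<open>c0\<close> to
    \<open>x\<close>, so \<open>k\<close> fixes \<open>c0\<close>; conjugating by it replaces
    \<open>t\<close> by the transversal element.\<close>
  define k where "k = inv (tau i x) \<otimes> t"
  have "act k c0 = c0" using txM t c0 act_inv(1)[OF txM(1) c0] by (simp add: k_def act_mult x_def[symmetric])
  then have k: "k \<in> H" using txM t by (simp add: k_def H_def)
  have "b \<otimes> (k \<otimes> h \<otimes> inv k) \<otimes> inv b = conj_by f (t \<otimes> h \<otimes> inv t)"
    using f b tc by (simp add: k_def tx inv_mult_group m_assoc)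
  then have "b \<otimes> (k \<otimes> h \<otimes> inv k) \<otimes> inv b \<in> A i" using f h by simp
  moreover have "k \<otimes> h \<otimes> inv k \<in> H"
    using k h subgroup.m_closed[OF subH] subgroup.m_inv_closed[OF subH] by blast
  ultimately show ?thesis using k by (auto simp: b_def x_def[symmetric])
qed

lemma base_fixed:
  assumes "x \<in> C" "\<And>a. a \<in> A i \<Longrightarrow> act a x = x"
  shows "base i x = x"
  using base[of i x] assms by (auto simp: orb_def)

text \<open>A fixed point is a one-point orbit and its own base, and the full conjugate of
  \<open>A i\<close> fixes \<open>c0\<close>. So fixed points yield whole conjugates of
  \<open>A i\<close> among the free factors, and not merely subgroups of them.\<close>

lemma factor_fixed:
  assumes x: "x \<in> C" and fix_x: "\<And>a. a \<in> A i \<Longrightarrow> act a x = x"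
  shows "Inl (i, x) \<in> J" "factor (Inl (i, x)) = conj_by (tau i x) ` A i"
proof -
  let ?t = "tau i x"
  show "Inl (i, x) \<in> J" using base_fixed[of x i] assms unfolding J_def by force
  have t: "?t \<in> M" "?t \<in> carrier G" "act ?t c0 = x" using tau[OF x] M_carrier by auto
  show "factor (Inl (i, x)) = conj_by ?t ` A i"
  proof (intro equalityI subsetI)
    fix h assume "h \<in> factor (Inl (i, x))"
    then have h: "h \<in> carrier G" "?t \<otimes> h \<otimes> inv ?t \<in> A i" using H_carrier by auto
    show "h \<in> conj_by ?t ` A i"
      by (rule image_eqI[OF _ h(2)]) (use conj_cancel(2)[OF t(2) h(1)] in simp)
  next
    fix h assume "h \<in> conj_by ?t ` A i"
    then obtain a where a: "a \<in> A i" "h = conj_by ?t a" by blast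
    have aM: "a \<in> M" "a \<in> carrier G" using a A_M A_carrier by auto
    have "act h c0 = c0"
      using a aM t c0 x fix_x act_inv(1)[OF t(1) c0] by (simp add: act_mult)
    then have "h \<in> H" using a aM t by (simp add: H_def)
    then show "h \<in> factor (Inl (i, x))" using a conj_cancel(1)[OF t(2) aM(2)] by simp
  qed
qed

text \<open>Here \<open>c0\<close> is fixed by \<open>A j\<close>, so \<open>A j\<close> is itself
  one of the free factors of \<open>H\<close>. A conjugate of \<open>a\<close> lies in it and also
  in the factor of the \<open>A i\<close>-orbit of \<open>act t c0\<close>; distinct free factors
  meet trivially, so the indices agree and \<open>t\<close> fixes \<open>c0\<close>.\<close>

lemma malnormal_stabiliser:
  assumes H: "H = A j" and a: "a \<in> A i" "a \<noteq> \<one>" and t: "t \<in> M" "conj_by t a \<in> A j"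
  shows "i = j \<and> t \<in> A j"
proof -
  have fix_c0: "act b c0 = c0" if "b \<in> A j" for b using that H by (auto simp: H_def)
  have base_c0: "base j c0 = c0" using base_fixed[of c0 j] c0 fix_c0 by blast
  have "tau j c0 = \<one>" using tau_base[OF c0, of j] base_c0 by simp
  then have F: "factor (Inl (j, c0)) = A j" "Inl (j, c0) \<in> J"
    using factor_fixed[of c0 j] c0 fix_c0 A_carrier by (simp_all del: factor.simps)
  define h where "h = conj_by t a"
  have c: "t \<in> carrier G" "a \<in> carrier G" using t a M_carrier A_carrier by auto
  have h: "h \<in> H" "t \<otimes> h \<otimes> inv t \<in> A i" "h \<noteq> \<one>" "h \<in> carrier G"
    using t H a c conj_cancel(1)[OF c] by (auto simp: h_def)
  obtain k where k: "k \<in> H" "k \<otimes> h \<otimes> inv k \<in> factor (Inl (i, base i (act t c0)))"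
    using conj_in_factor[OF t(1) h(1,2)] by blast
  have J: "Inl (i, base i (act t c0)) \<in> J" using t c0 by (auto simp: J_def)
  have kc: "k \<in> carrier G" using k H_carrier by blast
  have "k \<otimes> h \<otimes> inv k \<in> H"
    using k h subgroup.m_closed[OF subH] subgroup.m_inv_closed[OF subH] by blast
  then have "k \<otimes> h \<otimes> inv k \<in> factor (Inl (j, c0))" using F H by simp
  moreover have "k \<otimes> h \<otimes> inv k \<noteq> \<one>"
  proof
    assume "k \<otimes> h \<otimes> inv k = \<one>"
    then have "conj_by k (k \<otimes> h \<otimes> inv k) = \<one>" using kc by simp
    then show False using conj_cancel(2)[OF kc h(4)] h(3) by simp
  qed
  ultimately have "Inl (i, base i (act t c0)) = (Inl (j, c0) :: ('i, 'c) tag)"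
    using free_family_disjoint[OF free_factors J F(2)] sub_factor[OF F(2)] k(2) by blast
  then have ij: "i = j" "base j (act t c0) = c0" by auto
  obtain b where "b \<in> A j" "act b (base j (act t c0)) = act t c0" using base_orb[of "act t c0" j] t c0 by auto
  then have "act t c0 = c0" using ij fix_c0 by simp
  then show ?thesis using ij t H by (auto simp: H_def)
qed

end

section \<open>Splitting a generating set\<close>

context group
begin

text \<open>The universal property with the permutations of \<open>Y\<close> as target;
  \<open>restrict\<close> appears because \<open>BijGroup Y\<close> consists of extensional
  functions.\<close>

lemma pc_basis_gact:
  fixes Y :: "'y set"
  assumes X: "pc_basis G X" and f: "\<And>x. x \<in> X \<Longrightarrow> bij_betw (f x) Y Y"
    and c: "\<And>x x' y. x \<in> X \<Longrightarrow> x' \<in> X \<Longrightarrow> comm G x x' \<Longrightarrow> y \<in> Y \<Longrightarrow> f x (f x' y) = f x' (f x y)"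
  obtains \<phi> where "gact G (generate G X) Y \<phi>" "\<And>x y. x \<in> X \<Longrightarrow> y \<in> Y \<Longrightarrow> \<phi> x y = f x y"
proof -
  let ?F = "\<lambda>x. restrict (f x) Y"
  have mult: "(g \<otimes>\<^bsub>BijGroup Y\<^esub> h) y = g (h y)" if "g \<in> Bij Y" "h \<in> Bij Y" "y \<in> Y" for g h y
    using that by (simp add: BijGroup_def compose_def)
  have Bij_mem: "g y \<in> Y" if "g \<in> Bij Y" "y \<in> Y" for g y
    using that Bij_imp_funcset by fastforce
  have fY: "f x y \<in> Y" if "x \<in> X" "y \<in> Y" for x y using f[OF that(1)] that(2) by (auto simp: bij_betw_def)
  have F: "?F x \<in> Bij Y" if "x \<in> X" for x
    using f[OF that] by (simp add: Bij_def bij_betw_restrict_eq)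
  have FB: "?F \<in> X \<rightarrow> carrier (BijGroup Y)" using F by (simp add: BijGroup_def)
  have Fc: "comm (BijGroup Y) (?F x) (?F x')" if "x \<in> X" "x' \<in> X" "comm G x x'" for x x'
  proof -
    have "compose Y (?F x) (?F x') = compose Y (?F x') (?F x)"
      using c[OF that] fY that by (auto simp: compose_def intro!: restrict_ext)
    then show ?thesis using F that by (simp add: comm_def BijGroup_def)
  qed
  obtain \<phi> where \<phi>: "\<phi> \<in> generate G X \<rightarrow> carrier (BijGroup Y)"
    "\<And>g h. g \<in> generate G X \<Longrightarrow> h \<in> generate G X \<Longrightarrow> \<phi> (g \<otimes> h) = \<phi> g \<otimes>\<^bsub>BijGroup Y\<^esub> \<phi> h"
    "\<And>x. x \<in> X \<Longrightarrow> \<phi> x = ?F x" "\<And>w. w \<in> words X \<Longrightarrow> \<phi> (word_val G id w) = word_val (BijGroup Y) ?F w"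
    by (rule pc_basis_extend[OF X group_BijGroup FB Fc]) blast+
  have \<phi>B: "\<phi> g \<in> Bij Y" if "g \<in> generate G X" for g using \<phi>(1) that by (auto simp: BijGroup_def)
  have "\<phi> \<one> = \<one>\<^bsub>BijGroup Y\<^esub>" using \<phi>(4)[of "[]"] by simp
  then have "\<phi> \<one> y = y" if "y \<in> Y" for y using that by (simp add: BijGroup_def)
  then have "gact G (generate G X) Y \<phi>"
    unfolding gact_def using \<phi>B Bij_mem \<phi>(2) mult by simp
  then show ?thesis by (rule that) (use \<phi>(3) in simp)
qed

lemma gact_bij:
  assumes "gact G S Y \<rho>" "subgroup S G" "g \<in> S" shows "bij_betw (\<rho> g) Y Y"
proof (rule bij_betw_byWitness[where f' = "\<rho> (inv g)"])
  have "inv g \<in> S" using assms subgroup.m_inv_closed by metis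
  then show "\<rho> g ` Y \<subseteq> Y" "\<rho> (inv g) ` Y \<subseteq> Y" using assms by (auto simp: gact_def)
qed (use gact_inv[OF assms] in auto)

lemma gact_mono: "gact G S Y \<rho> \<Longrightarrow> T \<subseteq> S \<Longrightarrow> gact G T Y \<rho>"
  unfolding gact_def by blast

lemma gact_agree:
  assumes \<phi>: "gact G (generate G X) Y \<phi>" and \<psi>: "gact G (generate G X) Y \<psi>" and X: "X \<subseteq> carrier G"
    and eq: "\<And>x y. x \<in> X \<Longrightarrow> y \<in> Y \<Longrightarrow> \<phi> x y = \<psi> x y" and g: "g \<in> generate G X" and "y \<in> Y"
  shows "\<phi> g y = \<psi> g y"
  using g assms(6)
proof (induction arbitrary: y rule: generate.induct)
  case one
  then show ?case using \<phi> \<psi> by (simp add: gact_def)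
next
  case (incl h)
  then show ?case using eq by simp
next
  case (inv h)
  note S = subgroup_generate[OF X]
  have h: "h \<in> generate G X" "inv h \<in> generate G X" using inv by (auto intro: generate.incl generate.inv)
  let ?z = "\<psi> (inv h) y"
  have z: "?z \<in> Y" by (rule gact_closed[OF \<psi> h(2) inv(2)])
  have "\<phi> (inv h) y = \<phi> (inv h) (\<phi> h ?z)"
    using gact_inv(2)[OF \<psi> S h(1) inv(2)] eq[OF inv(1) z] by simp
  also have "\<dots> = ?z" by (rule gact_inv(1)[OF \<phi> S h(1) z])
  finally show ?case .
next
  case (eng h1 h2)
  then show ?case using \<phi> \<psi> by (simp add: gact_def)
qed

lemma mult_int_pow:
  assumes S: "subgroup S G" and P: "group P" and \<phi>: "\<phi> \<in> S \<rightarrow> carrier P"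
    "\<And>g h. g \<in> S \<Longrightarrow> h \<in> S \<Longrightarrow> \<phi> (g \<otimes> h) = \<phi> g \<otimes>\<^bsub>P\<^esub> \<phi> h" and x: "x \<in> S"
  shows "\<phi> (x [^] (k :: int)) = \<phi> x [^]\<^bsub>P\<^esub> k"
proof -
  interpret h: group_hom "G\<lparr>carrier := S\<rparr>" P \<phi>
    by (rule group_hom.intro[OF subgroup.subgroup_is_group[OF S is_group] P])
      (unfold_locales, use \<phi> in \<open>auto simp: hom_def\<close>)
  show ?thesis using h.hom_int_pow[of x k] int_pow_consistent[OF S x, of k] x by simp
qed

text \<open>The exponent sum, which sends every generator to \<open>1\<close>, is a homomorphism to
  the integers and takes the value \<open>n\<close> on the given power.\<close>

lemma pc_basis_infinite_order:
  assumes X: "pc_basis G X" "x \<in> X" and n: "x [^] (n :: int) = \<one>"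
  shows "n = 0"
proof -
  have f: "(\<lambda>x. 1) \<in> X \<rightarrow> carrier integer_group" by simp
  have S: "subgroup (generate G X) G" using subgroup_generate pc_basis_carrier[OF X(1)] by blast
  obtain \<phi> :: "'a \<Rightarrow> int" where \<phi>X: "\<And>y. y \<in> X \<Longrightarrow> \<phi> y = 1" and \<phi>:
    "\<And>g h. g \<in> generate G X \<Longrightarrow> h \<in> generate G X \<Longrightarrow> \<phi> (g \<otimes> h) = \<phi> g + \<phi> h"
    by (rule pc_basis_extend[OF X(1) group_integer_group f], simp add: comm_def, simp only: mult_integer_group, blast)
  have "\<phi> (x [^] n) = \<phi> x [^]\<^bsub>integer_group\<^esub> n"
    by (rule mult_int_pow[OF S group_integer_group _ _ generate.incl[OF X(2)]]) (simp_all add: \<phi>)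
  moreover have "\<phi> \<one> = 0" using \<phi>[of \<one> \<one>] by (simp add: generate.one)
  ultimately show ?thesis using \<phi>X[OF X(2)] n by simp
qed

lemma pc_basis_not_one: "pc_basis G X \<Longrightarrow> \<one> \<notin> X"
  using pc_basis_infinite_order[of X \<one> 1] by auto

lemma left_coset_eq:
  assumes "subgroup K G" "g \<in> carrier G" "h \<in> carrier G"
  shows "g <# K = h <# K \<longleftrightarrow> inv h \<otimes> g \<in> K"
proof
  interpret K: subgroup K G by fact
  assume eq: "g <# K = h <# K"
  have "g \<otimes> \<one> \<in> g <# K" unfolding l_coset_def using K.one_closed by blast
  then have "g \<in> h <# K" using eq assms by simp
  then obtain k where "k \<in> K" "g = h \<otimes> k" by (auto simp: l_coset_def)
  then show "inv h \<otimes> g \<in> K" using assms K.mem_carrier by simp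
next
  interpret K: subgroup K G by fact
  assume k: "inv h \<otimes> g \<in> K"
  have "g \<otimes> x \<in> h <# K" "h \<otimes> x \<in> g <# K" if x: "x \<in> K" for x
  proof -
    have "g \<otimes> x = h \<otimes> (inv h \<otimes> g \<otimes> x)" "h \<otimes> x = g \<otimes> (inv (inv h \<otimes> g) \<otimes> x)"
      using assms K.mem_carrier[OF x] by (simp_all add: m_assoc inv_mult_group)
    moreover have "inv h \<otimes> g \<otimes> x \<in> K" "inv (inv h \<otimes> g) \<otimes> x \<in> K"
      using k x by (simp_all add: K.m_closed K.m_inv_closed)
    ultimately show "g \<otimes> x \<in> h <# K" "h \<otimes> x \<in> g <# K" unfolding l_coset_def by blast+
  qed
  then show "g <# K = h <# K" unfolding l_coset_def by blast
qed

end

section \<open>Free products: two generating sets with no commutation between them\<close>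

locale split_group = group G for G :: "('g, 'm) monoid_scheme" (structure) +
  fixes V :: "bool \<Rightarrow> 'g set"
  assumes pc_basis_V: "pc_basis G (\<Union>i. V i)"
    and V_nonempty: "V i \<noteq> {}"
    and V_across: "x \<in> V i \<Longrightarrow> y \<in> V j \<Longrightarrow> i \<noteq> j \<Longrightarrow> \<not> comm G x y"
begin

definition A :: "bool \<Rightarrow> 'g set" where "A i = generate G (V i)"
definition M :: "'g set" where "M = generate G (\<Union>i. V i)"

lemma V_carrier: "V i \<subseteq> carrier G"
  using pc_basis_carrier[OF pc_basis_V] by blast

lemma subA: "subgroup (A i) G"
  unfolding A_def by (rule subgroup_generate[OF V_carrier])

lemma subM: "subgroup M G"
  unfolding M_def by (rule subgroup_generate) (use V_carrier in blast)

lemma V_A: "V i \<subseteq> A i"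
  unfolding A_def by (blast intro: generate.incl)

lemma A_M: "A i \<subseteq> M"
  unfolding A_def M_def by (rule mono_generate) blast

lemma M_eq: "M = generate G (\<Union>i. A i)"
proof
  show "M \<subseteq> generate G (\<Union>i. A i)" unfolding M_def by (rule mono_generate) (use V_A in blast)
  show "generate G (\<Union>i. A i) \<subseteq> M" by (rule generate_subgroup_incl[OF _ subM]) (use A_M in blast)
qed

text \<open>The universal property of the free product. A generator acts through the only piece
  containing it, pieces being disjoint since \<open>comm\<close> is reflexive; commuting generators
  share a piece, where the given action takes care of them.\<close>

lemma glue:
  assumes \<rho>: "\<And>i. gact G (A i) Y (\<rho> i)"
  shows "\<exists>\<phi>. gact G M Y \<phi> \<and> (\<forall>i. \<forall>a\<in>A i. \<forall>y\<in>Y. \<phi> a y = \<rho> i a y)"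
proof -
  define \<kappa> where "\<kappa> x = (SOME i. x \<in> V i)" for x
  have \<kappa>: "\<kappa> x = i" if "x \<in> V i" for x i
  proof -
    have "x \<in> V (\<kappa> x)" unfolding \<kappa>_def by (rule someI[of "\<lambda>i. x \<in> V i", OF that])
    then show ?thesis using V_across[OF that, of x "\<kappa> x"] by auto
  qed
  have bij: "bij_betw (\<rho> (\<kappa> x) x) Y Y" if x: "x \<in> (\<Union>i. V i)" for x
  proof -
    obtain i where "x \<in> V i" using x by blast
    then show ?thesis using gact_bij[OF \<rho> subA subsetD[OF V_A]] \<kappa> by simp
  qed
  have c: "\<rho> (\<kappa> x) x (\<rho> (\<kappa> x') x' y) = \<rho> (\<kappa> x') x' (\<rho> (\<kappa> x) x y)"
    if x: "x \<in> (\<Union>i. V i)" "x' \<in> (\<Union>i. V i)" and xx: "comm G x x'" and y: "y \<in> Y" for x x' y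
  proof -
    obtain i j where ij: "x \<in> V i" "x' \<in> V j" using x by blast
    then have "i = j" using V_across xx by blast
    then have A: "x \<in> A i" "x' \<in> A i" and k: "\<kappa> x = i" "\<kappa> x' = i" using ij V_A \<kappa> by auto
    show ?thesis using gact_mult[OF \<rho> A y] gact_mult[OF \<rho> A(2,1) y] xx by (simp add: k comm_def)
  qed
  obtain \<phi> where \<phi>: "gact G M Y \<phi>" "\<And>x y. x \<in> (\<Union>i. V i) \<Longrightarrow> y \<in> Y \<Longrightarrow> \<phi> x y = \<rho> (\<kappa> x) x y"
    unfolding M_def by (rule pc_basis_gact[OF pc_basis_V bij c]) blast+
  have "\<phi> a y = \<rho> i a y" if a: "a \<in> A i" and y: "y \<in> Y" for a i y
  proof (rule gact_agree[OF _ _ V_carrier _ a[unfolded A_def] y])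
    show "gact G (generate G (V i)) Y \<phi>" using gact_mono[OF \<phi>(1) A_M] by (simp add: A_def)
    show "gact G (generate G (V i)) Y (\<rho> i)" using \<rho>[of i] by (simp add: A_def)
    show "\<phi> x y = \<rho> i x y" if "x \<in> V i" "y \<in> Y" for x y using \<phi>(2)[of x y] that \<kappa> by auto
  qed
  then show ?thesis using \<phi>(1) by blast
qed

definition vv :: 'g where "vv = (SOME x. x \<in> V True)"

lemma vv: "vv \<in> V True" "vv \<in> carrier G" "vv [^] (n :: int) = \<one> \<Longrightarrow> n = 0"
proof -
  show v: "vv \<in> V True" unfolding vv_def using V_nonempty by (simp add: some_in_eq)
  then show "vv \<in> carrier G" using V_carrier by blast
  show "vv [^] (n :: int) = \<one> \<Longrightarrow> n = 0"
    using pc_basis_infinite_order[OF pc_basis_V, of vv n] v by blast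
qed

text \<open>Makes an arbitrary subgroup \<open>K\<close> of \<open>M\<close> a point stabiliser, so
  that the decomposition of stabilisers covers all subgroups.\<close>

lemma free_product_action_coset:
  assumes K: "subgroup K G" "K \<subseteq> M"
  shows "free_product_action G A M ((\<lambda>g. g <# K) ` M) (\<lambda>g x. g <# x) K vv"
proof (intro free_product_action.intro free_product_action_axioms.intro is_group subA M_eq vv(2))
  note Mc = subgroup.mem_carrier[OF subM]
  have Kc: "K \<subseteq> carrier G" using K subgroup.subset by blast
  have eK: "\<one> <# K = K" using Kc by (force simp: l_coset_def)
  have assoc: "g <# (h <# K) = (g \<otimes> h) <# K" if "g \<in> M" "h \<in> M" for g h
    using lcos_m_assoc[OF Kc] that Mc by auto
  show "gact G M ((\<lambda>g. g <# K) ` M) (\<lambda>g x. g <# x)"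
    unfolding gact_def
  proof (intro conjI ballI)
    fix g y assume "g \<in> M" "y \<in> (\<lambda>g. g <# K) ` M"
    then show "g <# y \<in> (\<lambda>g. g <# K) ` M" using assoc subgroup.m_closed[OF subM] by auto
  next
    fix y assume "y \<in> (\<lambda>g. g <# K) ` M"
    then show "\<one> <# y = y" using assoc[OF subgroup.one_closed[OF subM]] Mc by auto
  next
    fix g h y assume gh: "g \<in> M" "h \<in> M" and "y \<in> (\<lambda>g. g <# K) ` M"
    then obtain k where k: "k \<in> M" "y = k <# K" by blast
    show "(g \<otimes> h) <# y = g <# (h <# y)"
      using gh k assoc subgroup.m_closed[OF subM] Mc by (simp add: m_assoc)
  qed
  show "K \<in> (\<lambda>g. g <# K) ` M" using eK subgroup.one_closed[OF subM] by (metis image_eqI)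
  show "\<exists>g\<in>M. g <# K = x" if "x \<in> (\<lambda>g. g <# K) ` M" for x using that by blast
  show "n = 0" if "vv [^] n = \<one>" for n :: int by (rule vv(3)[OF that])
  show "\<exists>\<phi>. gact G M Y \<phi> \<and> (\<forall>i. \<forall>a\<in>A i. \<forall>y\<in>Y. \<phi> a y = \<rho> i a y)"
    if "\<And>i. gact G (A i) Y (\<rho> i)"
    for Y :: "((((bool \<times> 'g set) + (bool \<times> 'g set)) \<times> 'g) list \<times> 'g set) set" and \<rho>
    by (rule glue[OF that])
qed

lemma coset_stabiliser:
  assumes K: "subgroup K G" "K \<subseteq> M"
  shows "free_product_action.H M (\<lambda>g x. g <# x) K = K"
proof -
  interpret free_product_action G A M "(\<lambda>g. g <# K) ` M" "\<lambda>g x. g <# x" K vv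
    by (rule free_product_action_coset[OF assms])
  have "K \<subseteq> carrier G" using K subgroup.subset by blast
  then have eK: "\<one> <# K = K" by (force simp: l_coset_def)
  have "g <# K = K \<longleftrightarrow> g \<in> K" if "g \<in> carrier G" for g
    using left_coset_eq[OF K(1) that one_closed] that by (simp add: eK)
  then show ?thesis using K(2) M_carrier by (auto simp: H_def)
qed

lemma malnormal:
  assumes "a \<in> A i" "a \<noteq> \<one>" "t \<in> M" "conj_by t a \<in> A j"
  shows "i = j \<and> t \<in> A j"
proof -
  note stab = coset_stabiliser[OF subA A_M]
  interpret free_product_action G A M "(\<lambda>g. g <# A j) ` M" "\<lambda>g x. g <# x" "A j" vv
    by (rule free_product_action_coset[OF subA A_M])
  show ?thesis by (rule malnormal_stabiliser[OF stab assms])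
qed

text \<open>Malnormality twice: the conjugate of \<open>y'\<close> fixes \<open>y\<close> under
  conjugation, hence lies in \<open>A i\<close>; then \<open>y'\<close> is a nontrivial element of
  \<open>A j\<close> that \<open>inv s\<close> conjugates into \<open>A i\<close>.\<close>

lemma comm_factors:
  assumes y: "y \<in> A i" "y \<noteq> \<one>" and y': "y' \<in> A j" "y' \<noteq> \<one>" and s: "s \<in> M"
    and c: "comm G y (s \<otimes> y' \<otimes> inv s)"
  shows "i = j \<and> s \<in> A j"
proof -
  note Mc = subgroup.mem_carrier[OF subM] and Ac = subgroup.mem_carrier[OF subA]
  define z where "z = s \<otimes> y' \<otimes> inv s"
  have zM: "z \<in> M" unfolding z_def
    using s y' A_M subgroup.m_closed[OF subM] subgroup.m_inv_closed[OF subM] by blast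
  have "conj_by z y = y"
    using c zM Mc Ac[OF y(1)] by (simp add: comm_def z_def[symmetric] m_assoc)
  then have "z \<in> A i" using malnormal[OF y zM, of i] y by simp
  then have "conj_by (inv s) y' \<in> A i" using s Mc by (simp add: z_def)
  then have "j = i \<and> inv s \<in> A i"
    using malnormal[OF y', of "inv s" i] s subgroup.m_inv_closed[OF subM] by blast
  then show ?thesis using subgroup.m_inv_closed[OF subA, of "inv s" i] inv_inv[OF Mc[OF s]] by simp
qed

text \<open>
  The free product acts on the integers through two permutations: the cycles
  \<open>(4k, 4k + 1, 4k + 2)\<close> of one and \<open>(4k + 2, 4k + 3, 4k + 4)\<close> of the other are linked into a chain
  and leave infinitely many points fixed by either.
\<close>

definition cyc :: "bool \<Rightarrow> int \<Rightarrow> int" where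
  "cyc i n = (if i then (if n mod 4 \<in> {0, 1} then n + 1 else if n mod 4 = 2 then n - 2 else n)
    else (if n mod 4 \<in> {2, 3} then n + 1 else if n mod 4 = 0 then n - 2 else n))"

lemma bij_cyc: "bij (cyc i)"
proof -
  have "cyc i (cyc i (cyc i n)) = n" for n
  proof -
    define q where "q = n div 4"
    have m: "(4 * q) mod 4 = 0" "(4 * q + 1) mod 4 = 1" "(4 * q + 2) mod 4 = 2" "(4 * q + 3) mod 4 = 3"
      "(4 * q + 4) mod 4 = 0" "(4 * q - 2) mod 4 = 2" "(4 * q - 1) mod 4 = 3"
      by presburger+
    have "n = 4 * q \<or> n = 4 * q + 1 \<or> n = 4 * q + 2 \<or> n = 4 * q + 3"
      unfolding q_def by presburger
    then consider "n = 4 * q" | "n = 4 * q + 1" | "n = 4 * q + 2" | "n = 4 * q + 3" by blast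
    then show ?thesis
      by cases (cases i; simp add: cyc_def m)+
  qed
  then show ?thesis
    by (intro bij_betw_byWitness[where f' = "\<lambda>n. cyc i (cyc i n)"]) simp_all
qed

text \<open>Every point fixed by \<open>A i\<close> gives a full conjugate of \<open>A i\<close> as
  a free factor of the stabiliser of \<open>0\<close>, and different points give different factors.
  So it is enough that one orbit contains infinitely many fixed points of either factor.\<close>

lemma infinite_free_family:
  "\<exists>u :: bool \<Rightarrow> nat \<Rightarrow> 'g. (\<forall>i n. u i n \<in> M) \<and>
    free_family G UNIV (\<lambda>(i, n). conj_by (u i n) ` A i)"
proof -
  define g where "g i = (SOME x. x \<in> V i)" for i
  have g: "g i \<in> V i" for i unfolding g_def using V_nonempty[of i] by (simp add: some_in_eq)
  have gne: "g i \<noteq> g j" if "i \<noteq> j" for i j using V_across[OF g g that] by auto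
  \<comment> \<open>One generator of each piece acts by a product of 3-cycles and all others
    trivially; the two chosen generators do not commute, so no relation ties their
    permutations.\<close>
  define f where "f x = (if x = g True then cyc True else if x = g False then cyc False else id)" for x
  have fg: "f (g i) = cyc i" for i using gne[of False True] by (cases i) (auto simp: f_def)
  have bij: "bij_betw (f x) UNIV UNIV" for x using bij_cyc by (auto simp: f_def)
  have c: "f x (f x' y) = f x' (f x y)" if "comm G x x'" for x x' and y :: int
    using that V_across[OF g g, of True False] V_across[OF g g, of False True] by (auto simp: f_def)
  obtain \<phi> where \<phi>: "gact G M UNIV \<phi>" "\<And>x y. x \<in> (\<Union>i. V i) \<Longrightarrow> \<phi> x y = f x y"
    unfolding M_def by (rule pc_basis_gact[where f = f and Y = "UNIV :: int set", OF pc_basis_V bij]) (blast intro: c)+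
  have oneM: "\<one> \<in> M" by (rule subgroup.one_closed[OF subM])
  define C where "C = {\<phi> h 0 | h. h \<in> M}"
  have closed: "\<phi> h x \<in> C" if h: "h \<in> M" and x: "x \<in> C" for h x
  proof -
    obtain k where k: "k \<in> M" "x = \<phi> k 0" using x by (auto simp: C_def)
    then have "\<phi> h x = \<phi> (h \<otimes> k) 0" using gact_mult[OF \<phi>(1) h k(1)] by simp
    then show ?thesis using subgroup.m_closed[OF subM h k(1)] by (auto simp: C_def)
  qed
  have C0: "0 \<in> C" unfolding C_def using gact_one[OF \<phi>(1), of 0] oneM by fastforce
  have gC: "cyc i x \<in> C" if "x \<in> C" for i x
  proof -
    have "g i \<in> M" using g[of i] V_A A_M by blast
    moreover have "g i \<in> (\<Union>i. V i)" using g by blast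
    then have "\<phi> (g i) x = cyc i x" using \<phi>(2) by (simp add: fg)
    ultimately show ?thesis using closed[of "g i" x] that by simp
  qed
  \<comment> \<open>Residues \<open>0\<close> and \<open>1\<close> are raised by the cycles of
    \<open>True\<close>, residues \<open>2\<close> and \<open>3\<close> by those of
    \<open>False\<close>; the orbit of \<open>0\<close> therefore contains all natural
    numbers.\<close>
  have up: "n + 1 \<in> C" if "n \<in> C" for n
  proof -
    have "cyc (n mod 4 \<in> {0, 1}) n = n + 1" by (auto simp: cyc_def)
    then show ?thesis using gC[OF that] by metis
  qed
  note VM = subset_trans[OF V_A A_M] and AM = A_M
  have nonneg: "int n \<in> C" for n
  proof (induction n)
    case (Suc n)
    have "int (Suc n) = int n + 1" by simp
    then show ?case using up[OF Suc] by (simp only:)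
  qed (use C0 in simp)
  interpret free_product_action G A M C \<phi> 0 vv
  proof (intro free_product_action.intro free_product_action_axioms.intro is_group subA M_eq vv(2) C0)
    show "n = 0" if "vv [^] n = \<one>" for n :: int by (rule vv(3)[OF that])
    show "\<exists>\<phi>. gact G M Y \<phi> \<and> (\<forall>i. \<forall>a\<in>A i. \<forall>y\<in>Y. \<phi> a y = \<rho> i a y)"
      if "\<And>i. gact G (A i) Y (\<rho> i)"
      for Y :: "((((bool \<times> int) + (bool \<times> int)) \<times> 'g) list \<times> int) set" and \<rho>
      by (rule glue[OF that])
    show "gact G M C \<phi>" using \<phi>(1) closed by (auto simp: gact_def)
    show "\<exists>h\<in>M. \<phi> h 0 = x" if "x \<in> C" for x using that by (auto simp: C_def)
  qed
  \<comment> \<open>The middle points of the 3-cycles of the other factor: \<open>4 * n + 3\<close>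
    is missed by the cycles of \<open>True\<close>, \<open>4 * n + 1\<close> by those of
    \<open>False\<close>. The endpoints serve as links of the chain and are moved by both.\<close>
  define pt where "pt i n = int (if i then 4 * n + 3 else 4 * n + 1)" for i n
  have ptC: "pt i n \<in> C" for i n unfolding pt_def by (rule nonneg)
  have mod: "pt i n mod 4 = (if i then 3 else 1)" for i n
    unfolding pt_def by (cases i) (simp; presburger)+
  have gens: "\<phi> x (pt i n) = pt i n" if x: "x \<in> V i" for x i n
  proof -
    have "x \<noteq> g (\<not> i)" using V_across[OF x g, of "\<not> i"] by auto
    then have "f x = cyc i \<or> f x = id" by (cases i) (auto simp: f_def)
    moreover have "cyc i (pt i n) = pt i n" by (simp add: cyc_def mod)
    moreover have "\<phi> x (pt i n) = f x (pt i n)" using \<phi>(2) x by blast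
    ultimately show ?thesis by auto
  qed
  have fixed: "\<phi> a (pt i n) = pt i n" if "a \<in> A i" for a i n
    using that unfolding A_def
  proof (induction rule: generate.induct)
    case one
    show ?case by (rule gact_one[OF \<phi>(1)]) simp
  next
    case (incl h)
    then show ?case by (rule gens)
  next
    case (inv h)
    then have "h \<in> M" using VM by blast
    then show ?case using gact_inv(1)[OF \<phi>(1) subM, of h "pt i n"] gens[OF inv, of n] by simp
  next
    case (eng h1 h2)
    have "h1 \<in> M" "h2 \<in> M" using eng AM by (auto simp: A_def)
    then show ?case using gact_mult[OF \<phi>(1), of h1 h2 "pt i n"] eng by simp
  qed
  have inj: "inj (\<lambda>(i, n). Inl (i, pt i n) :: (bool \<times> int) + (bool \<times> int))"
    by (auto simp: inj_on_def pt_def)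
  define u where "u i n = tau i (pt i n)" for i n
  have "free_family G UNIV (\<lambda>(i, n). conj_by (u i n) ` A i)"
  proof (rule free_family_mono[OF free_factors inj])
    show "range (\<lambda>(i, n). Inl (i, pt i n)) \<subseteq> J" using factor_fixed(1)[OF ptC fixed] by auto
    show "(case k of (i, n) \<Rightarrow> conj_by (u i n) ` A i)
        \<subseteq> factor (case k of (i, n) \<Rightarrow> Inl (i, pt i n))" for k
      by (cases k) (simp add: factor_fixed(2)[OF ptC fixed] u_def del: factor.simps)
  qed
  moreover have "u i n \<in> M" for i n unfolding u_def by (rule tau(1)[OF ptC])
  ultimately show ?thesis by blast
qed

end

section \<open>Embedding commutation graphs\<close>

text \<open>An isomorphism between commutation graphs on subsets of \<open>G\<close>; compatibility
  with products is not asked for.\<close>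

definition cemb :: "('g, 'm) monoid_scheme \<Rightarrow> ('g \<Rightarrow> 'g) \<Rightarrow> 'g set \<Rightarrow> bool" where
  "cemb G e W \<longleftrightarrow> inj_on e W \<and> (\<forall>x\<in>W. \<forall>y\<in>W. comm G (e x) (e y) \<longleftrightarrow> comm G x y)"

text \<open>Conjugators come from \<open>generate G V\<close> only, so this is the vertex set of the
  extension graph of the subgroup generated by \<open>V\<close>, inside whatever larger
  group.\<close>

definition conjs :: "('g, 'm) monoid_scheme \<Rightarrow> 'g set \<Rightarrow> 'g set" where
  "conjs G V = {inv\<^bsub>G\<^esub> g \<otimes>\<^bsub>G\<^esub> v \<otimes>\<^bsub>G\<^esub> g | v g. v \<in> V \<and> g \<in> generate G V}"

text \<open>\<open>X\<close> generates \<open>K\<close> itself, while the image of \<open>X\<close>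
  under \<open>e\<close> is just a copy of its commutation graph and may generate a quite different
  subgroup.\<close>

definition subgroups_embed :: "('g, 'm) monoid_scheme \<Rightarrow> 'g set \<Rightarrow> bool" where
  "subgroups_embed G V \<longleftrightarrow> (\<forall>K. subgroup K G \<and> K \<subseteq> generate G V \<longrightarrow>
    (\<exists>X e. pc_basis G X \<and> generate G X = K \<and> cemb G e X \<and> e ` X \<subseteq> conjs G V))"

text \<open>One embedding of the whole extension graph serves all its induced subgraphs, because
  subsets of faithful sets are faithful by \<open>pc_basis_mono\<close>.\<close>

definition extension_embeds :: "('g, 'm) monoid_scheme \<Rightarrow> 'g set \<Rightarrow> bool" where
  "extension_embeds G V \<longleftrightarrow>
    (\<exists>e. cemb G e (conjs G V) \<and> e ` conjs G V \<subseteq> generate G V \<and> pc_basis G (e ` conjs G V))"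

lemma cemb_comp:
  assumes "cemb G e W" "cemb G f (e ` W)" shows "cemb G (f \<circ> e) W"
  using assms unfolding cemb_def by (auto intro: comp_inj_on)

text \<open>Since \<open>comm\<close> is reflexive, the absence of commutation between pieces also
  makes them disjoint, on both sides; hence the glued map is well defined and injective.\<close>

lemma cemb_Union:
  assumes e: "\<And>j. j \<in> J \<Longrightarrow> cemb G (e j) (W j)"
    and W: "\<And>j k x y. j \<in> J \<Longrightarrow> k \<in> J \<Longrightarrow> j \<noteq> k \<Longrightarrow> x \<in> W j \<Longrightarrow> y \<in> W k \<Longrightarrow> \<not> comm G x y"
    and X: "\<And>j k x y. j \<in> J \<Longrightarrow> k \<in> J \<Longrightarrow> j \<noteq> k \<Longrightarrow> x \<in> W j \<Longrightarrow> y \<in> W k \<Longrightarrow> \<not> comm G (e j x) (e k y)"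
  shows "\<exists>f. cemb G f (\<Union>j\<in>J. W j) \<and> (\<forall>j\<in>J. \<forall>x\<in>W j. f x = e j x)"
proof -
  define \<kappa> where "\<kappa> x = (SOME j. j \<in> J \<and> x \<in> W j)" for x
  have \<kappa>: "\<kappa> x = j" if "j \<in> J" "x \<in> W j" for x j
  proof -
    have "\<kappa> x \<in> J \<and> x \<in> W (\<kappa> x)" unfolding \<kappa>_def by (rule someI[of _ j]) (use that in simp)
    then show ?thesis using W[of "\<kappa> x" j x x] that by auto
  qed
  define f where "f x = e (\<kappa> x) x" for x
  have f: "f x = e j x" if "j \<in> J" "x \<in> W j" for x j using \<kappa>[OF that] by (simp add: f_def)
  have iff: "comm G (f x) (f y) \<longleftrightarrow> comm G x y" "f x = f y \<Longrightarrow> x = y"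
    if jk: "j \<in> J" "x \<in> W j" "k \<in> J" "y \<in> W k" for j k x y
  proof -
    show "comm G (f x) (f y) \<longleftrightarrow> comm G x y"
    proof (cases "j = k")
      case True
      then show ?thesis using e[OF jk(1)] jk by (simp add: f cemb_def)
    next
      case False
      then show ?thesis using W[OF jk(1,3) False jk(2,4)] X[OF jk(1,3) False jk(2,4)] jk by (simp add: f)
    qed
    assume eq: "f x = f y"
    then have "j = k" using X[OF jk(1,3) _ jk(2,4)] jk by (auto simp: f)
    then show "x = y" using e[OF jk(1)] eq jk by (auto simp: f cemb_def inj_on_def)
  qed
  have "cemb G f (\<Union>j\<in>J. W j)" unfolding cemb_def
  proof (intro conjI inj_onI ballI)
    fix x y assume "x \<in> (\<Union>j\<in>J. W j)" "y \<in> (\<Union>j\<in>J. W j)"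
    then obtain j k where "j \<in> J" "x \<in> W j" "k \<in> J" "y \<in> W k" by blast
    then show "comm G (f x) (f y) \<longleftrightarrow> comm G x y" "f x = f y \<Longrightarrow> x = y" by (rule iff)+
  qed
  then show ?thesis using f by blast
qed

context group
begin

lemma cemb_conj: "g \<in> carrier G \<Longrightarrow> X \<subseteq> carrier G \<Longrightarrow> cemb G (conj_by g) X"
  unfolding cemb_def inj_on_def using conj_eq_iff[of g] comm_conj_iff[of g] by blast

lemma generate_conj:
  assumes "g \<in> carrier G" "X \<subseteq> carrier G"
  shows "generate G (conj_by g ` X) = conj_by g ` generate G X"
proof -
  interpret h: group_hom G G "\<lambda>x. conj_by g x"
    by unfold_locales (use assms in \<open>auto simp: hom_def conj_mult\<close>)
  show ?thesis by (rule h.generate_img[OF assms(2)])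
qed

lemma subgroup_conj:
  assumes "g \<in> carrier G" "subgroup K G"
  shows "subgroup (conj_by g ` K) G"
proof -
  interpret h: group_hom G G "\<lambda>x. conj_by g x"
    by unfold_locales (use assms in \<open>auto simp: hom_def conj_mult\<close>)
  show ?thesis by (rule h.subgroup_img_is_subgroup[OF assms(2)])
qed

lemma conjs_generate:
  assumes "V \<subseteq> carrier G" shows "conjs G V \<subseteq> generate G V"
proof -
  note S = subgroup_generate[OF assms]
  show ?thesis unfolding conjs_def
    using subgroup.m_closed[OF S] subgroup.m_inv_closed[OF S] generate.incl[of _ V G] by blast
qed

lemma subset_conjs:
  assumes "V \<subseteq> carrier G" shows "V \<subseteq> conjs G V"
proof
  fix v assume "v \<in> V"
  moreover from this have "v = inv \<one> \<otimes> v \<otimes> \<one>" using assms by auto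
  ultimately show "v \<in> conjs G V" unfolding conjs_def using generate.one[of G V] by blast
qed

lemma one_not_conjs:
  assumes "V \<subseteq> carrier G" "\<one> \<notin> V" shows "\<one> \<notin> conjs G V"
proof
  assume "\<one> \<in> conjs G V"
  then obtain v g where v: "v \<in> V" "g \<in> generate G V" "conj_by g v = \<one>" by (auto simp: conjs_def)
  then have "g \<in> carrier G" using generate_in_carrier assms by blast
  then have "v = \<one>" using v conj_eq_iff[of g v \<one>] assms by auto
  then show False using v assms by blast
qed

lemma conjs_conj:
  assumes "y \<in> conjs G W" "W \<subseteq> V" "V \<subseteq> carrier G" "g \<in> generate G V"
  shows "conj_by g y \<in> conjs G V"
proof -
  obtain v h where v: "v \<in> W" "h \<in> generate G W" "y = conj_by h v" using assms(1) by (auto simp: conjs_def)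
  have h: "h \<in> generate G V" using v mono_generate[OF assms(2)] by blast
  have "conj_by g y = inv (h \<otimes> g) \<otimes> v \<otimes> (h \<otimes> g)"
    using v h assms generate_in_carrier[OF assms(3)] conj_conj[of h g v] by blast
  then show ?thesis using v h assms generate.eng[OF h assms(4)] by (auto simp: conjs_def)
qed

lemma countable_generate:
  assumes "countable X" "X \<subseteq> carrier G" shows "countable (generate G X)"
proof -
  have "countable (words X)" unfolding words_def using assms(1) by simp
  then show ?thesis by (simp add: generate_word_val_id[OF assms(2)])
qed

lemma cemb_conj_comp:
  assumes "cemb G e X" "e ` X \<subseteq> carrier G" "g \<in> carrier G"
  shows "cemb G (\<lambda>x. inv g \<otimes> e x \<otimes> g) X"
  using cemb_comp[OF assms(1) cemb_conj[OF assms(3,2)]] by (simp add: comp_def)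

subsection \<open>A central generator\<close>

fun exponent_of :: "'v \<Rightarrow> 'v word \<Rightarrow> int" where
  "exponent_of z [] = 0"
| "exponent_of z ((x, b) # w) = (if x = z then if b then 1 else - 1 else 0) + exponent_of z w"

abbreviation drop_letter :: "'v \<Rightarrow> 'v word \<Rightarrow> 'v word" where
  "drop_letter z w \<equiv> filter (\<lambda>l. fst l \<noteq> z) w"

lemma drop_letter_words: "w \<in> words (insert z X) \<Longrightarrow> drop_letter z w \<in> words X"
  by (induction w) auto

lemma comm_int_pow:
  assumes "comm G x y" "x \<in> carrier G" "y \<in> carrier G" shows "comm G (x [^] (k :: int)) y"
proof -
  have "x [^] k \<in> generate G {x}" using generate_pow assms by auto
  then show ?thesis by (rule comm_generate) (use assms in auto)
qed

lemma word_val_central: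
  assumes f: "f \<in> insert z X \<rightarrow> carrier G" and c: "\<And>x. x \<in> X \<Longrightarrow> comm G (f z) (f x)"
    and w: "w \<in> words (insert z X)"
  shows "word_val G f w = f z [^] exponent_of z w \<otimes> word_val G f (drop_letter z w)"
  using w
proof (induction w)
  case (Cons a w)
  obtain x b where a: "a = (x, b)" by (cases a)
  have w: "w \<in> words (insert z X)" "x = z \<or> x \<in> X" using Cons.prems a by auto
  let ?v = "word_val G f (drop_letter z w)"
  have z: "f z \<in> carrier G" using f by auto
  have v: "?v \<in> carrier G" using word_val_closed[OF drop_letter_words[OF w(1)]] f by auto
  show ?case
  proof (cases "x = z")
    case True
    have "f z [^] ((if b then 1 else - 1) + exponent_of z w) =
        (if b then f z else inv (f z)) \<otimes> f z [^] exponent_of z w"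
      using z int_pow_mult[OF z, of "if b then 1 else -1" "exponent_of z w"] by (simp add: int_pow_neg)
    then show ?thesis using True Cons.IH[OF w(1)] a z v by (simp add: m_assoc)
  next
    case False
    define y where "y = (if b then f x else inv (f x))"
    define p where "p = f z [^] exponent_of z w"
    have x: "f x \<in> carrier G" "comm G (f z) (f x)" using w False c f by auto
    then have "comm G (f x) (f z)" by (simp add: comm_def)
    then have "comm G y (f z)" using comm_inv[of "f x" "f z"] z x by (simp add: y_def)
    moreover have y: "y \<in> carrier G" and p: "p \<in> carrier G" using x z by (simp_all add: y_def p_def)
    ultimately have "comm G p y" unfolding p_def using z by (intro comm_int_pow) (simp_all add: comm_def)
    then have "y \<otimes> p \<otimes> ?v = p \<otimes> y \<otimes> ?v" by (simp add: comm_def)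
    then have "y \<otimes> (p \<otimes> ?v) = p \<otimes> (y \<otimes> ?v)" using y p v by (simp add: m_assoc)
    then have "(if b then f x else inv (f x)) \<otimes> (f z [^] exponent_of z w \<otimes> ?v) =
        f z [^] exponent_of z w \<otimes> ((if b then f x else inv (f x)) \<otimes> ?v)"
      by (simp only: y_def p_def)
    then show ?thesis using False Cons.IH[OF w(1)] a by simp
  qed
qed simp

text \<open>Collecting the central letter writes the value of a word as a power of \<open>z\<close>
  times an element of \<open>generate G X\<close>. If the value is trivial, \<open>indep\<close>
  forces exponent \<open>0\<close>, and what remains is a word over \<open>X\<close>.\<close>

lemma pc_basis_insert:
  assumes X: "pc_basis G X" and z: "z \<in> carrier G" "z \<notin> X" "\<And>x. x \<in> X \<Longrightarrow> comm G z x"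
    and indep: "\<And>k :: int. z [^] k \<in> generate G X \<Longrightarrow> k = 0"
  shows "pc_basis G (insert z X)"
  unfolding pc_basis_def
proof (intro conjI ballI impI)
  let ?X = "insert z X" let ?P = "pc_group (comm_graph G ?X)" and ?R = "pc_relators (comm_graph G ?X)"
  let ?gen = "pc_gen (comm_graph G ?X)"
  interpret P: group ?P by (rule group_pc_group)
  show Xc: "?X \<subseteq> carrier G" using pc_basis_carrier[OF X] z by auto
  fix w assume w: "w \<in> words ?X" "word_val G id w = \<one>"
  define k where "k = exponent_of z w"
  define v where "v = drop_letter z w"
  have v: "v \<in> words X" unfolding v_def by (rule drop_letter_words[OF w(1)])
  then have vX: "v \<in> words ?X" by (rule words_mono) auto
  have val: "word_val G id w = z [^] k \<otimes> word_val G id v"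
    using word_val_central[of id z X w] Xc z w by (auto simp: k_def v_def Pi_iff)
  have gv: "word_val G id v \<in> generate G X" "word_val G id v \<in> carrier G"
    using generate_word_val_id[OF pc_basis_carrier[OF X]] v word_val_closed[OF v, of id] pc_basis_carrier[OF X]
    by (auto simp: Pi_iff)
  have "z [^] k = inv (word_val G id v)"
    using val w(2) gv z by (metis int_pow_closed inv_equality)
  then have "z [^] k \<in> generate G X"
    using gv subgroup.m_inv_closed[OF subgroup_generate[OF pc_basis_carrier[OF X]]] by simp
  then have k0: "k = 0" by (rule indep)
  then have "word_val G id v = \<one>" using val w gv by simp
  then have "word_eq X (pc_relators (comm_graph G X)) v []" using X v by (auto simp: pc_basis_def)
  then have "word_eq ?X ?R (map (apfst id) v) (map (apfst id) [])"
    by (rule word_eq_map) (auto simp: edges_comm_graph)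
  then have "word_eq ?X ?R v []" by (simp add: apfst_id)
  then have "word_class ?X ?R v = word_class ?X ?R []" using vX by (simp add: word_class_eq_iff)
  \<comment> \<open>The same collection of \<open>z\<close>, performed in the presented group by
    evaluation there instead of by rewriting words.\<close>
  moreover have "word_val ?P ?gen w = ?gen z [^]\<^bsub>?P\<^esub> k \<otimes>\<^bsub>?P\<^esub> word_val ?P ?gen v"
    unfolding k_def v_def
  proof (rule P.word_val_central[OF _ _ w(1)])
    show "?gen \<in> insert z X \<rightarrow> carrier ?P" using pc_gen_closed[of "comm_graph G ?X"] by simp
    show "comm ?P (?gen z) (?gen x)" if "x \<in> X" for x
      by (rule pc_gen_comm) (use that z in \<open>auto simp: edges_comm_graph\<close>)
  qed
  moreover have "word_class ?X ?R [] = \<one>\<^bsub>?P\<^esub>" by (simp add: one_pc_group)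
  ultimately have "word_class ?X ?R w = word_class ?X ?R []"
    using word_val_pc_gen[of w "comm_graph G ?X"] word_val_pc_gen[of v "comm_graph G ?X"] w vX k0 by simp
  then show "word_eq ?X ?R w []" using w by (simp add: word_class_eq_iff)
qed

end

section \<open>Direct products with an infinite cyclic group\<close>

locale cone_group = group G for G :: "('g, 'm) monoid_scheme" (structure) +
  fixes z :: 'g and W :: "'g set"
  assumes pc_basis_zW: "pc_basis G (insert z W)" and zW: "z \<notin> W" and z_comm: "w \<in> W \<Longrightarrow> comm G z w"
begin

definition V where "V = insert z W"

lemma W_carrier: "W \<subseteq> carrier G" and z_carrier: "z \<in> carrier G" and V_carrier: "V \<subseteq> carrier G"
  using pc_basis_carrier[OF pc_basis_zW] by (auto simp: V_def)

lemma subV: "subgroup (generate G V) G" and subW: "subgroup (generate G W) G"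
  by (rule subgroup_generate, rule V_carrier) (rule subgroup_generate, rule W_carrier)

lemma W_V: "generate G W \<subseteq> generate G V"
  by (rule mono_generate) (auto simp: V_def)

lemma genV_carrier: "g \<in> generate G V \<Longrightarrow> g \<in> carrier G"
  by (rule generate_in_carrier[OF V_carrier])

lemma z_pow_central: "g \<in> generate G V \<Longrightarrow> comm G (z [^] (k :: int)) g"
proof -
  assume g: "g \<in> generate G V"
  have "comm G g z" by (rule comm_generate[OF g V_carrier z_carrier]) (use z_comm in \<open>auto simp: V_def comm_def\<close>)
  then show ?thesis using g genV_carrier z_carrier by (intro comm_int_pow) (auto simp: comm_def)
qed

lemma z_pow_V: "z [^] (k :: int) \<in> generate G V"
  by (rule subgroup_int_pow_closed[OF subV]) (auto simp: V_def intro: generate.incl)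

lemma z_pow_eq_one: "z [^] (k :: int) = \<one> \<Longrightarrow> k = 0"
  using pc_basis_infinite_order[OF pc_basis_zW, of z k] by auto

lemma retraction:
  obtains r where "\<And>g. g \<in> generate G V \<Longrightarrow> r g \<in> generate G W"
    "\<And>g h. g \<in> generate G V \<Longrightarrow> h \<in> generate G V \<Longrightarrow> r (g \<otimes> h) = r g \<otimes> r h"
    "\<And>g. g \<in> generate G V \<Longrightarrow> \<exists>k :: int. g = z [^] k \<otimes> r g"
    "\<And>g. g \<in> generate G W \<Longrightarrow> r g = g" "\<And>k :: int. r (z [^] k) = \<one>"
proof -
  let ?f = "\<lambda>x. if x = z then \<one> else x"
  have f: "?f \<in> insert z W \<rightarrow> carrier G" using W_carrier by auto
  have c: "comm G (?f x) (?f y)" if "x \<in> insert z W" "y \<in> insert z W" "comm G x y" for x y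
    using that W_carrier by (auto simp: comm_def)
  obtain r where r: "\<And>w. w \<in> words (insert z W) \<Longrightarrow> r (word_val G id w) = word_val G ?f w"
    "r \<in> generate G (insert z W) \<rightarrow> carrier G"
    "\<And>g h. g \<in> generate G (insert z W) \<Longrightarrow> h \<in> generate G (insert z W) \<Longrightarrow> r (g \<otimes> h) = r g \<otimes> r h"
    "\<And>x. x \<in> insert z W \<Longrightarrow> r x = ?f x"
    by (rule pc_basis_extend[OF pc_basis_zW is_group f c]) (assumption | blast)+
  have idW: "word_val G ?f w = word_val G id w" if "w \<in> words W" for w
    by (rule word_val_cong[OF that]) (use zW in auto)
  have gW: "generate G W = word_val G id ` words W" by (rule generate_word_val_id[OF W_carrier])
  have gV: "generate G V = word_val G id ` words (insert z W)"
    unfolding V_def by (rule generate_word_val_id[OF V_carrier[unfolded V_def]])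
  have decomp: "\<exists>k :: int. g = z [^] k \<otimes> r g \<and> r g \<in> generate G W" if g: "g \<in> generate G V" for g
  proof -
    obtain w where w: "w \<in> words (insert z W)" "g = word_val G id w" using g gV by blast
    define v where "v = drop_letter z w"
    have v: "v \<in> words W" unfolding v_def by (rule drop_letter_words[OF w(1)])
    have vc: "word_val G id v \<in> carrier G" using word_val_closed[OF v, of id] W_carrier by (auto simp: Pi_iff)
    have "g = z [^] exponent_of z w \<otimes> word_val G id v"
      unfolding w(2) v_def
      using word_val_central[of id z W w] w(1) W_carrier z_carrier z_comm by (auto simp: Pi_iff)
    moreover have "r g = ?f z [^] exponent_of z w \<otimes> word_val G ?f v"
      unfolding w(2) r(1)[OF w(1)] v_def
      by (rule word_val_central[OF f _ w(1)]) (use W_carrier in \<open>auto simp: comm_def\<close>)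
    then have "r g = word_val G id v" using idW[OF v] vc by simp
    ultimately show ?thesis using v gW by auto
  qed
  show ?thesis
  proof (rule that[of r])
    show "r g = g" if "g \<in> generate G W" for g
    proof -
      obtain w where w: "w \<in> words W" "g = word_val G id w" using \<open>g \<in> generate G W\<close> gW by blast
      then have "w \<in> words (insert z W)" by (auto intro: words_mono)
      then show ?thesis using r(1) idW w by simp
    qed
    have "r (z [^] k) = r z [^] k" for k :: int
      by (rule mult_int_pow[OF subV is_group]) (use r(2,3) in \<open>auto simp: V_def intro: generate.incl\<close>)
    then show "r (z [^] k) = \<one>" for k :: int using r(4)[of z] by simp
    show "r (g \<otimes> h) = r g \<otimes> r h" if "g \<in> generate G V" "h \<in> generate G V" for g h
      using r(3) that by (simp add: V_def)
  qed (use decomp in blast)+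
qed

lemma z_pow_W:
  assumes "z [^] (k :: int) \<in> generate G W" shows "k = 0"
proof -
  obtain r where r: "\<And>g. g \<in> generate G W \<Longrightarrow> r g = g" "\<And>k :: int. r (z [^] k) = \<one>"
    by (rule retraction) blast
  have "z [^] k = \<one>" using r(1)[OF assms] r(2) by simp
  then show ?thesis by (rule z_pow_eq_one)
qed

lemma z_not_W: "z \<notin> generate G W"
  using z_pow_W[of 1] z_carrier by auto

text \<open>Every conjugator is a central power of \<open>z\<close> times an element of
  \<open>generate G W\<close>, and the central part has no effect; \<open>z\<close> itself is fixed
  by all conjugations. So the extension graph of a cone is again a cone.\<close>

lemma conjs_cone: "conjs G V = insert z (conjs G W)"
proof (intro equalityI subsetI)
  fix x assume "x \<in> conjs G V"
  then obtain v g where v: "v \<in> V" "g \<in> generate G V" "x = conj_by g v" by (auto simp: conjs_def)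
  obtain r where r: "\<And>g. g \<in> generate G V \<Longrightarrow> r g \<in> generate G W"
    "\<And>g. g \<in> generate G V \<Longrightarrow> \<exists>k :: int. g = z [^] k \<otimes> r g"
    by (rule retraction) blast
  obtain k :: int where k: "g = z [^] k \<otimes> r g" using r(2)[OF v(2)] by blast
  define h where "h = r g"
  have h: "h \<in> generate G W" "h \<in> carrier G" using r(1)[OF v(2)] generate_in_carrier[OF W_carrier] by (auto simp: h_def)
  have vc: "v \<in> carrier G" using v V_carrier by blast
  have "v \<in> generate G V" using v by (auto intro: generate.incl)
  then have c: "comm G (z [^] k) v" by (rule z_pow_central)
  have "x = inv h \<otimes> (conj_by (z [^] k) v) \<otimes> h"
    using v(3) k h vc z_carrier conj_conj[of "z [^] k" h v] by (simp add: h_def[symmetric])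
  also have "conj_by (z [^] k) v = v"
    using c[unfolded comm_def, symmetric] vc z_carrier by (simp add: m_assoc)
  finally have x: "x = conj_by h v" .
  show "x \<in> insert z (conjs G W)"
  proof (cases "v = z")
    case True
    have "comm G z h" using z_pow_central[of h 1] h W_V z_carrier by auto
    then have "x = z" using x True h z_carrier by (simp add: comm_def m_assoc)
    then show ?thesis by simp
  next
    case False
    then show ?thesis using x h v by (auto simp: V_def conjs_def)
  qed
next
  fix x assume "x \<in> insert z (conjs G W)"
  then show "x \<in> conjs G V"
    using subset_conjs[OF V_carrier] W_V by (auto simp: V_def conjs_def)
qed

lemma conjs_W: "conjs G W \<subseteq> generate G W"
  by (rule conjs_generate[OF W_carrier])

lemma z_comm_W: "g \<in> generate G W \<Longrightarrow> comm G z g"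
  using z_pow_central[of g 1] W_V z_carrier by auto

text \<open>\<open>z\<close> commutes with all of \<open>generate G W\<close> and lies outside it,
  so it can receive any new vertex \<open>y\<close> that is joined to everything.\<close>

lemma cemb_insert:
  assumes e: "cemb G e X" "e ` X \<subseteq> generate G W" and y: "y \<notin> X" "\<And>x. x \<in> X \<Longrightarrow> comm G y x"
  shows "cemb G (e(y := z)) (insert y X)"
  unfolding cemb_def
proof (intro conjI ballI)
  have ne: "x \<noteq> y" "e x \<noteq> z" if "x \<in> X" for x using that y e(2) z_not_W by auto
  show "inj_on (e(y := z)) (insert y X)"
    using e(1) ne unfolding cemb_def inj_on_def by auto
  have c: "comm G z (e x)" "comm G y x" "comm G (e x) z" "comm G x y" if "x \<in> X" for x
    using that z_comm_W[of "e x"] e(2) y(2)[OF that] by (auto simp: comm_def)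
  fix x x' assume "x \<in> insert y X" "x' \<in> insert y X"
  then show "comm G ((e(y := z)) x) ((e(y := z)) x') \<longleftrightarrow> comm G x x'"
    using e(1) c ne unfolding cemb_def by auto
qed

lemma extension_embeds_cone:
  assumes "extension_embeds G W" shows "extension_embeds G V"
proof -
  obtain e where e: "cemb G e (conjs G W)" "e ` conjs G W \<subseteq> generate G W" "pc_basis G (e ` conjs G W)"
    using assms by (auto simp: extension_embeds_def)
  let ?e = "e(z := z)"
  have z: "z \<notin> conjs G W" using z_not_W conjs_W by blast
  have img: "?e ` conjs G V = insert z (e ` conjs G W)" using z by (auto simp: conjs_cone)
  have gen: "generate G (e ` conjs G W) \<subseteq> generate G W"
    by (rule generate_subgroup_incl[OF e(2) subW])
  have "cemb G ?e (conjs G V)"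
    unfolding conjs_cone by (rule cemb_insert[OF e(1,2) z]) (use z_comm_W conjs_W in blast)
  moreover have "?e ` conjs G V \<subseteq> generate G V"
    unfolding img using e(2) W_V z_pow_V[of 1] z_carrier by auto
  moreover have "pc_basis G (?e ` conjs G V)" unfolding img
  proof (rule pc_basis_insert[OF e(3) z_carrier])
    show "z \<notin> e ` conjs G W" using e(2) z_not_W by blast
    show "comm G z x" if "x \<in> e ` conjs G W" for x using that e(2) z_comm_W by blast
    show "k = 0" if "z [^] k \<in> generate G (e ` conjs G W)" for k :: int using that gen z_pow_W by blast
  qed
  ultimately show ?thesis unfolding extension_embeds_def by blast
qed

text \<open>\<open>m\<close> is the least positive exponent that occurs; \<open>m = 0\<close>
  encodes that \<open>K\<close> contains no nontrivial power of \<open>z\<close>.\<close>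

lemma powers_in_subgroup:
  assumes K: "subgroup K G"
  obtains m :: int where "z [^] m \<in> K" "\<And>n :: int. z [^] n \<in> K \<Longrightarrow> m dvd n"
proof (cases "\<exists>n :: int. n \<noteq> 0 \<and> z [^] n \<in> K")
  case False
  then show ?thesis using subgroup.one_closed[OF K] by (intro that[of 0]) auto
next
  case True
  then obtain n :: int where n: "n \<noteq> 0" "z [^] n \<in> K" by blast
  have "z [^] \<bar>n\<bar> \<in> K" using n z_carrier subgroup.m_inv_closed[OF K n(2)] by (cases "n \<ge> 0") (auto simp: int_pow_neg)
  then have ex: "\<exists>d :: nat. d > 0 \<and> z [^] int d \<in> K" using n(1) by (intro exI[of _ "nat \<bar>n\<bar>"]) auto
  define d where "d = (LEAST d :: nat. d > 0 \<and> z [^] int d \<in> K)"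
  have d: "d > 0" "z [^] int d \<in> K" using LeastI_ex[OF ex] by (auto simp: d_def)
  show ?thesis
  proof (rule that[of "int d"])
    fix n :: int assume n: "z [^] n \<in> K"
    have "(z [^] int d) [^] (- (n div int d)) \<in> K" by (rule subgroup_int_pow_closed[OF K d(2)])
    then have "z [^] n \<otimes> z [^] (int d * (- (n div int d))) \<in> K"
      using n subgroup.m_closed[OF K] z_carrier by (simp add: int_pow_pow)
    moreover have "n + int d * (- (n div int d)) = n mod int d" by (simp add: minus_div_mult_eq_mod[symmetric])
    ultimately have "z [^] (n mod int d) \<in> K" using int_pow_mult[OF z_carrier] by metis
    moreover have "0 \<le> n mod int d" "n mod int d < int d" using d by auto
    ultimately have "n mod int d = 0"
      using not_less_Least[of "nat (n mod int d)" "\<lambda>d. d > 0 \<and> z [^] int d \<in> K"] d_def by force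
    then show "int d dvd n" by auto
  qed (rule d(2))
qed

text \<open>\<open>K\<close> is an extension of its image under \<open>r\<close> by the powers of
  \<open>z\<close> it contains. The extension splits: basis elements of the image lift to
  \<open>K\<close>, and as lifts differ from them by central factors they commute exactly when the
  originals do.\<close>

lemma subgroups_embed_cone:
  assumes IH: "subgroups_embed G W" shows "subgroups_embed G V"
  unfolding subgroups_embed_def
proof (intro allI impI, elim conjE)
  fix K assume K: "subgroup K G" "K \<subseteq> generate G V"
  obtain r where r: "\<And>g. g \<in> generate G V \<Longrightarrow> r g \<in> generate G W"
    "\<And>g h. g \<in> generate G V \<Longrightarrow> h \<in> generate G V \<Longrightarrow> r (g \<otimes> h) = r g \<otimes> r h"
    "\<And>g. g \<in> generate G V \<Longrightarrow> \<exists>k :: int. g = z [^] k \<otimes> r g"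
    "\<And>g. g \<in> generate G W \<Longrightarrow> r g = g" "\<And>k :: int. r (z [^] k) = \<one>"
    by (rule retraction) blast
  have rc: "r \<in> generate G V \<rightarrow> carrier G" using r(1) generate_in_carrier[OF W_carrier] by blast
  have "subgroup (r ` K) G"
  proof (rule subgroupI)
    have inv: "inv (r a) = r (inv a)" if "a \<in> K" for a
    proof -
      have a: "a \<in> generate G V" "inv a \<in> generate G V"
        using that K subgroup.m_inv_closed[OF K(1)] by auto
      have "r (inv a) \<otimes> r a = r \<one>" using r(2)[OF a(2,1)] a genV_carrier by simp
      then show ?thesis using r(5)[of 0] a rc by (intro inv_equality) auto
    qed
    show "inv a \<in> r ` K" if "a \<in> r ` K" for a
      using that inv subgroup.m_inv_closed[OF K(1)] by auto
    show "a \<otimes> b \<in> r ` K" if "a \<in> r ` K" "b \<in> r ` K" for a b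
    proof -
      obtain x y where xy: "x \<in> K" "y \<in> K" "a = r x" "b = r y" using \<open>a \<in> r ` K\<close> \<open>b \<in> r ` K\<close> by blast
      then have "a \<otimes> b = r (x \<otimes> y)" using r(2)[of x y] K(2) by (simp add: subsetD)
      then show ?thesis using subgroup.m_closed[OF K(1)] xy by blast
    qed
  qed (use rc K subgroup.one_closed[OF K(1)] in auto)
  moreover have "r ` K \<subseteq> generate G W" using r(1) K by blast
  ultimately have "\<exists>X e. pc_basis G X \<and> generate G X = r ` K \<and> cemb G e X \<and> e ` X \<subseteq> conjs G W"
    by (rule IH[unfolded subgroups_embed_def, rule_format, OF conjI])
  then obtain X e where X: "pc_basis G X" "generate G X = r ` K" and e: "cemb G e X" "e ` X \<subseteq> conjs G W"
    by (elim exE conjE)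
  have Xc: "X \<subseteq> carrier G" by (rule pc_basis_carrier[OF X(1)])
  have "\<forall>x\<in>X. \<exists>y. y \<in> K \<and> r y = x"
  proof
    fix x assume "x \<in> X"
    then have "x \<in> r ` K" using generate.incl[of x X G] X(2) by simp
    then show "\<exists>y. y \<in> K \<and> r y = x" by blast
  qed
  then obtain s where s: "\<And>x. x \<in> X \<Longrightarrow> s x \<in> K" "\<And>x. x \<in> X \<Longrightarrow> r (s x) = x" by metis
  have sV: "s x \<in> generate G V" if "x \<in> X" for x using s(1)[OF that] K by blast
  have scar: "s \<in> X \<rightarrow> carrier G" using sV genV_carrier by blast
  have s_comm: "comm G (s x) (s y) \<longleftrightarrow> comm G x y" if xy: "x \<in> X" "y \<in> X" for x y
  proof
    assume "comm G (s x) (s y)"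
    then have "r (s x \<otimes> s y) = r (s y \<otimes> s x)" by (simp add: comm_def)
    then show "comm G x y" using r(2) sV s(2) xy by (simp add: comm_def)
  next
    assume xy': "comm G x y"
    obtain k l :: int where k: "s x = z [^] k \<otimes> x" and l: "s y = z [^] l \<otimes> y"
      using r(3)[OF sV] s(2) xy by metis
    have c: "x \<in> carrier G" "y \<in> carrier G" "z [^] k \<in> carrier G" "z [^] l \<in> carrier G"
      using xy Xc z_carrier by auto
    have "x \<in> generate G V" using r(1)[OF sV[OF xy(1)]] s(2)[OF xy(1)] W_V by auto
    then have "comm G (z [^] l) x" by (rule z_pow_central)
    then have "comm G (s y) x" unfolding l using xy' c by (intro comm_mult) (simp_all add: comm_def)
    then have "comm G x (s y)" by (simp add: comm_def)
    moreover have "comm G (z [^] k) (s y)" by (rule z_pow_central[OF sV[OF xy(2)]])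
    ultimately show "comm G (s x) (s y)"
      unfolding k using c scar xy by (intro comm_mult) auto
  qed
  have s_inj: "inj_on s X" using s(2) by (metis inj_onI)
  have r_val: "r (word_val G s w) = word_val G id w" if "w \<in> words X" for w
  proof -
    have "r (word_val G s w) = word_val G (r \<circ> s) w"
      by (rule word_val_hom[OF is_group is_group scar subV _ rc r(2) that]) (use sV in auto)
    also have "\<dots> = word_val G id w" by (rule word_val_cong[OF that]) (simp add: s(2))
    finally show ?thesis .
  qed
  have r1: "r \<one> = \<one>" using r(5)[of 0] by simp
  have pc_basis_s: "pc_basis G (s ` X)"
    by (rule pc_basis_image[OF X(1) scar s_inj]) (use s_comm in blast, metis r_val r1)
  have gen_s: "generate G (s ` X) = word_val G s ` words X" by (rule generate_word_val[OF scar])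
  have gs_K: "generate G (s ` X) \<subseteq> K" by (rule generate_subgroup_incl[OF _ K(1)]) (use s(1) in auto)
  \<comment> \<open>A word with trivial image is trivial over \<open>X\<close>, and then its value
    under \<open>s\<close> is trivial because \<open>s\<close> respects commutation.\<close>
  have r_inj: "g = \<one>" if "g \<in> generate G (s ` X)" "r g = \<one>" for g
  proof -
    obtain w where w: "w \<in> words X" "g = word_val G s w" using \<open>g \<in> generate G (s ` X)\<close> gen_s by blast
    then have "word_val G id w = \<one>" using r_val \<open>r g = \<one>\<close> by simp
    then have "word_eq X (pc_relators (comm_graph G X)) w []" using X(1) w by (auto simp: pc_basis_def)
    then have "word_val G s w = word_val G s []"
      by (rule word_val_eq[OF _ scar]) (use s_comm in \<open>auto simp: edges_comm_graph\<close>)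
    then show ?thesis using w by simp
  qed
  obtain m :: int where m: "z [^] m \<in> K" "\<And>n :: int. z [^] n \<in> K \<Longrightarrow> m dvd n"
    by (rule powers_in_subgroup[OF K(1)]) blast
  \<comment> \<open>Dividing \<open>k\<close> by the lift \<open>h\<close> of \<open>r k\<close>
    leaves an element of \<open>K\<close> killed by \<open>r\<close>, hence a power of
    \<open>z\<close>, hence one of \<open>z [^] m\<close>.\<close>
  have split: "\<exists>q :: int. \<exists>h\<in>generate G (s ` X). k = (z [^] m) [^] q \<otimes> h" if k: "k \<in> K" for k
  proof -
    have kV: "k \<in> generate G V" using k K by blast
    have "r k \<in> generate G X" using k X(2) by blast
    then obtain w where w: "w \<in> words X" "r k = word_val G id w" using generate_word_val_id[OF Xc] by auto
    define h where "h = word_val G s w"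
    have h: "h \<in> generate G (s ` X)" "h \<in> K" "r h = r k" using gen_s gs_K w r_val by (auto simp: h_def)
    have hV: "h \<in> generate G V" "inv h \<in> generate G V" and kh: "k \<otimes> inv h \<in> K"
      using h K k subgroup.m_inv_closed[OF K(1)] subgroup.m_closed[OF K(1)] by blast+
    have "r (inv h) \<otimes> r h = \<one>" using r(2)[OF hV(2,1)] r1 hV genV_carrier by simp
    then have "r (inv h) = inv (r h)" using hV rc by (metis funcset_mem inv_equality)
    then have "r (k \<otimes> inv h) = \<one>" using r(2)[OF kV hV(2)] h(3) funcset_mem[OF rc kV] by simp
    moreover have khV: "k \<otimes> inv h \<in> generate G V" using kh K by blast
    ultimately obtain n :: int where n: "k \<otimes> inv h = z [^] n"
      using r(3)[OF khV] z_carrier by (metis int_pow_closed r_one)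
    then obtain q where q: "n = m * q" using m(2) kh by (metis dvdE)
    have "k = z [^] n \<otimes> h" using n kV hV genV_carrier by (metis inv_solve_right' m_closed inv_closed)
    then have "k = (z [^] m) [^] q \<otimes> h" using q z_carrier by (simp add: int_pow_pow)
    then show ?thesis using h by blast
  qed
  \<comment> \<open>For \<open>m = 0\<close> the element \<open>z [^] m\<close> would be
    \<open>\<one>\<close>, which no faithful set contains.\<close>
  define Y where "Y = (if m = 0 then s ` X else insert (z [^] m) (s ` X))"
  have YK: "Y \<subseteq> K" using s(1) m(1) by (auto simp: Y_def)
  have "generate G Y = K"
  proof
    show "generate G Y \<subseteq> K" by (rule generate_subgroup_incl[OF YK K(1)])
    show "K \<subseteq> generate G Y"
    proof
      fix k assume "k \<in> K"
      then obtain q :: int and h where k: "h \<in> generate G (s ` X)" "k = (z [^] m) [^] q \<otimes> h" using split by blast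
      have Yc: "subgroup (generate G Y) G" by (rule subgroup_generate) (use YK K(1) subgroup.subset in blast)
      have "s ` X \<subseteq> Y" by (auto simp: Y_def)
      then have "h \<in> generate G Y" using k(1) mono_generate by blast
      moreover have "z [^] m \<in> generate G Y" by (cases "m = 0") (auto simp: Y_def intro: generate.intros)
      then have "(z [^] m) [^] q \<in> generate G Y" by (rule subgroup_int_pow_closed[OF Yc])
      ultimately show "k \<in> generate G Y" unfolding k(2) by (intro generate.eng)
    qed
  qed
  moreover have e_r: "cemb G (e \<circ> r) (s ` X)"
    using e(1) s(2) s_comm s_inj unfolding cemb_def inj_on_def by auto
  have e_rW: "(e \<circ> r) ` s ` X \<subseteq> conjs G W" using e(2) s(2) by auto
  have "pc_basis G Y \<and> (\<exists>f. cemb G f Y \<and> f ` Y \<subseteq> conjs G V)"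
  proof (cases "m = 0")
    case True
    then have "Y = s ` X" by (simp add: Y_def)
    moreover have "(e \<circ> r) ` s ` X \<subseteq> conjs G V" using e_rW unfolding conjs_cone by blast
    ultimately show ?thesis using pc_basis_s e_r by blast
  next
    case False
    have zm: "z [^] m \<notin> s ` X"
    proof
      assume "z [^] m \<in> s ` X"
      then obtain x where "x \<in> X" "z [^] m = s x" by blast
      then have "\<one> \<in> X" using s(2) r(5) by metis
      then show False using pc_basis_not_one[OF X(1)] by blast
    qed
    have zc: "comm G (z [^] m) x" if "x \<in> s ` X" for x using that sV z_pow_central by blast
    have "pc_basis G Y" unfolding Y_def if_not_P[OF False]
    proof (rule pc_basis_insert[OF pc_basis_s _ zm zc])
      show "z [^] m \<in> carrier G" using z_carrier by simp
      fix k :: int assume "(z [^] m) [^] k \<in> generate G (s ` X)"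
      then have "z [^] (m * k) \<in> generate G (s ` X)" using z_carrier by (simp add: int_pow_pow)
      then have "z [^] (m * k) = \<one>" using r_inj r(5) by blast
      then have "m * k = 0" by (rule z_pow_eq_one)
      then show "k = 0" using False by simp
    qed
    moreover have "cemb G ((e \<circ> r)(z [^] m := z)) Y" unfolding Y_def if_not_P[OF False]
      by (rule cemb_insert[OF e_r _ zm zc]) (use e_rW conjs_W in blast)
    moreover have "((e \<circ> r)(z [^] m := z)) ` Y \<subseteq> conjs G V"
      using e_rW zm False unfolding Y_def conjs_cone by auto
    ultimately show ?thesis by blast
  qed
  ultimately show "\<exists>X e. pc_basis G X \<and> generate G X = K \<and> cemb G e X \<and> e ` X \<subseteq> conjs G V" by blast
qed

end

subsection \<open>A disconnected commutation graph\<close>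

context group
begin

lemma pc_basis_empty: "pc_basis G {}"
  unfolding pc_basis_def by (auto simp: words_def intro: word_eq.refl)

lemma pc_basis_singleton:
  assumes "x \<in> carrier G" "\<And>n :: int. x [^] n = \<one> \<Longrightarrow> n = 0"
  shows "pc_basis G {x}"
  by (rule pc_basis_insert[OF pc_basis_empty]) (use assms generate_empty in auto)

lemma generate_UN:
  assumes "\<And>j. j \<in> J \<Longrightarrow> generate G (X j) = B j" "\<And>j. j \<in> J \<Longrightarrow> X j \<subseteq> carrier G"
  shows "generate G (\<Union>j\<in>J. X j) = generate G (\<Union>j\<in>J. B j)"
proof
  have XB: "X j \<subseteq> B j" if "j \<in> J" for j
    using assms(1)[OF that] generate.incl[of _ "X j" G] by blast
  show "generate G (\<Union>j\<in>J. X j) \<subseteq> generate G (\<Union>j\<in>J. B j)"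
    by (rule mono_generate) (use XB in blast)
  have "B j \<subseteq> generate G (\<Union>j\<in>J. X j)" if "j \<in> J" for j
    unfolding assms(1)[OF that, symmetric] by (rule mono_generate) (use that in blast)
  then show "generate G (\<Union>j\<in>J. B j) \<subseteq> generate G (\<Union>j\<in>J. X j)"
    by (intro generate_subgroup_incl subgroup_generate) (use assms(2) in blast)+
qed

end

context split_group
begin

text \<open>Numbering \<open>J\<close> injectively assigns to each index its own conjugate of the
  prescribed factor; countability of \<open>J\<close> is what makes the supply sufficient.\<close>

lemma free_conjugates:
  fixes J :: "'j set"
  assumes "countable J"
  shows "\<exists>u. (\<forall>j. u j \<in> M) \<and> free_family G J (\<lambda>j. conj_by (u j) ` A (\<iota> j))"
proof -
  obtain u :: "bool \<Rightarrow> nat \<Rightarrow> 'g" where u: "\<And>i n. u i n \<in> M"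
    and free_u: "free_family G UNIV (\<lambda>(i, n). conj_by (u i n) ` A i)"
    using infinite_free_family by blast
  obtain n :: "'j \<Rightarrow> nat" where n: "inj_on n J" using assms by (rule countableE)
  have "free_family G J (\<lambda>j. (\<lambda>a. inv (u (\<iota> j) (n j)) \<otimes> a \<otimes> u (\<iota> j) (n j)) ` A (\<iota> j))"
    by (rule free_family_mono[OF free_u, of "\<lambda>j. (\<iota> j, n j)"]) (use n in \<open>auto simp: inj_on_def\<close>)
  then show ?thesis using u by (intro exI[of _ "\<lambda>j. u (\<iota> j) (n j)"]) simp
qed

lemma UV_carrier: "(\<Union>i. V i) \<subseteq> carrier G"
  using V_carrier by blast

lemma V_one: "\<one> \<notin> V i"
  using pc_basis_not_one[OF pc_basis_V] by blast

lemma conjs_A: "conjs G (V i) \<subseteq> A i"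
  unfolding A_def by (rule conjs_generate[OF V_carrier])

lemma conjs_V_one: "\<one> \<notin> conjs G (V i)"
  by (rule one_not_conjs[OF V_carrier V_one])

text \<open>Each Kurosh factor of \<open>K\<close> gets a basis and a commutation embedding
  separately. The images are then conjugated into a free family, so that different pieces fail to
  commute on the target side as they do in \<open>K\<close>.\<close>

lemma subgroups_embed_split:
  assumes countable: "\<And>i. countable (V i)" and IH: "\<And>i. subgroups_embed G (V i)"
  shows "subgroups_embed G (\<Union>i. V i)"
  unfolding subgroups_embed_def
proof (intro allI impI, elim conjE)
  fix K assume K: "subgroup K G" "K \<subseteq> generate G (\<Union>i. V i)"
  then have KM: "K \<subseteq> M" by (simp add: M_def)
  let ?C = "(\<lambda>g. g <# K) ` M"
  interpret F: free_product_action G A M ?C "\<lambda>g x. g <# x" K vv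
    by (rule free_product_action_coset[OF K(1) KM])
  have H: "F.H = K" by (rule coset_stabiliser[OF K(1) KM])
  have "\<exists>X e i. pc_basis G X \<and> generate G X = F.factor j \<and> cemb G e X \<and> e ` X \<subseteq> conjs G (V i)"
    if j: "j \<in> F.J" for j
    using j
  proof (cases rule: F.J_cases)
    case (vertex i x)
    \<comment> \<open>Conjugation by \<open>inv t\<close> moves the vertex factor into
      \<open>A i\<close>, where the induction hypothesis applies; the basis found there is
      conjugated back.\<close>
    define t where "t = F.tau i (F.base i x)"
    have tc: "t \<in> carrier G" unfolding t_def using vertex by simp
    let ?B = "F.factor j" let ?L = "conj_by (inv t) ` ?B"
    have B: "subgroup ?B G" by (rule F.sub_factor[OF j])
    then have Bc: "?B \<subseteq> carrier G" by (rule subgroup.subset)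
    have "subgroup ?L G" by (rule subgroup_conj[OF _ B]) (use tc in simp)
    moreover have "?L \<subseteq> generate G (V i)" using tc by (auto simp: vertex t_def[symmetric] A_def)
    ultimately have "\<exists>X e. pc_basis G X \<and> generate G X = ?L \<and> cemb G e X \<and> e ` X \<subseteq> conjs G (V i)"
      by (rule IH[unfolded subgroups_embed_def, rule_format, OF conjI])
    then obtain X e where X: "pc_basis G X" "generate G X = ?L" and e: "cemb G e X" "e ` X \<subseteq> conjs G (V i)"
      by (elim exE conjE)
    have Xc: "X \<subseteq> carrier G" by (rule pc_basis_carrier[OF X(1)])
    let ?X = "conj_by t ` X"
    have "generate G ?X = conj_by t ` ?L" using generate_conj[OF tc Xc] X(2) by simp
    also have "\<dots> = (\<lambda>h. h) ` ?B" unfolding image_image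
    proof (rule image_cong)
      fix h assume "h \<in> ?B"
      then show "inv t \<otimes> (conj_by (inv t) h) \<otimes> t = h" using conj_cancel(2)[OF tc, of h] Bc tc by auto
    qed simp
    finally have gen: "generate G ?X = ?B" by simp
    have cancel_t: "t \<otimes> (conj_by t x) \<otimes> inv t = x" if "x \<in> X" for x
      using conj_cancel(1)[OF tc] that Xc by blast
    have "cemb G (conj_by (inv t)) ?X"
      by (rule cemb_conj) (use tc Xc in auto)
    moreover have img: "conj_by (inv t) ` ?X = X"
      using cancel_t tc by (simp add: image_image)
    ultimately have "cemb G (e \<circ> (conj_by (inv t))) ?X"
      by (intro cemb_comp) (use e in auto)
    moreover have "(e \<circ> (conj_by (inv t))) ` ?X \<subseteq> conjs G (V i)"
      unfolding image_comp[symmetric] img by (rule e(2))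
    ultimately show ?thesis using pc_basis_conj[OF X(1) tc] gen by blast
  next
    case (loop i x)
    let ?f = "F.edge i x"
    have fc: "?f \<in> carrier G" using F.H_carrier[OF F.edge_H[OF loop(2)]] .
    \<comment> \<open>A cyclic factor contributes a single vertex, which any generator can
      represent; the choice of the piece \<open>True\<close> is arbitrary.\<close>
    obtain v where v: "v \<in> V True" using V_nonempty by blast
    have "pc_basis G {?f}" by (rule pc_basis_singleton[OF fc F.edge_infinite_order[OF loop(2,3)]])
    moreover have "generate G {?f} = F.factor j" using generate_pow[OF fc] by (auto simp: loop)
    moreover have "cemb G (\<lambda>_. v) {?f}" by (simp add: cemb_def)
    moreover have "(\<lambda>_. v) ` {?f} \<subseteq> conjs G (V True)" using v subset_conjs[OF V_carrier] by auto
    ultimately show ?thesis by blast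
  qed
  \<comment> \<open>The basis, the embedding and the piece are packed into one tuple so that a
    single use of choice makes all three functions of \<open>j\<close>.\<close>
  then have "\<forall>j\<in>F.J. \<exists>p. pc_basis G (fst p) \<and> generate G (fst p) = F.factor j \<and>
      cemb G (fst (snd p)) (fst p) \<and> fst (snd p) ` fst p \<subseteq> conjs G (V (snd (snd p)))"
    unfolding split_paired_Ex fst_conv snd_conv by (rule ballI)
  then obtain p where p: "\<forall>j\<in>F.J. pc_basis G (fst (p j)) \<and> generate G (fst (p j)) = F.factor j \<and>
      cemb G (fst (snd (p j))) (fst (p j)) \<and>
      fst (snd (p j)) ` fst (p j) \<subseteq> conjs G (V (snd (snd (p j))))"
    by (rule bchoice[THEN exE])
  define X e \<iota> where "X j = fst (p j)" and "e j = fst (snd (p j))" and "\<iota> j = snd (snd (p j))" for j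
  have X: "\<And>j. j \<in> F.J \<Longrightarrow> pc_basis G (X j)" "\<And>j. j \<in> F.J \<Longrightarrow> generate G (X j) = F.factor j"
    and e: "\<And>j. j \<in> F.J \<Longrightarrow> cemb G (e j) (X j)" "\<And>j. j \<in> F.J \<Longrightarrow> e j ` X j \<subseteq> conjs G (V (\<iota> j))"
    using p by (simp_all add: X_def e_def \<iota>_def)
  have XB: "X j \<subseteq> F.factor j" and Xc: "X j \<subseteq> carrier G" if "j \<in> F.J" for j
    using X(2)[OF that] generate.incl[of _ "X j" G] pc_basis_carrier[OF X(1)[OF that]] by auto
  have "countable M" unfolding M_def by (rule countable_generate) (use countable UV_carrier in auto)
  then have "countable (Inl ` (UNIV \<times> ?C) \<union> Inr ` (UNIV \<times> ?C) :: ((bool \<times> 'g set) + (bool \<times> 'g set)) set)"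
    by (intro countable_Un countable_image countable_SIGMA) auto
  moreover have "F.J \<subseteq> Inl ` (UNIV \<times> ?C) \<union> Inr ` (UNIV \<times> ?C)"
  proof
    fix j assume "j \<in> F.J"
    then show "j \<in> Inl ` (UNIV \<times> ?C) \<union> Inr ` (UNIV \<times> ?C)"
      by (cases rule: F.J_cases) (auto simp del: F.base_C intro: F.base_C)
  qed
  ultimately have "countable F.J" by (rule countable_subset[rotated])
  then obtain u where u: "\<And>j. u j \<in> M"
    and free_U: "free_family G F.J (\<lambda>j. conj_by (u j) ` A (\<iota> j))"
    using free_conjugates by blast
  have uc: "u j \<in> carrier G" for j using u F.M_carrier by blast
  define U where "U j = conj_by (u j) ` A (\<iota> j)" for j
  define e' where "e' j x = inv (u j) \<otimes> e j x \<otimes> u j" for j x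
  note free_U = free_U[folded U_def]
  have subU: "subgroup (U j) G" for j unfolding U_def by (rule subgroup_conj[OF uc subA])
  have e'U: "e' j x \<in> U j" "e' j x \<noteq> \<one>" "e' j x \<in> conjs G (\<Union>i. V i)" if j: "j \<in> F.J" and x: "x \<in> X j" for j x
  proof -
    have ex: "e j x \<in> conjs G (V (\<iota> j))" using e(2)[OF j] x by blast
    then have exA: "e j x \<in> A (\<iota> j)" "e j x \<noteq> \<one>" using conjs_A conjs_V_one by auto
    then show "e' j x \<in> U j" unfolding e'_def U_def by blast
    show "e' j x \<noteq> \<one>"
      using conj_eq_iff[OF uc, of "e j x" \<one>] exA F.A_carrier uc by (auto simp: e'_def)
    show "e' j x \<in> conjs G (\<Union>i. V i)" unfolding e'_def
      by (rule conjs_conj[OF ex _ UV_carrier]) (use u in \<open>auto simp: M_def\<close>)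
  qed
  have "\<exists>f. cemb G f (\<Union>j\<in>F.J. X j) \<and> (\<forall>j\<in>F.J. \<forall>x\<in>X j. f x = e' j x)"
  proof (rule cemb_Union)
    show "cemb G (e' j) (X j)" if "j \<in> F.J" for j
      unfolding e'_def
      by (rule cemb_conj_comp[OF e(1)[OF that] _ uc])
        (use e(2)[OF that] conjs_A[of "\<iota> j"] F.A_carrier in blast)
    show "\<not> comm G x y" if "j \<in> F.J" "k \<in> F.J" "j \<noteq> k" "x \<in> X j" "y \<in> X k" for j k x y
    proof (rule free_family_not_comm[OF F.free_factors that(1-3)])
      show "x \<noteq> \<one>" "y \<noteq> \<one>" using that pc_basis_not_one X(1) by blast+
    qed (use that XB F.sub_factor in blast)+
    show "\<not> comm G (e' j x) (e' k y)" if "j \<in> F.J" "k \<in> F.J" "j \<noteq> k" "x \<in> X j" "y \<in> X k" for j k x y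
      by (rule free_family_not_comm[OF free_U that(1-3) subU subU]) (use e'U that in blast)+
  qed
  then obtain f where f: "cemb G f (\<Union>j\<in>F.J. X j)" "\<forall>j\<in>F.J. \<forall>x\<in>X j. f x = e' j x" by blast
  have "pc_basis G (\<Union>j\<in>F.J. X j)" by (rule pc_basis_Union[OF F.free_factors F.sub_factor X(1) XB])
  moreover have "generate G (\<Union>j\<in>F.J. X j) = K"
    using generate_UN[of F.J X F.factor, OF X(2) Xc] F.generate_factors H by simp
  moreover have "f ` (\<Union>j\<in>F.J. X j) \<subseteq> conjs G (\<Union>i. V i)" using f(2) e'U(3) by auto
  ultimately show "\<exists>X e. pc_basis G X \<and> generate G X = K \<and> cemb G e X \<and> e ` X \<subseteq> conjs G (\<Union>i. V i)"
    using f(1) by blast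
qed

text \<open>The extension graph of a free product is a disjoint union of copies of the extension
  graphs of the factors, one for each right coset of \<open>A i\<close>; by malnormality no edge
  joins different copies. Each copy is embedded by the induction hypothesis and moved to its own
  free conjugate.\<close>

lemma extension_embeds_split:
  assumes countable: "\<And>i. countable (V i)" and IH: "\<And>i. extension_embeds G (V i)"
  shows "extension_embeds G (\<Union>i. V i)"
proof -
  note Mc = subgroup.mem_carrier[OF subM] and Ac = subgroup.mem_carrier[OF subA]
  note M_closed = subgroup.m_closed[OF subM] subgroup.m_inv_closed[OF subM] subgroup.one_closed[OF subM]
  obtain e where e: "\<And>i. cemb G (e i) (conjs G (V i))" "\<And>i. e i ` conjs G (V i) \<subseteq> A i"
    "\<And>i. pc_basis G (e i ` conjs G (V i))"
    using IH unfolding extension_embeds_def A_def by metis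
  \<comment> \<open>Conjugating \<open>conjs G (V i)\<close> by an element of \<open>A i\<close>
    leaves it unchanged, so its conjugate by \<open>g\<close> depends on the coset
    \<open>A i #> g\<close> alone. The tag \<open>i\<close> keeps cosets of different factors
    apart.\<close>
  define J where "J = {(i, A i #> g) | i g. g \<in> M}"
  define r where "r j = (SOME g. g \<in> M \<and> snd j = A (fst j) #> g)" for j
  have r: "r j \<in> M" "snd j = A (fst j) #> r j" if "j \<in> J" for j
  proof -
    have "\<exists>g. g \<in> M \<and> snd j = A (fst j) #> g" using that by (auto simp: J_def)
    then have "r j \<in> M \<and> snd j = A (fst j) #> r j" unfolding r_def by (rule someI_ex)
    then show "r j \<in> M" "snd j = A (fst j) #> r j" by auto
  qed
  have rc: "r j \<in> carrier G" if "j \<in> J" for j using r(1)[OF that] Mc by blast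
  define W where "W j = conj_by (r j) ` conjs G (V (fst j))" for j
  have cc: "conjs G (V i) \<subseteq> carrier G" for i using conjs_A Ac by blast
  have W_Un: "conjs G (\<Union>i. V i) = (\<Union>j\<in>J. W j)"
  proof (intro equalityI subsetI)
    fix w assume "w \<in> conjs G (\<Union>i. V i)"
    then obtain i v g where v: "v \<in> V i" "g \<in> M" "w = conj_by g v" by (auto simp: conjs_def M_def)
    define j where "j = (i, A i #> g)"
    have j: "j \<in> J" using v by (auto simp: J_def j_def)
    have "\<one> \<otimes> r j \<in> A i #> r j" unfolding r_coset_def using subgroup.one_closed[OF subA] by blast
    then have "r j \<in> A i #> g" using r(2)[OF j] rc[OF j] by (simp add: j_def)
    then obtain a where a: "a \<in> A i" "r j = a \<otimes> g" by (auto simp: r_coset_def)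
    have c: "a \<in> carrier G" "g \<in> carrier G" "v \<in> carrier G" using a v Ac Mc subsetD[OF V_carrier] by auto
    have "conj_by (inv a) v \<in> conjs G (V i)"
      unfolding conjs_def using v(1) subgroup.m_inv_closed[OF subA a(1)] by (auto simp: A_def)
    moreover have "w = inv (r j) \<otimes> (conj_by (inv a) v) \<otimes> r j"
      using c by (simp add: v(3) a(2) inv_mult_group m_assoc)
    ultimately have "w \<in> W j" unfolding W_def by (auto simp: j_def)
    then show "w \<in> (\<Union>j\<in>J. W j)" using j by blast
  next
    fix w assume "w \<in> (\<Union>j\<in>J. W j)"
    then obtain j y where j: "j \<in> J" "y \<in> conjs G (V (fst j))" "w = conj_by (r j) y" by (auto simp: W_def)
    show "w \<in> conjs G (\<Union>i. V i)" unfolding j(3)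
      by (rule conjs_conj[OF j(2) _ UV_carrier]) (use r(1)[OF j(1)] in \<open>auto simp: M_def\<close>)
  qed
  have W_across: "\<not> comm G x y" if jk: "j \<in> J" "k \<in> J" "j \<noteq> k" and x: "x \<in> W j" and y: "y \<in> W k" for j k x y
  proof
    assume c: "comm G x y"
    obtain a where a: "a \<in> conjs G (V (fst j))" "x = conj_by (r j) a" using x by (auto simp: W_def)
    obtain b where b: "b \<in> conjs G (V (fst k))" "y = conj_by (r k) b" using y by (auto simp: W_def)
    \<comment> \<open>Undoing the conjugation by \<open>r j\<close> brings the pair into the form
      required by \<open>comm_factors\<close>; the resulting membership of \<open>s\<close> says
      that \<open>r j\<close> and \<open>r k\<close> represent the same coset.\<close>
    define s where "s = r j \<otimes> inv (r k)"
    have sM: "s \<in> M" using r(1) jk M_closed by (simp add: s_def)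
    have ab: "a \<in> A (fst j)" "a \<noteq> \<one>" "b \<in> A (fst k)" "b \<noteq> \<one>" using a b conjs_A conjs_V_one by auto
    have car: "a \<in> carrier G" "b \<in> carrier G" "r j \<in> carrier G" "r k \<in> carrier G" "s \<in> carrier G"
      using ab Ac rc jk sM Mc by auto
    have "y = conj_by (r j) (s \<otimes> b \<otimes> inv s)"
      using car by (simp add: b(2) s_def inv_mult_group m_assoc)
    then have "comm G a (s \<otimes> b \<otimes> inv s)"
      using c a(2) comm_conj_iff[of "r j" a "s \<otimes> b \<otimes> inv s"] car by simp
    then have *: "fst j = fst k" "s \<in> A (fst k)" using comm_factors[OF ab sM] by auto
    have "A (fst k) #> r j = A (fst k) #> (s \<otimes> r k)" using car by (simp add: s_def m_assoc)
    also have "\<dots> = A (fst k) #> s #> r k"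
      using car subgroup.subset[OF subA] by (simp add: coset_mult_assoc)
    also have "A (fst k) #> s = A (fst k)" by (rule coset_join2[OF car(5) subA *(2)])
    finally have "snd j = snd k" using r(2) jk * by simp
    then show False using * jk(3) by (simp add: prod_eq_iff)
  qed
  have "countable M" unfolding M_def by (rule countable_generate) (use countable UV_carrier in auto)
  then have "countable ((\<lambda>(i, g). (i, A i #> g)) ` (UNIV \<times> M))" by (intro countable_image countable_SIGMA) auto
  moreover have "J \<subseteq> (\<lambda>(i, g). (i, A i #> g)) ` (UNIV \<times> M)" by (auto simp: J_def)
  ultimately have "countable J" by (rule countable_subset[rotated])
  then obtain u where u: "\<And>j. u j \<in> M"
    and free_U: "free_family G J (\<lambda>j. conj_by (u j) ` A (fst j))"
    using free_conjugates by blast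
  have uc: "u j \<in> carrier G" for j using u Mc by blast
  define U where "U j = conj_by (u j) ` A (fst j)" for j
  \<comment> \<open>\<open>pull j\<close> returns a copy to \<open>conjs G (V (fst j))\<close> and
    embeds it there; \<open>e' j\<close> then moves the result into the free conjugate reserved for
    \<open>j\<close>.\<close>
  define pull where "pull j w = e (fst j) (r j \<otimes> w \<otimes> inv (r j))" for j w
  define e' where "e' j w = inv (u j) \<otimes> pull j w \<otimes> u j" for j w
  note free_U = free_U[folded U_def]
  have subU: "subgroup (U j) G" for j unfolding U_def by (rule subgroup_conj[OF uc subA])
  have W_img: "(\<lambda>w. inv (inv (r j)) \<otimes> w \<otimes> inv (r j)) ` W j = conjs G (V (fst j))" if j: "j \<in> J" for j
  proof -
    have "inv (inv (r j)) \<otimes> (conj_by (r j) y) \<otimes> inv (r j) = y" if "y \<in> conjs G (V (fst j))" for y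
      using conj_cancel(1)[OF rc[OF j], of y] that cc rc[OF j] by auto
    then show ?thesis unfolding W_def image_image by simp
  qed
  have Wc: "W j \<subseteq> carrier G" if "j \<in> J" for j using cc rc[OF that] by (auto simp: W_def)
  have pull_eq: "pull j = e (fst j) \<circ> (\<lambda>w. inv (inv (r j)) \<otimes> w \<otimes> inv (r j))" if "j \<in> J" for j
    using rc[OF that] by (simp add: pull_def fun_eq_iff)
  have pull_cemb: "cemb G (pull j) (W j)" if "j \<in> J" for j
    unfolding pull_eq[OF that]
    by (rule cemb_comp[OF cemb_conj]) (use rc[OF that] Wc[OF that] W_img[OF that] e(1) in auto)
  have pull_img: "pull j ` W j = e (fst j) ` conjs G (V (fst j))" if "j \<in> J" for j
    unfolding pull_eq[OF that] image_comp[symmetric] W_img[OF that] ..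
  have e'_img: "e' j ` W j = conj_by (u j) ` (e (fst j) ` conjs G (V (fst j)))"
    if "j \<in> J" for j
  proof -
    have "e' j = (conj_by (u j)) \<circ> pull j"
      by (simp add: e'_def fun_eq_iff)
    then show ?thesis by (simp only: image_comp[symmetric] pull_img[OF that])
  qed
  have e'_pcb: "pc_basis G (e' j ` W j)" if "j \<in> J" for j
    unfolding e'_img[OF that] by (rule pc_basis_conj[OF e(3) uc])
  have e'U: "e' j ` W j \<subseteq> U j" if "j \<in> J" for j
    unfolding e'_img[OF that] U_def using e(2) by blast
  have "\<exists>f. cemb G f (\<Union>j\<in>J. W j) \<and> (\<forall>j\<in>J. \<forall>x\<in>W j. f x = e' j x)"
  proof (rule cemb_Union)
    show "cemb G (e' j) (W j)" if "j \<in> J" for j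
      unfolding e'_def
      by (rule cemb_conj_comp[OF pull_cemb[OF that] _ uc])
        (unfold pull_img[OF that], use e(2) Ac in blast)
    show "\<not> comm G (e' j x) (e' k y)" if "j \<in> J" "k \<in> J" "j \<noteq> k" "x \<in> W j" "y \<in> W k" for j k x y
    proof (rule free_family_not_comm[OF free_U that(1-3) subU subU])
      show "e' j x \<in> U j" "e' k y \<in> U k" using e'U that by blast+
      have "e' j x \<in> e' j ` W j" "e' k y \<in> e' k ` W k" using that by simp_all
      then show "e' j x \<noteq> \<one>" "e' k y \<noteq> \<one>"
        using pc_basis_not_one[OF e'_pcb[OF that(1)]] pc_basis_not_one[OF e'_pcb[OF that(2)]] by metis+
    qed
  qed (rule W_across)
  then obtain f where f: "cemb G f (\<Union>j\<in>J. W j)" "\<forall>j\<in>J. \<forall>x\<in>W j. f x = e' j x" by blast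
  have img: "f ` (\<Union>j\<in>J. W j) = (\<Union>j\<in>J. e' j ` W j)" using f(2) by (simp add: image_UN)
  have "pc_basis G (\<Union>j\<in>J. e' j ` W j)" by (rule pc_basis_Union[OF free_U subU e'_pcb e'U])
  moreover have UM: "U j \<subseteq> M" for j
    unfolding U_def using subsetD[OF A_M] u M_closed(1,2) by (simp add: image_subset_iff)
  have "(\<Union>j\<in>J. e' j ` W j) \<subseteq> M" by (intro UN_least subset_trans[OF e'U UM])
  ultimately show ?thesis unfolding extension_embeds_def W_Un M_def[symmetric]
    using f(1) img by (intro exI[of _ f]) simp
qed

end

section \<open>Thin-chordal commutation graphs\<close>

text \<open>The last hypothesis leaves open whether \<open>a\<close> and \<open>d\<close> commute
  and so excludes the path and the 4-cycle at once. It holds automatically when two of the four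
  elements coincide, \<open>comm\<close> being reflexive.\<close>

lemma (in group) embeddings_thin_chordal:
  assumes "finite V" "pc_basis G V"
    and "\<And>a b c d. {a, b, c, d} \<subseteq> V \<Longrightarrow> comm G a b \<Longrightarrow> comm G b c \<Longrightarrow> comm G c d \<Longrightarrow>
      comm G a c \<or> comm G b d"
  shows "subgroups_embed G V \<and> extension_embeds G V"
  using assms
proof (induction "card V" arbitrary: V rule: less_induct)
  case (less V)
  note fin = less.prems(1) and pc_basis = less.prems(2) and thin = less.prems(3)
  have IH: "subgroups_embed G W \<and> extension_embeds G W" if "W \<subset> V" for W
  proof (rule less.hyps)
    show "card W < card V" by (rule psubset_card_mono[OF fin that])
    show "finite W" "pc_basis G W" using that fin pc_basis by (auto intro: finite_subset pc_basis_mono)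
    show "comm G a c \<or> comm G b d"
      if "{a, b, c, d} \<subseteq> W" "comm G a b" "comm G b c" "comm G c d" for a b c d
      using thin[of a b c d] \<open>W \<subset> V\<close> that by auto
  qed
  show ?case
  proof (cases "V = {}")
    case True
    have "subgroups_embed G V" unfolding subgroups_embed_def
    proof (intro allI impI, elim conjE)
      fix K assume K: "subgroup K G" "K \<subseteq> generate G V"
      then have "K = {\<one>}" using True generate_empty subgroup.one_closed[OF K(1)] by auto
      then show "\<exists>X e. pc_basis G X \<and> generate G X = K \<and> cemb G e X \<and> e ` X \<subseteq> conjs G V"
        using pc_basis_empty generate_empty by (intro exI[of _ "{}"]) (auto simp: cemb_def)
    qed
    moreover have "extension_embeds G V"
      unfolding extension_embeds_def using True pc_basis_empty by (auto simp: conjs_def cemb_def)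
    ultimately show ?thesis by blast
  next
    case False
    \<comment> \<open>Closed neighbourhoods, again by reflexivity of \<open>comm\<close>;
      \<open>N z = V\<close> says that \<open>z\<close> is a cone point.\<close>
    define N where "N x = {y \<in> V. comm G x y}" for x
    have finN: "finite (N x)" for x using fin by (simp add: N_def)
    let ?c = "(\<lambda>x. card (N x)) ` V"
    have "Max ?c \<in> ?c" using fin False by (intro Max_in) auto
    then obtain z where z: "z \<in> V" "card (N z) = Max ?c" by auto
    have z_max: "card (N y) \<le> card (N z)" if "y \<in> V" for y
      unfolding z(2) by (rule Max_ge) (use fin that in auto)
    show ?thesis
    proof (cases "N z = V")
      case True
      have V: "insert z (V - {z}) = V" using z by blast
      interpret cone: cone_group G z "V - {z}"
        by unfold_locales (use True V pc_basis in \<open>auto simp: N_def\<close>)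
      have "V - {z} \<subset> V" using z by blast
      from IH[OF this] show ?thesis
        using cone.subgroups_embed_cone cone.extension_embeds_cone unfolding cone.V_def V by blast
    next
      case False
      \<comment> \<open>\<open>N z\<close> is then a union of components: an edge leaving it from \<open>y\<close> would, as \<open>z\<close> has
        maximal degree, complete to an induced \<open>P\<^sub>3\<close> or \<open>C\<^sub>4\<close>.\<close>
      have across: "\<not> comm G y w" if y: "y \<in> N z" and w: "w \<in> V - N z" for y w
      proof
        assume yw: "comm G y w"
        have yV: "y \<in> V" "comm G z y" and wV: "w \<in> V" "\<not> comm G z w" using y w by (auto simp: N_def)
        have "\<not> N z \<subseteq> N y"
        proof
          assume "N z \<subseteq> N y"
          moreover have "w \<in> N y" "w \<notin> N z" using yw wV by (auto simp: N_def)
          ultimately have "N z \<subset> N y" by blast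
          then show False using psubset_card_mono[OF finN] z_max[OF yV(1)] by (metis not_less)
        qed
        then obtain x where x: "x \<in> V" "comm G z x" "\<not> comm G y x" by (auto simp: N_def)
        have "comm G x y \<or> comm G z w"
          using thin[of x z y w] x yV wV z(1) yw comm_sym[of G x z] by auto
        then show False using x(3) wV comm_sym[of G x y] by auto
      qed
      define S where "S i = (if i then N z else V - N z)" for i
      have S: "(\<Union>i. S i) = V" by (auto simp: S_def N_def split: if_splits)
      have S_ne: "S i \<noteq> {}" for i
        using z(1) False by (auto simp: S_def N_def)
      interpret split: split_group G S
      proof
        show "pc_basis G (\<Union>i. S i)" using pc_basis S by simp
        show "\<not> comm G x y" if "x \<in> S i" "y \<in> S j" "i \<noteq> j" for x y i j
          using that across[of x y] across[of y x] comm_sym[of G x y] by (auto simp: S_def split: if_splits)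
      qed (rule S_ne)
      have "S i \<subset> V" for i using S_ne[of "\<not> i"] by (cases i) (auto simp: S_def N_def)
      then have IH': "subgroups_embed G (S i) \<and> extension_embeds G (S i)" and "countable (S i)" for i
        using IH fin by (auto intro: countable_finite finite_subset)
      then show ?thesis
        using split.subgroups_embed_split split.extension_embeds_split by (simp add: S)
    qed
  qed
qed

subsection \<open>The canonical generators\<close>

text \<open>Two test homomorphisms. For non-adjacent \<open>x\<close> and \<open>y\<close>, send
  them to the non-commuting transpositions \<open>(0 1)\<close> and \<open>(1 2)\<close> and all
  other vertices to the identity: every edge then has an end that is sent to the identity.
  Distinctness is detected by the exponent of \<open>x\<close> in the integers.\<close>

lemma pc_gen_inj_comm:
  assumes \<Gamma>: "simple_graph \<Gamma>" and xy: "x \<in> verts \<Gamma>" "y \<in> verts \<Gamma>" "x \<noteq> y"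
  shows "pc_gen \<Gamma> x \<noteq> pc_gen \<Gamma> y"
    and "comm (pc_group \<Gamma>) (pc_gen \<Gamma> x) (pc_gen \<Gamma> y) \<longleftrightarrow> {x, y} \<in> edges \<Gamma>"
proof -
  let ?V = "verts \<Gamma>" and ?R = "pc_relators \<Gamma>"
  let ?B = "BijGroup (UNIV :: nat set)"
  interpret B: group ?B by (rule group_BijGroup)
  interpret P: group "pc_group \<Gamma>" by (rule group_pc_group)
  have gc: "pc_gen \<Gamma> z \<in> carrier (pc_group \<Gamma>)" if "z \<in> ?V" for z
    using pc_gen_closed[of \<Gamma>] that by blast
  define s where "s = (\<lambda>n :: nat. if n = 0 then 1 else if n = 1 then 0 else n)"
  define t where "t = (\<lambda>n :: nat. if n = 1 then 2 else if n = 2 then 1 else n)"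
  have st: "s \<in> carrier ?B" "t \<in> carrier ?B"
  proof -
    have "s (s n) = n" "t (t n) = n" for n by (auto simp: s_def t_def)
    then have "bij s" "bij t" by (metis bijI')+
    then show "s \<in> carrier ?B" "t \<in> carrier ?B" by (simp_all add: BijGroup_def Bij_def)
  qed
  have mult: "g \<otimes>\<^bsub>?B\<^esub> h = g \<circ> h" if "g \<in> carrier ?B" "h \<in> carrier ?B" for g h
    using that by (auto simp: BijGroup_def compose_def fun_eq_iff)
  have "(s \<circ> t) 0 = 1" "(t \<circ> s) 0 = 2" by (simp_all add: s_def t_def)
  then have "s \<circ> t \<noteq> t \<circ> s" by (metis numeral_eq_one_iff semiring_norm(85))
  then have nc: "\<not> comm ?B s t" using st by (simp add: comm_def mult)
  define f where "f z = (if z = x then s else if z = y then t else \<one>\<^bsub>?B\<^esub>)" for z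
  have f: "f \<in> ?V \<rightarrow> carrier ?B" using st by (auto simp: f_def)
  have eq: "word_val ?B f u = word_val ?B f w"
    if "word_class ?V ?R u = word_class ?V ?R w" "u \<in> words ?V"
      "{x, y} \<notin> edges \<Gamma>" for u w
  proof (rule B.word_val_eq[OF _ f])
    show "word_eq ?V ?R u w" using that by (simp add: word_class_eq_iff)
    fix a b assume ab: "{a, b} \<in> edges \<Gamma>"
    then have "a \<noteq> b" using \<Gamma> by (auto simp: simple_graph_def)
    then have "\<not> ({a, b} = {x, y})" using ab that(3) by metis
    then have "(a \<noteq> x \<and> a \<noteq> y) \<or> (b \<noteq> x \<and> b \<noteq> y)" using \<open>a \<noteq> b\<close> by blast
    then show "comm ?B (f a) (f b)" using st by (auto simp: f_def comm_def)
  qed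
  show "comm (pc_group \<Gamma>) (pc_gen \<Gamma> x) (pc_gen \<Gamma> y) \<longleftrightarrow> {x, y} \<in> edges \<Gamma>"
  proof
    assume c: "comm (pc_group \<Gamma>) (pc_gen \<Gamma> x) (pc_gen \<Gamma> y)"
    show "{x, y} \<in> edges \<Gamma>"
    proof (rule ccontr)
      assume "{x, y} \<notin> edges \<Gamma>"
      moreover have "word_class ?V ?R [(x, True), (y, True)] = word_class ?V ?R [(y, True), (x, True)]"
        using c xy by (simp add: comm_def pc_gen_def mult_pc_group)
      ultimately have "word_val ?B f [(x, True), (y, True)] = word_val ?B f [(y, True), (x, True)]"
        by (intro eq) (use xy in simp_all)
      then have "comm ?B (f x) (f y)" using f xy by (simp add: comm_def Pi_iff)
      then show False using nc xy by (simp add: f_def)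
    qed
  qed (rule pc_gen_comm[OF _ xy(1,2)])
  show "pc_gen \<Gamma> x \<noteq> pc_gen \<Gamma> y"
  proof
    assume e: "pc_gen \<Gamma> x = pc_gen \<Gamma> y"
    interpret I: group integer_group by simp
    have "word_eq ?V ?R [(x, True)] [(y, True)]"
      using e xy by (simp add: pc_gen_def word_class_eq_iff)
    then have "word_val integer_group (\<lambda>z. if z = x then 1 else 0) [(x, True)] =
        word_val integer_group (\<lambda>z. if z = x then 1 else 0) [(y, True)]"
      by (rule I.word_val_eq) (auto simp: comm_def)
    then show False using xy by simp
  qed
qed

text \<open>The starting point of the induction: by \<open>word_val_pc_gen\<close> the value of a
  word at the generators is its class, and injectivity of \<open>pc_gen\<close> transfers this to
  words whose letters are group elements.\<close>

lemma pc_basis_pc_gen: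
  assumes \<Gamma>: "simple_graph \<Gamma>"
  shows "pc_basis (pc_group \<Gamma>) (pc_gen \<Gamma> ` verts \<Gamma>)"
    and "generate (pc_group \<Gamma>) (pc_gen \<Gamma> ` verts \<Gamma>) = carrier (pc_group \<Gamma>)"
proof -
  let ?V = "verts \<Gamma>" and ?R = "pc_relators \<Gamma>" and ?P = "pc_group \<Gamma>" and ?g = "pc_gen \<Gamma>"
  interpret P: group ?P by (rule group_pc_group)
  have "generate ?P (?g ` ?V) = word_val ?P ?g ` words ?V" by (rule P.generate_word_val[OF pc_gen_closed])
  also have "\<dots> = word_class ?V ?R ` words ?V" by (rule image_cong[OF HOL.refl word_val_pc_gen])
  finally show "generate ?P (?g ` ?V) = carrier ?P" by (simp add: carrier_pc_group)
  have inj: "inj_on ?g ?V" using pc_gen_inj_comm(1)[OF \<Gamma>] by (auto simp: inj_on_def)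
  define h where "h = the_inv_into ?V ?g"
  have h: "h (?g x) = x" if "x \<in> ?V" for x unfolding h_def by (rule the_inv_into_f_f[OF inj that])
  show "pc_basis ?P (?g ` ?V)" unfolding pc_basis_def
  proof (intro conjI ballI impI)
    show "?g ` ?V \<subseteq> carrier ?P" using pc_gen_closed[of \<Gamma>] by blast
    fix w assume w: "w \<in> words (?g ` ?V)" "word_val ?P id w = \<one>\<^bsub>?P\<^esub>"
    have hw: "map (apfst h) w \<in> words ?V" by (rule words_map[OF w(1)]) (auto simp: h)
    have gw: "map (apfst ?g) (map (apfst h) w) = w" using w(1) by (induction w) (auto simp: h)
    have "word_val ?P ?g (map (apfst h) w) = \<one>\<^bsub>?P\<^esub>"
      using w(2) gw word_val_map[of ?P id ?g "map (apfst h) w"] by simp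
    then have "word_eq ?V ?R (map (apfst h) w) []"
      using hw by (simp add: word_val_pc_gen one_pc_group word_class_eq_iff)
    then have "word_eq (?g ` ?V) (pc_relators (comm_graph ?P (?g ` ?V))) (map (apfst ?g) (map (apfst h) w)) (map (apfst ?g) [])"
    proof (rule word_eq_map)
      fix x y assume xy: "x \<in> ?V" "y \<in> ?V" "{x, y} \<in> edges \<Gamma>"
      then have "x \<noteq> y" using \<Gamma> by (auto simp: simple_graph_def)
      then show "{?g x, ?g y} \<in> edges (comm_graph ?P (?g ` ?V))"
        using xy pc_gen_inj_comm[OF \<Gamma> xy(1,2)] by (simp add: edges_comm_graph)
    qed simp
    then show "word_eq (?g ` ?V) (pc_relators (comm_graph ?P (?g ` ?V))) w []" by (simp only: gw list.map)
  qed
qed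

text \<open>Without a chord the four vertices would induce a 4-cycle or a path, according to whether
  \<open>{a, d}\<close> is an edge.\<close>

lemma thin_chordal_path:
  assumes \<Gamma>: "simple_graph \<Gamma>" and thin: "thin_chordal \<Gamma>"
    and V: "a \<in> verts \<Gamma>" "b \<in> verts \<Gamma>" "c \<in> verts \<Gamma>" "d \<in> verts \<Gamma>" and dist: "distinct [a, b, c, d]"
    and e: "{a, b} \<in> edges \<Gamma>" "{b, c} \<in> edges \<Gamma>" "{c, d} \<in> edges \<Gamma>"
  shows "{a, c} \<in> edges \<Gamma> \<or> {b, d} \<in> edges \<Gamma>"
proof (rule ccontr)
  assume non: "\<not> ?thesis"
  have loop: "{x} \<notin> edges \<Gamma>" for x using \<Gamma> by (auto simp: simple_graph_def)
  define f where "f n = (if n = (0::nat) then a else if n = 1 then b else if n = 2 then c else d)" for n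
  have f: "f 0 = a" "f (Suc 0) = b" "f 2 = c" "f 3 = d" by (simp_all add: f_def)
  have four: "{..<4} = {0, Suc 0, 2, 3 :: nat}" "{..3} = {0, Suc 0, 2, 3 :: nat}" by auto
  have bij: "bij_betw f {0, Suc 0, 2, 3} {a, b, c, d}"
    using dist by (auto simp: bij_betw_def inj_on_def f)
  have ec: "edges (cycle_graph 4) = {{0, Suc 0}, {Suc 0, 2}, {2, 3}, {3, 0}}"
  proof -
    have "edges (cycle_graph 4) = (\<lambda>i. {i, (i + 1) mod 4}) ` {..<4}" by (auto simp: cycle_graph_def)
    moreover have "(0 + 1) mod 4 = Suc 0" "(Suc 0 + 1) mod 4 = 2" "(2 + 1) mod 4 = (3 :: nat)" "(3 + 1) mod 4 = (0 :: nat)"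
      by simp_all
    ultimately show ?thesis unfolding four by (simp only: image_insert image_empty)
  qed
  have ep: "edges (path_graph 3) = {{0, Suc 0}, {Suc 0, 2}, {2, 3}}"
  proof -
    have "edges (path_graph 3) = (\<lambda>i. {i, i + 1}) ` {..<3}" by (auto simp: path_graph_def)
    moreover have "{..<3} = {0, Suc 0, 2 :: nat}" by auto
    moreover have "0 + 1 = Suc 0" "Suc 0 + 1 = 2" "2 + 1 = (3 :: nat)" by simp_all
    ultimately show ?thesis by (simp only: image_insert image_empty)
  qed
  have sym: "{b, a} \<in> edges \<Gamma>" "{c, b} \<in> edges \<Gamma>" "{d, c} \<in> edges \<Gamma>" "{c, a} \<notin> edges \<Gamma>" "{d, b} \<notin> edges \<Gamma>"
    "{d, a} \<in> edges \<Gamma> \<longleftrightarrow> {a, d} \<in> edges \<Gamma>"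
    using e non by (simp_all add: insert_commute)
  have induced: "induced_subgraph \<Delta> \<Gamma>"
    if \<Delta>: "simple_graph \<Delta>" "verts \<Delta> = {0, Suc 0, 2, 3}"
      "\<And>i j. i \<in> {0, Suc 0, 2, 3} \<Longrightarrow> j \<in> {0, Suc 0, 2, 3} \<Longrightarrow>
        {i, j} \<in> edges \<Delta> \<longleftrightarrow> {f i, f j} \<in> edges (full_subgraph \<Gamma> {a, b, c, d})" for \<Delta>
  proof -
    have "graph_isomorphic \<Delta> (full_subgraph \<Gamma> {a, b, c, d})"
      unfolding graph_isomorphic_def \<Delta>(2) using bij \<Delta>(3)
      by (intro exI[of _ f] conjI ballI) (simp_all add: full_subgraph_def)
    then show ?thesis unfolding induced_subgraph_def using V \<Delta>(1)
      by (intro conjI exI[of _ "{a, b, c, d}"]) auto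
  qed
  show False
  proof (cases "{a, d} \<in> edges \<Gamma>")
    case True
    have "induced_subgraph (cycle_graph 4) \<Gamma>"
    proof (rule induced[OF simple_graph_cycle_graph_4])
      show "verts (cycle_graph 4) = {0, Suc 0, 2, 3}" by (simp add: cycle_graph_def four)
      fix i j :: nat assume ij: "i \<in> {0, Suc 0, 2, 3}" "j \<in> {0, Suc 0, 2, 3}"
      show "{i, j} \<in> edges (cycle_graph 4) \<longleftrightarrow> {f i, f j} \<in> edges (full_subgraph \<Gamma> {a, b, c, d})"
        unfolding ec using ij non
        by (elim insertE emptyE; simp add: full_subgraph_def f doubleton_eq_iff e sym True loop)
    qed
    then show False using thin by (simp add: thin_chordal_def)
  next
    case False
    have "induced_subgraph (path_graph 3) \<Gamma>"
    proof (rule induced[OF simple_graph_path_graph])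
      show "verts (path_graph 3) = {0, Suc 0, 2, 3}" by (simp add: path_graph_def four)
      fix i j :: nat assume ij: "i \<in> {0, Suc 0, 2, 3}" "j \<in> {0, Suc 0, 2, 3}"
      show "{i, j} \<in> edges (path_graph 3) \<longleftrightarrow> {f i, f j} \<in> edges (full_subgraph \<Gamma> {a, b, c, d})"
        unfolding ep using ij non
        by (elim insertE emptyE; simp add: full_subgraph_def f doubleton_eq_iff e sym False loop)
    qed
    then show False using thin by (simp add: thin_chordal_def)
  qed
qed

lemma extension_graph_comm_graph:
  assumes "simple_graph \<Gamma>"
  shows "verts (extension_graph \<Gamma>) = conjs (pc_group \<Gamma>) (pc_gen \<Gamma> ` verts \<Gamma>)"
    and "{u, v} \<in> edges (extension_graph \<Gamma>) \<longleftrightarrow> u \<in> verts (extension_graph \<Gamma>) \<and>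
      v \<in> verts (extension_graph \<Gamma>) \<and> u \<noteq> v \<and> comm (pc_group \<Gamma>) u v"
proof -
  let ?P = "pc_group \<Gamma>"
  interpret P: group ?P by (rule group_pc_group)
  show V: "verts (extension_graph \<Gamma>) = conjs ?P (pc_gen \<Gamma> ` verts \<Gamma>)"
    by (auto simp: extension_graph_def extension_verts_def conjs_def pc_basis_pc_gen(2)[OF assms])
  have c: "commutator ?P u v = \<one>\<^bsub>?P\<^esub> \<longleftrightarrow> comm ?P u v"
    if "u \<in> carrier ?P" "v \<in> carrier ?P" for u v
  proof -
    have "commutator ?P u v = inv\<^bsub>?P\<^esub> (v \<otimes>\<^bsub>?P\<^esub> u) \<otimes>\<^bsub>?P\<^esub> (u \<otimes>\<^bsub>?P\<^esub> v)"
      using that by (simp add: commutator_def P.inv_mult_group P.m_assoc)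
    then show ?thesis using that by (simp add: comm_def P.inv_solve_left')
  qed
  have vc: "extension_verts \<Gamma> \<subseteq> carrier ?P"
    using pc_gen_closed[of \<Gamma>] by (auto simp: extension_verts_def)
  show "{u, v} \<in> edges (extension_graph \<Gamma>) \<longleftrightarrow> u \<in> verts (extension_graph \<Gamma>) \<and>
      v \<in> verts (extension_graph \<Gamma>) \<and> u \<noteq> v \<and> comm ?P u v"
  proof
    assume "{u, v} \<in> edges (extension_graph \<Gamma>)"
    then obtain a b where ab: "{u, v} = {a, b}" "a \<in> extension_verts \<Gamma>" "b \<in> extension_verts \<Gamma>" "a \<noteq> b"
      "commutator ?P a b = \<one>\<^bsub>?P\<^esub>" by (auto simp: extension_graph_def)
    then have "comm ?P a b" using c[OF subsetD[OF vc] subsetD[OF vc]] by simp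
    then have "comm ?P a b" "comm ?P b a" using comm_sym[of ?P a b] by simp_all
    then show "u \<in> verts (extension_graph \<Gamma>) \<and> v \<in> verts (extension_graph \<Gamma>) \<and> u \<noteq> v \<and> comm ?P u v"
      using ab by (auto simp: extension_graph_def doubleton_eq_iff)
  next
    assume "u \<in> verts (extension_graph \<Gamma>) \<and> v \<in> verts (extension_graph \<Gamma>) \<and> u \<noteq> v \<and> comm ?P u v"
    moreover from this have "commutator ?P u v = \<one>\<^bsub>?P\<^esub>"
      using c[OF subsetD[OF vc] subsetD[OF vc]] by (simp add: extension_graph_def)
    ultimately show "{u, v} \<in> edges (extension_graph \<Gamma>)" by (auto simp: extension_graph_def)
  qed
qed

theorem theorem5p1:
  fixes \<Gamma> :: "'a sgraph" and H :: "('h, 'm) monoid_scheme"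
  assumes "finite_graph \<Gamma>" and "thin_chordal \<Gamma>" and "group H"
  shows "(\<exists>K. subgroup K (pc_group \<Gamma>) \<and> H \<cong> (pc_group \<Gamma>)\<lparr>carrier := K\<rparr>) \<longleftrightarrow>
         (\<exists>\<Gamma>' :: 'a word set sgraph.
            induced_subgraph \<Gamma>' (extension_graph \<Gamma>) \<and> H \<cong> pc_group \<Gamma>')"
proof -
  let ?P = "pc_group \<Gamma>" and ?V = "pc_gen \<Gamma> ` verts \<Gamma>" and ?E = "extension_graph \<Gamma>"
  interpret P: group ?P by (rule group_pc_group)
  have \<Gamma>: "simple_graph \<Gamma>" "finite (verts \<Gamma>)" using assms(1) by (auto simp: finite_graph_def)
  note gens = pc_basis_pc_gen[OF \<Gamma>(1)] and ext = extension_graph_comm_graph[OF \<Gamma>(1)]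
  have thin: "comm ?P p r \<or> comm ?P q s"
    if V: "{p, q, r, s} \<subseteq> ?V" and c: "comm ?P p q" "comm ?P q r" "comm ?P r s" for p q r s
  proof (rule ccontr)
    assume non: "\<not> ?thesis"
    have "p \<in> ?V" "q \<in> ?V" "r \<in> ?V" "s \<in> ?V" using V by auto
    then obtain a b c' d where v: "a \<in> verts \<Gamma>" "b \<in> verts \<Gamma>" "c' \<in> verts \<Gamma>" "d \<in> verts \<Gamma>"
      and pq: "p = pc_gen \<Gamma> a" "q = pc_gen \<Gamma> b" "r = pc_gen \<Gamma> c'" "s = pc_gen \<Gamma> d"
      by (elim imageE)
    \<comment> \<open>Any coincidence among the four would make one of the two denied pairs
      commute.\<close>
    have "distinct [p, q, r, s]"
      using non c comm_sym[of ?P p q] comm_sym[of ?P r s] comm_sym[of ?P q r] by auto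
    then have dist: "distinct [a, b, c', d]" using pq by auto
    then have e: "{a, b} \<in> edges \<Gamma>" "{b, c'} \<in> edges \<Gamma>" "{c', d} \<in> edges \<Gamma>"
      "{a, c'} \<notin> edges \<Gamma>" "{b, d} \<notin> edges \<Gamma>"
      using c non v pc_gen_inj_comm(2)[OF \<Gamma>(1)] by (auto simp: pq)
    show False using thin_chordal_path[OF \<Gamma>(1) assms(2) v dist e(1-3)] e(4,5) by blast
  qed
  have embed: "subgroups_embed ?P ?V" "extension_embeds ?P ?V"
    using P.embeddings_thin_chordal[OF _ gens(1) thin] \<Gamma>(2) by auto
  show ?thesis
  proof
    assume "\<exists>K. subgroup K ?P \<and> H \<cong> ?P\<lparr>carrier := K\<rparr>"
    then obtain K where K: "subgroup K ?P" "H \<cong> ?P\<lparr>carrier := K\<rparr>" by blast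
    have "K \<subseteq> generate ?P ?V" using K(1) subgroup.subset gens(2) by blast
    then obtain X e where X: "pc_basis ?P X" "generate ?P X = K" and e: "cemb ?P e X" "e ` X \<subseteq> conjs ?P ?V"
      using embed(1) K(1) unfolding subgroups_embed_def by metis
    \<comment> \<open>The vertices of this graph are elements of \<open>?P\<close>, so it has the
      type required of \<open>\<Gamma>'\<close>; \<open>e\<close> exhibits it as an induced
      subgraph.\<close>
    have "pc_group (comm_graph ?P X) \<cong> ?P\<lparr>carrier := K\<rparr>"
      using P.pc_basis_iso[OF X(1), of id "comm_graph ?P X"] X(2) by (simp add: edges_comm_graph bij_betw_def)
    then have "?P\<lparr>carrier := K\<rparr> \<cong> pc_group (comm_graph ?P X)"
      using group.iso_sym[OF group_pc_group] by blast
    then have "H \<cong> pc_group (comm_graph ?P X)" by (rule iso_trans[OF K(2)])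
    moreover have "graph_isomorphic (comm_graph ?P X) (full_subgraph ?E (e ` X))"
      unfolding graph_isomorphic_def
    proof (intro exI[of _ e] conjI ballI)
      show "bij_betw e (verts (comm_graph ?P X)) (verts (full_subgraph ?E (e ` X)))"
        using e(1) by (simp add: cemb_def full_subgraph_def bij_betw_def)
      fix x y assume xy: "x \<in> verts (comm_graph ?P X)" "y \<in> verts (comm_graph ?P X)"
      then have "comm ?P (e x) (e y) \<longleftrightarrow> comm ?P x y" "e x = e y \<longleftrightarrow> x = y"
        using e(1) by (auto simp: cemb_def inj_on_def)
      moreover have "e x \<in> verts ?E" "e y \<in> verts ?E" using xy e(2) ext(1) by auto
      ultimately show "{x, y} \<in> edges (comm_graph ?P X) \<longleftrightarrow> {e x, e y} \<in> edges (full_subgraph ?E (e ` X))"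
        using xy ext(2) by (auto simp: edges_comm_graph full_subgraph_def)
    qed
    then have "induced_subgraph (comm_graph ?P X) ?E"
      unfolding induced_subgraph_def using e(2) ext(1) simple_graph_comm_graph by blast
    ultimately show "\<exists>\<Gamma>' :: 'a word set sgraph. induced_subgraph \<Gamma>' ?E \<and> H \<cong> pc_group \<Gamma>'"
      by (intro exI[of _ "comm_graph ?P X"] conjI)
  next
    assume "\<exists>\<Gamma>' :: 'a word set sgraph. induced_subgraph \<Gamma>' ?E \<and> H \<cong> pc_group \<Gamma>'"
    then obtain \<Gamma>' :: "'a word set sgraph" and W and f where W: "W \<subseteq> conjs ?P ?V"
      and f: "bij_betw f (verts \<Gamma>') W"
        "\<And>x y. x \<in> verts \<Gamma>' \<Longrightarrow> y \<in> verts \<Gamma>' \<Longrightarrow>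
          {x, y} \<in> edges \<Gamma>' \<longleftrightarrow> {f x, f y} \<in> edges (full_subgraph ?E W)"
      and H: "H \<cong> pc_group \<Gamma>'"
      unfolding induced_subgraph_def graph_isomorphic_def ext(1) by (auto simp: full_subgraph_def)
    obtain e where e: "cemb ?P e (conjs ?P ?V)" "pc_basis ?P (e ` conjs ?P ?V)"
      using embed(2) by (auto simp: extension_embeds_def)
    \<comment> \<open>\<open>e\<close> carries the chosen vertices of the extension graph into a
      faithful set, so their images generate a copy of \<open>pc_group \<Gamma>'\<close>, although
      the vertices themselves need not.\<close>
    have "pc_basis ?P (e ` W)" by (rule P.pc_basis_mono[OF e(2)]) (use W in blast)
    moreover have "bij_betw (e \<circ> f) (verts \<Gamma>') (e ` W)"
      by (rule bij_betw_trans[OF f(1)])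
        (use e(1) W in \<open>auto simp: cemb_def bij_betw_def intro: inj_on_subset\<close>)
    moreover have "{x, y} \<in> edges \<Gamma>' \<longleftrightarrow> (e \<circ> f) x \<noteq> (e \<circ> f) y \<and> comm ?P ((e \<circ> f) x) ((e \<circ> f) y)"
      if xy: "x \<in> verts \<Gamma>'" "y \<in> verts \<Gamma>'" for x y
    proof -
      have fW: "f x \<in> W" "f y \<in> W" using f(1) xy by (auto simp: bij_betw_def)
      then have v: "f x \<in> conjs ?P ?V" "f y \<in> conjs ?P ?V" using W by auto
      then have "comm ?P (e (f x)) (e (f y)) \<longleftrightarrow> comm ?P (f x) (f y)" "e (f x) = e (f y) \<longleftrightarrow> f x = f y"
        using e(1) by (auto simp: cemb_def inj_on_def)
      then show ?thesis using f(2)[OF xy] fW v ext by (auto simp: full_subgraph_def)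
    qed
    ultimately have "pc_group \<Gamma>' \<cong> ?P\<lparr>carrier := generate ?P (e ` W)\<rparr>" by (rule P.pc_basis_iso)
    then have "H \<cong> ?P\<lparr>carrier := generate ?P (e ` W)\<rparr>" by (rule iso_trans[OF H])
    moreover have "subgroup (generate ?P (e ` W)) ?P"
      by (rule P.subgroup_generate) (rule pc_basis_carrier[OF \<open>pc_basis ?P (e ` W)\<close>])
    ultimately show "\<exists>K. subgroup K ?P \<and> H \<cong> ?P\<lparr>carrier := K\<rparr>" by blast
  qed
qed

end
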